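(* Let $C>1$, $\beta=\int\phi<\infty$, $0<z\le\min\{Ce^{-C\beta},2Ce^{-2C\beta}\}$, and assume $\bar\phi:=\sup_{x\in\mathbb R^d}\phi(x)<\infty$. Then for every $G\in\mathcal L_{2C}$, $t\ge0$, $\varepsilon>0$, $$\|\hat T_{\varepsilon,\mathrm{ren}}(t)G-\hat T_V(t)G\|_C\le\varepsilon t\,\bar\phi(1+\beta)\|G\|_{2C}.$$ In particular $\hat T_{\varepsilon,\mathrm{ren}}(t)G\to\hat T_V(t)G$ in $\mathcal L_C$ as $\varepsilon\to0$ for every $G\in\mathcal L_C$, uniformly for $t$ in bounded intervals.
   Context: $\Gamma_0$: finite subsets of $\mathbb R^d$ with Lebesgue–Poisson measure $\lambda=\sum_{n\ge0}\frac1{n!}m^{(n)}$ ($m^{(0)}=\delta_\emptyset$, $m^{(n)}$ the image of Lebesgue measure on $n$-tuples of distinct points). $|\eta|$ cardinality, $\xi\cup x:=\xi\cup\{x\}$. $e_\lambda(f,\eta)=\prod_{x\in\eta}f(x)$, $e_\lambda(f,\emptyset)=1$. $\mathcal L_C$: measurable $G$ with $\|G\|_C=\int|G(\eta)|C^{|\eta|}d\lambda(\eta)<\infty$. $\phi:\mathbb R^d\to[0,\infty)$ even measurable. $(L_1G)(\eta)=-|\eta|G(\eta)$; $(L_{2,\varepsilon}G)(\eta)=z\sum_{\xi\subset\eta}\int e_\lambda(e^{-\varepsilon\phi(x-\cdot)},\xi)e_\lambda\big(\tfrac{e^{-\varepsilon\phi(x-\cdot)}-1}{\varepsilon},\eta\setminus\xi\big)G(\xi\cup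 x)dx$; $(L_2^VG)(\eta)=z\sum_{\xi\subset\eta}\int G(\xi\cup x)e_\lambda(-\phi(x-\cdot),\eta\setminus\xi)dx$; $\hat L_{\varepsilon,\mathrm{ren}}=L_1+L_{2,\varepsilon}$, $\hat L_V=L_1+L_2^V$ on domain $\mathcal L_{2C}$. Under the stated hypotheses these operators are closable in $\mathcal L_C$ and their closures generate strongly continuous contraction semigroups on $\mathcal L_C$, denoted $\hat T_{\varepsilon,\mathrm{ren}}(t)$ and $\hat T_V(t)$ respectively. *)

theory Defs
  imports "HOL-Analysis.Analysis"
begin

text \<open>Configurations (elements of Gamma_0) are finite sets of points of an
  Euclidean space 'a (playing the role of R^d).  Functions on Gamma_0 are
  functions 'a set => real; only their values on finite sets matter.\<close>

text \<open>n-th term of the Lebesgue--Poisson measure: image of Lebesgue measure on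
  n-tuples of distinct points.  The Lebesgue--Poisson integral of a nonnegative
  function F is sum_n 1/n! int F({x_0..x_(n-1)}) dm^(n).\<close>

definition LP_nn_integral :: "('a::euclidean_space set \<Rightarrow> ennreal) \<Rightarrow> ennreal" where
  "LP_nn_integral F =
     (\<Sum>n. ennreal (1 / fact n) *
        (\<integral>\<^sup>+ x. F (x ` {..<n}) * indicator {x. inj_on x {..<n}} x
           \<partial>(PiM {..<n} (\<lambda>_. lborel))))"

definition LP_measurable :: "('a::euclidean_space set \<Rightarrow> real) \<Rightarrow> bool" where
  "LP_measurable G \<longleftrightarrow>
     (\<forall>n::nat. (\<lambda>x. G (x ` {..<n})) \<in> borel_measurable (PiM {..<n} (\<lambda>_. lborel)))"

definition LC_norm :: "real \<Rightarrow> ('a::euclidean_space set \<Rightarrow> real) \<Rightarrow> real" where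
  "LC_norm C G = enn2real (LP_nn_integral (\<lambda>\<eta>. ennreal (\<bar>G \<eta>\<bar> * C ^ card \<eta>)))"

definition LC :: "real \<Rightarrow> ('a::euclidean_space set \<Rightarrow> real) set" where
  "LC C = {F. LP_measurable F \<and> LP_nn_integral (\<lambda>\<eta>. ennreal (\<bar>F \<eta>\<bar> * C ^ card \<eta>)) < \<infinity>}"

definition e_lam :: "('a \<Rightarrow> real) \<Rightarrow> 'a set \<Rightarrow> real" where
  "e_lam f \<eta> = (\<Prod>x\<in>\<eta>. f x)"

definition L1 :: "('a set \<Rightarrow> real) \<Rightarrow> 'a set \<Rightarrow> real" where
  "L1 G \<eta> = - real (card \<eta>) * G \<eta>"

definition L2eps :: "real \<Rightarrow> ('a::euclidean_space \<Rightarrow> real) \<Rightarrow> real \<Rightarrow>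
    ('a set \<Rightarrow> real) \<Rightarrow> 'a set \<Rightarrow> real" where
  "L2eps z \<phi> \<epsilon> G \<eta> = z * (\<Sum>\<xi>\<in>Pow \<eta>.
      \<integral>x. e_lam (\<lambda>y. exp (- \<epsilon> * \<phi> (x - y))) \<xi> *
           e_lam (\<lambda>y. (exp (- \<epsilon> * \<phi> (x - y)) - 1) / \<epsilon>) (\<eta> - \<xi>) *
           G (insert x \<xi>) \<partial>lborel)"

definition L2V :: "real \<Rightarrow> ('a::euclidean_space \<Rightarrow> real) \<Rightarrow>
    ('a set \<Rightarrow> real) \<Rightarrow> 'a set \<Rightarrow> real" where
  "L2V z \<phi> G \<eta> = z * (\<Sum>\<xi>\<in>Pow \<eta>.
      \<integral>x. G (insert x \<xi>) * e_lam (\<lambda>y. - \<phi> (x - y)) (\<eta> - \<xi>) \<partial>lborel)"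

definition L_ren :: "real \<Rightarrow> ('a::euclidean_space \<Rightarrow> real) \<Rightarrow> real \<Rightarrow>
    ('a set \<Rightarrow> real) \<Rightarrow> 'a set \<Rightarrow> real" where
  "L_ren z \<phi> \<epsilon> G \<eta> = L1 G \<eta> + L2eps z \<phi> \<epsilon> G \<eta>"

definition L_V :: "real \<Rightarrow> ('a::euclidean_space \<Rightarrow> real) \<Rightarrow>
    ('a set \<Rightarrow> real) \<Rightarrow> 'a set \<Rightarrow> real" where
  "L_V z \<phi> G \<eta> = L1 G \<eta> + L2V z \<phi> G \<eta>"

text \<open>Since L_C consists of functions (not a.e.-classes), everything below is
  up to the seminorm: f and g represent the same element iff LC_norm C (f - g) = 0.\<close>

definition closure_graph ::
  "real \<Rightarrow> (('a::euclidean_space set \<Rightarrow> real) \<Rightarrow> ('a set \<Rightarrow> real)) \<Rightarrow>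
   ('a set \<Rightarrow> real) set \<Rightarrow> ('a set \<Rightarrow> real) \<Rightarrow> ('a set \<Rightarrow> real) \<Rightarrow> bool" where
  "closure_graph C L D f g \<longleftrightarrow> f \<in> LC C \<and> g \<in> LC C \<and>
     (\<exists>u. (\<forall>n. u n \<in> D) \<and>
          (\<lambda>n. LC_norm C (\<lambda>\<eta>. u n \<eta> - f \<eta>)) \<longlonglongrightarrow> 0 \<and>
          (\<lambda>n. LC_norm C (\<lambda>\<eta>. L (u n) \<eta> - g \<eta>)) \<longlonglongrightarrow> 0)"

definition generator_graph ::
  "real \<Rightarrow> (real \<Rightarrow> ('a::euclidean_space set \<Rightarrow> real) \<Rightarrow> ('a set \<Rightarrow> real)) \<Rightarrow>
   ('a set \<Rightarrow> real) \<Rightarrow> ('a set \<Rightarrow> real) \<Rightarrow> bool" where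
  "generator_graph C T f g \<longleftrightarrow> f \<in> LC C \<and> g \<in> LC C \<and>
     ((\<lambda>h. LC_norm C (\<lambda>\<eta>. (T h f \<eta> - f \<eta>) / h - g \<eta>)) \<longlongrightarrow> 0) (at_right 0)"

definition contraction_C0_semigroup ::
  "real \<Rightarrow> (real \<Rightarrow> ('a::euclidean_space set \<Rightarrow> real) \<Rightarrow> ('a set \<Rightarrow> real)) \<Rightarrow> bool" where
  "contraction_C0_semigroup C T \<longleftrightarrow>
     (\<forall>t\<ge>0. \<forall>f\<in>LC C. T t f \<in> LC C) \<and>
     (\<forall>t\<ge>0. \<forall>f\<in>LC C. \<forall>g\<in>LC C. \<forall>a b.
        LC_norm C (\<lambda>\<eta>. T t (\<lambda>\<zeta>. a * f \<zeta> + b * g \<zeta>) \<eta> - (a * T t f \<eta> + b * T t g \<eta>)) = 0) \<and>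
     (\<forall>f\<in>LC C. LC_norm C (\<lambda>\<eta>. T 0 f \<eta> - f \<eta>) = 0) \<and>
     (\<forall>s\<ge>0. \<forall>t\<ge>0. \<forall>f\<in>LC C. LC_norm C (\<lambda>\<eta>. T (s + t) f \<eta> - T s (T t f) \<eta>) = 0) \<and>
     (\<forall>t\<ge>0. \<forall>f\<in>LC C. LC_norm C (T t f) \<le> LC_norm C f) \<and>
     (\<forall>f\<in>LC C. ((\<lambda>h. LC_norm C (\<lambda>\<eta>. T h f \<eta> - f \<eta>)) \<longlongrightarrow> 0) (at_right 0))"

definition generates ::
  "real \<Rightarrow> (('a::euclidean_space set \<Rightarrow> real) \<Rightarrow> ('a set \<Rightarrow> real)) \<Rightarrow> ('a set \<Rightarrow> real) set \<Rightarrow>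
   (real \<Rightarrow> ('a set \<Rightarrow> real) \<Rightarrow> ('a set \<Rightarrow> real)) \<Rightarrow> bool" where
  "generates C L D T \<longleftrightarrow> contraction_C0_semigroup C T \<and>
     (\<forall>f g. generator_graph C T f g \<longleftrightarrow> closure_graph C L D f g)"

end

theory Submission
  imports Defs
begin

text \<open>
  Write \<open>A\<close> for the Vlasov operator restricted to configurations with at most \<open>m\<close> points.  The smallness
  of \<open>z\<close> makes the birth part no larger than the death part in \<open>LC C\<close> and in \<open>LC (2 * C)\<close>, so for
  \<open>h * m \<le> 1\<close> the explicit Euler step \<open>1 + h A\<close> is a contraction of both spaces.  Along the Euler scheme
  started in \<open>G\<close> the norm of \<open>LC (2 * C)\<close> therefore stays below that of \<open>G\<close>; on such functions the error
  of replacing the Vlasov operator by \<open>A\<close> is \<open>O(1 / m)\<close> in \<open>LC C\<close>, and the renormalised operator differs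
  from the Vlasov operator by \<open>O(\<epsilon>)\<close>.  Hence the scheme approximates both semigroups, and comparing the
  two errors as \<open>h \<rightarrow> 0\<close> and \<open>m \<rightarrow> \<infinity>\<close> gives the estimate, without having to show that \<open>T_V t\<close> preserves
  \<open>LC (2 * C)\<close>.  The convergence on all of \<open>LC C\<close> follows by density.
\<close>

section \<open>Tuples and configurations\<close>

text \<open>All norm bounds are read off from the masses of the \<open>n\<close>-point layers. In a
  birth term the points of \<open>\<eta> - \<xi>\<close> are integrated out one by one; summed over
  their number they give \<open>exp (C * \<beta>)\<close>, while the newborn point raises the kept
  block from \<open>p\<close> to \<open>p + 1\<close> points and leaves a factor
  \<open>p + 1\<close>. With \<open>z * exp (C * \<beta>) \<le> C\<close> the coefficient of layer
  \<open>n\<close> is therefore at most \<open>n * C ^ n\<close>, the same as for deaths. The two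
  bounds on \<open>z\<close> are this statement for \<open>C\<close> and for \<open>2 * C\<close>.
  Passing from \<open>C\<close> to \<open>2 * C\<close> gains \<open>2 ^ n\<close>, which pays for
  the factors polynomial in \<open>n\<close> that come from the unbounded generator and from
  comparing kernels. Two obstacles shape the preparations. Birth operators can be analysed only on
  tuples without repetitions, whereas \<open>LP_measurable\<close> concerns all tuples; and they are
  additive only almost everywhere, because a divergent integral has the value 0. Moreover elements
  of \<open>LC C\<close> are functions, so every semigroup law holds only up to a seminorm and each
  use of it costs a triangle inequality.\<close>

abbreviation tuples :: "nat set \<Rightarrow> (nat \<Rightarrow> 'a::euclidean_space) measure" where
  "tuples I \<equiv> PiM I (\<lambda>_. lborel)"

interpretation tuples: product_sigma_finite "\<lambda>_::nat. lborel :: 'a::euclidean_space measure"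
  by standard

lemma tuples_reindex_measurable:
  assumes "f ` K \<subseteq> I"
  shows "(\<lambda>x. \<lambda>i\<in>K. x (f i)) \<in> measurable (tuples I) (tuples K)"
  using assms by (intro measurable_restrict measurable_component_singleton) auto

text \<open>It suffices to test boxes: the preimage of the box with sides \<open>A\<close> is the
  box with the relabelled sides \<open>B\<close>, and all coordinates carry the same
  measure.\<close>

lemma distr_tuples_reindex:
  assumes "finite I" "bij_betw f K I"
  shows "distr (tuples I) (tuples K) (\<lambda>x. \<lambda>i\<in>K. x (f i)) = (tuples K :: (nat \<Rightarrow> 'a::euclidean_space) measure)"
proof (rule tuples.PiM_eqI)
  have fin: "finite K" using assms bij_betw_finite by blast
  then show "finite K" .
  have im: "f ` K = I" and inj: "inj_on f K" using assms by (auto simp: bij_betw_def)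
  fix A :: "nat \<Rightarrow> 'a set" assume A: "\<And>i. i \<in> K \<Longrightarrow> A i \<in> sets lborel"
  define B where "B j = A (the_inv_into K f j)" for j
  have Bf: "B (f i) = A i" if "i \<in> K" for i
    using that inj by (simp add: B_def the_inv_into_f_f)
  have B: "B j \<in> sets lborel" if "j \<in> I" for j
    using that A im Bf by (metis imageE)
  have "emeasure (distr (tuples I) (tuples K) (\<lambda>x. \<lambda>i\<in>K. x (f i))) (Pi\<^sub>E K A)
      = emeasure (tuples I) ((\<lambda>x. \<lambda>i\<in>K. x (f i)) -` Pi\<^sub>E K A \<inter> space (tuples I))"
    using im A fin by (intro emeasure_distr tuples_reindex_measurable sets_PiM_I_finite) auto
  also have "(\<lambda>x. \<lambda>i\<in>K. x (f i)) -` Pi\<^sub>E K A \<inter> space (tuples I) = Pi\<^sub>E I B"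
  proof (intro equalityI subsetI)
    fix x assume "x \<in> (\<lambda>x. \<lambda>i\<in>K. x (f i)) -` Pi\<^sub>E K A \<inter> space (tuples I)"
    then have xA: "x (f i) \<in> A i" if "i \<in> K" for i
      using that by (auto simp: space_PiM PiE_iff)
    moreover have "x \<in> extensional I"
      using \<open>x \<in> _\<close> by (auto simp: space_PiM PiE_iff)
    moreover have "x j \<in> B j" if "j \<in> I" for j
      using that xA Bf unfolding im[symmetric] by auto
    ultimately show "x \<in> Pi\<^sub>E I B" by (auto simp: PiE_iff)
  next
    fix x assume x: "x \<in> Pi\<^sub>E I B"
    then have "x (f i) \<in> A i" if "i \<in> K" for i
      using that im Bf[OF that] by (metis PiE_mem imageI)
    then show "x \<in> (\<lambda>x. \<lambda>i\<in>K. x (f i)) -` Pi\<^sub>E K A \<inter> space (tuples I)"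
      using x by (auto simp: space_PiM PiE_iff)
  qed
  also have "emeasure (tuples I) (Pi\<^sub>E I B) = (\<Prod>j\<in>I. emeasure lborel (B j))"
    using B assms(1) by (intro tuples.emeasure_PiM) auto
  also have "\<dots> = (\<Prod>i\<in>K. emeasure lborel (A i))"
    unfolding im[symmetric] by (simp add: prod.reindex[OF inj] Bf cong: prod.cong)
  finally show "emeasure (distr (tuples I) (tuples K) (\<lambda>x. \<lambda>i\<in>K. x (f i))) (Pi\<^sub>E K A)
      = (\<Prod>i\<in>K. emeasure lborel (A i))" .
qed simp

lemma
  assumes "bij_betw f K I"
  shows inj_on_reindex_iff: "inj_on (\<lambda>i\<in>K. x (f i)) K \<longleftrightarrow> inj_on x I"
    and image_reindex: "(\<lambda>i\<in>K. x (f i)) ` K = x ` I"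
proof -
  have "inj_on f K" and im: "f ` K = I" using assms by (auto simp: bij_betw_def)
  then show "inj_on (\<lambda>i\<in>K. x (f i)) K \<longleftrightarrow> inj_on x I"
    using comp_inj_on_iff[of f K x] by (simp add: comp_def)
  show "(\<lambda>i\<in>K. x (f i)) ` K = x ` I"
    unfolding im[symmetric] by (simp add: image_image)
qed

lemma tuples_component_measurable:
  "i \<in> I \<Longrightarrow> (\<lambda>x. x i) \<in> borel_measurable (tuples I :: (nat \<Rightarrow> 'a::euclidean_space) measure)"
  using measurable_component_singleton[of i I "\<lambda>_. lborel :: 'a measure"] by simp

lemma tuples_pred_eq:
  assumes "i \<in> I" "j \<in> I"
  shows "Measurable.pred (tuples I) (\<lambda>x :: nat \<Rightarrow> 'a::euclidean_space. x i = x j)"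
  unfolding pred_def by (intro measurable_equality_set tuples_component_measurable assms)

text \<open>Extends \<open>LP_measurable\<close> to other codomains, so that
  \<open>ennreal\<close>-valued majorants obey the same lemmas.\<close>

definition conf_measurable :: "('a::euclidean_space set \<Rightarrow> 'b::topological_space) \<Rightarrow> bool" where
  "conf_measurable F \<longleftrightarrow> (\<forall>n::nat. (\<lambda>x. F (x ` {..<n})) \<in> borel_measurable (tuples {..<n}))"

lemma LP_measurable_iff: "LP_measurable G \<longleftrightarrow> conf_measurable G"
  by (simp add: LP_measurable_def conf_measurable_def)

lemma conf_measurable_image:
  assumes "conf_measurable F" "finite I"
  shows "(\<lambda>x. F (x ` I)) \<in> borel_measurable (tuples I)"
proof -
  obtain f where f: "bij_betw f {..<card I} I"
    using ex_bij_betw_nat_finite[OF assms(2)] by (auto simp: atLeast0LessThan)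
  then have im: "f ` {..<card I} = I" by (auto simp: bij_betw_def)
  have "(\<lambda>x. F ((\<lambda>i\<in>{..<card I}. x (f i)) ` {..<card I})) \<in> borel_measurable (tuples I)"
    using assms(1) im unfolding conf_measurable_def
    by (intro measurable_compose[OF tuples_reindex_measurable]) auto
  then show ?thesis by (simp only: image_reindex[OF f])
qed

lemma conf_measurable_subimage:
  assumes "conf_measurable F" "finite I" "J \<subseteq> I"
  shows "(\<lambda>x. F (x ` J)) \<in> borel_measurable (tuples I)"
proof -
  have "(\<lambda>x. F (restrict x J ` J)) \<in> borel_measurable (tuples I)"
    using assms finite_subset
    by (intro measurable_compose[OF measurable_restrict_subset conf_measurable_image]) auto
  then show ?thesis by simp
qed

text \<open>A pair \<open>(x, y)\<close> is a single tuple with one more coordinate, at a fresh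
  index \<open>k\<close>, and adjoining \<open>y\<close> amounts to taking the image of this longer
  tuple.\<close>

lemma conf_measurable_insert:
  assumes "conf_measurable F" "finite I" "J \<subseteq> I"
  shows "(\<lambda>(x, y). F (insert y (x ` J))) \<in> borel_measurable (tuples I \<Otimes>\<^sub>M lborel)"
proof -
  obtain k where k: "k \<notin> I" using assms(2) ex_new_if_finite infinite_UNIV_nat by blast
  have m: "(\<lambda>(x, y). x(k := y)) \<in> measurable (tuples I \<Otimes>\<^sub>M lborel) (tuples (insert k I))"
    using measurable_add_dim[of k I "\<lambda>_. lborel"] by (simp add: split_beta)
  have "(\<lambda>p. F ((case p of (x, y) \<Rightarrow> x(k := y)) ` insert k J)) \<in> borel_measurable (tuples I \<Otimes>\<^sub>M lborel)"
    using assms by (intro measurable_compose[OF m conf_measurable_subimage]) auto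
  moreover have "F ((case p of (x, y) \<Rightarrow> x(k := y)) ` insert k J) = (case p of (x, y) \<Rightarrow> F (insert y (x ` J)))" for p
  proof -
    have "k \<notin> J" using k assms(3) by blast
    then have "(fst p)(k := snd p) ` J = fst p ` J" by (intro image_cong) auto
    then have "(fst p)(k := snd p) ` insert k J = insert (snd p) (fst p ` J)"
      by (simp only: image_insert fun_upd_same)
    then show ?thesis by (simp only: split_beta)
  qed
  ultimately show ?thesis by simp
qed

lemma inj_on_tuples_measurable:
  assumes "finite I" "J \<subseteq> I"
  shows "Measurable.pred (tuples I) (\<lambda>x :: nat \<Rightarrow> 'a::euclidean_space. inj_on x J)"
proof -
  have "finite J" using assms finite_subset by blast
  then have "Measurable.pred (tuples I) (\<lambda>x :: nat \<Rightarrow> 'a. \<forall>i\<in>J. \<forall>j\<in>J. x i = x j \<longrightarrow> i = j)"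
    using assms(2) by (intro pred_intros_finite pred_intros_logic tuples_pred_eq) auto
  then show ?thesis by (simp add: inj_on_def)
qed

text \<open>A tuple with repetitions spans the same configuration as the subtuple of first occurrences,
  which is injective.\<close>

lemma conf_measurableI_inj:
  fixes F :: "'a::euclidean_space set \<Rightarrow> 'b::topological_space"
  assumes "\<And>n. (\<lambda>x. if inj_on x {..<n} then F (x ` {..<n}) else c) \<in> borel_measurable (tuples {..<n})"
  shows "conf_measurable F"
  unfolding conf_measurable_def
proof
  fix n :: nat
  define firsts where "firsts x = {i. i < n \<and> (\<forall>j<i. x j \<noteq> x i)}" for x :: "nat \<Rightarrow> 'a"
  have inj: "inj_on x (firsts x)" for x
    by (rule inj_onI) (metis (mono_tags, lifting) firsts_def linorder_neqE_nat mem_Collect_eq)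
  have im: "x ` firsts x = x ` {..<n}" for x
  proof -
    have "x i \<in> x ` firsts x" if "i < n" for i
    proof -
      define j where "j = (LEAST j. x j = x i)"
      have "x j = x i" unfolding j_def by (rule LeastI) simp
      moreover have "j \<le> i" unfolding j_def by (rule Least_le) simp
      moreover have "x l \<noteq> x j" if "l < j" for l
        using that not_less_Least[of l "\<lambda>j. x j = x i"] \<open>x j = x i\<close> by (simp add: j_def)
      ultimately have "j \<in> firsts x" using that by (auto simp: firsts_def)
      then show ?thesis using \<open>x j = x i\<close> by (metis imageI)
    qed
    then show ?thesis by (auto simp: firsts_def)
  qed
  \<comment> \<open>Since \<open>firsts x\<close> takes finitely many values, it may be frozen to a
    set \<open>S\<close>. The test \<open>inj_on x S\<close> succeeds at
    \<open>S = firsts x\<close>, but is needed for frozen \<open>S\<close> to bring the term into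
    the form of the hypothesis.\<close>
  have "(\<lambda>x. (\<lambda>S x. if inj_on x S then F (x ` S) else c) (firsts x) x) \<in> borel_measurable (tuples {..<n})"
  proof (rule measurable_compose_countable'[where I = "Pow {..<n}"])
    fix S assume S: "S \<in> Pow {..<n}"
    then have fS: "finite S" using finite_subset by auto
    obtain f where f: "bij_betw f {..<card S} S"
      using ex_bij_betw_nat_finite[OF fS] by (auto simp: atLeast0LessThan)
    then have imf: "f ` {..<card S} = S" by (auto simp: bij_betw_def)
    let ?r = "\<lambda>x::nat \<Rightarrow> 'a. \<lambda>i\<in>{..<card S}. x (f i)"
    have "(\<lambda>x. if inj_on (?r x) {..<card S} then F (?r x ` {..<card S}) else c) \<in> borel_measurable (tuples {..<n})"
      using S imf by (intro measurable_compose[OF tuples_reindex_measurable assms]) auto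
    then show "(\<lambda>x. if inj_on x S then F (x ` S) else c) \<in> borel_measurable (tuples {..<n})"
      by (simp only: inj_on_reindex_iff[OF f] image_reindex[OF f])
  next
    have "Measurable.pred (tuples {..<n}) (\<lambda>x :: nat \<Rightarrow> 'a. firsts x = S)" if "S \<subseteq> {..<n}" for S
    proof -
      have "Measurable.pred (tuples {..<n})
         (\<lambda>x :: nat \<Rightarrow> 'a. \<forall>i\<in>{..<n}. (i \<in> S) = (\<forall>j\<in>{..<i}. x j \<noteq> x i))"
        by (intro pred_intros_finite pred_intros_logic tuples_pred_eq) auto
      moreover have "(firsts x = S) = (\<forall>i\<in>{..<n}. (i \<in> S) = (\<forall>j\<in>{..<i}. x j \<noteq> x i))" for x
        using that by (auto simp: firsts_def)
      ultimately show ?thesis by simp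
    qed
    then show "firsts \<in> measurable (tuples {..<n}) (count_space (Pow {..<n}))"
      by (subst measurable_count_space_eq2)
         (auto simp: firsts_def vimage_def pred_def Int_def conj_commute)
  qed (auto intro: countable_finite)
  then show "(\<lambda>x. F (x ` {..<n})) \<in> borel_measurable (tuples {..<n})"
    by (simp add: inj im)
qed

text \<open>Arbitrary index sets occur when one block of a split tuple is integrated
  separately.\<close>

definition inj_integral :: "nat set \<Rightarrow> ('a::euclidean_space set \<Rightarrow> ennreal) \<Rightarrow> ennreal" where
  "inj_integral I g = (\<integral>\<^sup>+ x. g (x ` I) * indicator {x. inj_on x I} x \<partial>tuples I)"

lemma inj_integrand_measurable:
  assumes "conf_measurable g" "finite I"
  shows "(\<lambda>x. g (x ` I) * indicator {x. inj_on x I} x :: ennreal) \<in> borel_measurable (tuples I)"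
proof -
  have [measurable]: "(\<lambda>x. g (x ` I)) \<in> borel_measurable (tuples I)"
    using assms by (rule conf_measurable_image)
  have [measurable]: "Measurable.pred (tuples I) (\<lambda>x :: nat \<Rightarrow> 'a. inj_on x I)"
    using assms by (intro inj_on_tuples_measurable) auto
  have "(\<lambda>x. if inj_on x I then g (x ` I) else 0) \<in> borel_measurable (tuples I)"
    by measurable
  moreover have "(if inj_on x I then g (x ` I) else 0) = g (x ` I) * indicator {x. inj_on x I} x" for x
    by simp
  ultimately show ?thesis by simp
qed

lemma inj_integral_cong_card:
  fixes g :: "'a::euclidean_space set \<Rightarrow> ennreal"
  assumes "conf_measurable g" "finite I"
  shows "inj_integral I g = inj_integral {..<card I} g"
proof -
  obtain f where f: "bij_betw f {..<card I} I"
    using ex_bij_betw_nat_finite[OF assms(2)] by (auto simp: atLeast0LessThan)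
  then have im: "f ` {..<card I} = I" by (auto simp: bij_betw_def)
  let ?r = "\<lambda>x::nat \<Rightarrow> 'a. \<lambda>i\<in>{..<card I}. x (f i)"
  have "inj_integral I g = (\<integral>\<^sup>+ x. g (?r x ` {..<card I}) *
      indicator {x. inj_on x {..<card I}} (?r x) \<partial>tuples I)"
    unfolding inj_integral_def indicator_def mem_Collect_eq
    by (simp only: inj_on_reindex_iff[OF f] image_reindex[OF f])
  also have "\<dots> = (\<integral>\<^sup>+ x. g (x ` {..<card I}) * indicator {x. inj_on x {..<card I}} x
      \<partial>distr (tuples I) (tuples {..<card I}) ?r)"
    using im assms(1)
    by (subst nn_integral_distr[OF tuples_reindex_measurable]) (auto intro: inj_integrand_measurable)
  also have "\<dots> = inj_integral {..<card I} g"
    unfolding distr_tuples_reindex[OF assms(2) f] by (simp add: inj_integral_def)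
  finally show ?thesis .
qed

section \<open>The Lebesgue--Poisson integral\<close>

definition conf_mass :: "nat \<Rightarrow> ('a::euclidean_space set \<Rightarrow> ennreal) \<Rightarrow> ennreal" where
  "conf_mass n g = ennreal (1 / fact n) * inj_integral {..<n} g"

lemma LP_nn_integral_eq_suminf: "LP_nn_integral g = (\<Sum>n. conf_mass n g)"
  by (simp add: LP_nn_integral_def conf_mass_def inj_integral_def)

text \<open>The Lebesgue--Poisson measure is never built as a measure, so its null sets are
  described layer by layer on injective tuples.\<close>

definition LP_AE :: "('a::euclidean_space set \<Rightarrow> bool) \<Rightarrow> bool" where
  "LP_AE P \<longleftrightarrow> (\<forall>n. AE x in tuples {..<n}. inj_on x {..<n} \<longrightarrow> P (x ` {..<n}))"

lemma LP_AE_I: "(\<And>\<eta>. finite \<eta> \<Longrightarrow> P \<eta>) \<Longrightarrow> LP_AE P"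
  by (simp add: LP_AE_def)

lemma LP_AE_mp:
  assumes "LP_AE P" "\<And>\<eta>. finite \<eta> \<Longrightarrow> P \<eta> \<Longrightarrow> Q \<eta>"
  shows "LP_AE Q"
  unfolding LP_AE_def
proof
  fix n
  show "AE x in tuples {..<n}. inj_on x {..<n} \<longrightarrow> Q (x ` {..<n})"
    using assms(1)[unfolded LP_AE_def, rule_format, of n] by eventually_elim (auto intro: assms(2))
qed

lemma LP_nn_integral_mono_AE:
  assumes "LP_AE (\<lambda>\<eta>. F \<eta> \<le> G \<eta>)"
  shows "LP_nn_integral F \<le> LP_nn_integral G"
proof -
  have "inj_integral {..<n} F \<le> inj_integral {..<n} G" for n
    unfolding inj_integral_def
  proof (rule nn_integral_mono_AE)
    show "AE x in tuples {..<n}. F (x ` {..<n}) * indicator {x. inj_on x {..<n}} x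
        \<le> G (x ` {..<n}) * indicator {x. inj_on x {..<n}} x"
      using assms[unfolded LP_AE_def, rule_format, of n]
      by eventually_elim (auto split: split_indicator)
  qed
  then show ?thesis
    unfolding LP_nn_integral_eq_suminf conf_mass_def
    by (intro suminf_le mult_left_mono) auto
qed

lemma LP_nn_integral_mono:
  "(\<And>\<eta>. finite \<eta> \<Longrightarrow> F \<eta> \<le> G \<eta>) \<Longrightarrow> LP_nn_integral F \<le> LP_nn_integral G"
  by (intro LP_nn_integral_mono_AE LP_AE_I)

lemma LP_nn_integral_add:
  assumes "conf_measurable F" "conf_measurable G"
  shows "LP_nn_integral (\<lambda>\<eta>. F \<eta> + G \<eta>) = LP_nn_integral F + LP_nn_integral G"
proof -
  have "inj_integral {..<n} (\<lambda>\<eta>. F \<eta> + G \<eta>) = inj_integral {..<n} F + inj_integral {..<n} G" for n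
    unfolding inj_integral_def using assms
    by (subst nn_integral_add[symmetric]) (auto simp: distrib_right intro: inj_integrand_measurable)
  then show ?thesis
    unfolding LP_nn_integral_eq_suminf conf_mass_def
    by (subst suminf_add) (auto simp: distrib_left)
qed

lemma inj_integral_card_weight:
  assumes "conf_measurable g" "finite I"
  shows "inj_integral I (\<lambda>\<eta>. W (card \<eta>) * g \<eta>) = W (card I) * inj_integral I g"
proof -
  have "inj_integral I (\<lambda>\<eta>. W (card \<eta>) * g \<eta>)
      = (\<integral>\<^sup>+ x. W (card I) * (g (x ` I) * indicator {x. inj_on x I} x) \<partial>tuples I)"
    unfolding inj_integral_def
    by (intro nn_integral_cong) (auto split: split_indicator simp: card_image)
  then show ?thesis
    using assms by (simp add: inj_integral_def nn_integral_cmult inj_integrand_measurable)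
qed

lemma LP_nn_integral_card_weight:
  assumes "conf_measurable g"
  shows "LP_nn_integral (\<lambda>\<eta>. W (card \<eta>) * g \<eta>) = (\<Sum>n. W n * conf_mass n g)"
  using assms by (simp add: LP_nn_integral_eq_suminf conf_mass_def inj_integral_card_weight mult.left_commute)

lemma LP_AE_finite:
  assumes g: "conf_measurable g" and fin: "LP_nn_integral g < \<infinity>"
  shows "LP_AE (\<lambda>\<eta>. g \<eta> < \<infinity>)"
  unfolding LP_AE_def
proof
  fix n
  have "conf_mass n g \<le> LP_nn_integral g"
    unfolding LP_nn_integral_eq_suminf using sum_le_suminf[of "\<lambda>n. conf_mass n g" "{n}"] by simp
  then have "conf_mass n g < \<infinity>" using fin by (rule le_less_trans)
  then have "inj_integral {..<n} g \<noteq> \<infinity>"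
    by (auto simp: conf_mass_def ennreal_mult_less_top)
  then have "AE x in tuples {..<n}. g (x ` {..<n}) * indicator {x. inj_on x {..<n}} x \<noteq> \<infinity>"
    unfolding inj_integral_def by (intro nn_integral_PInf_AE inj_integrand_measurable g) auto
  then show "AE x in tuples {..<n}. inj_on x {..<n} \<longrightarrow> g (x ` {..<n}) < \<infinity>"
    by eventually_elim (auto simp: less_top)
qed

section \<open>Integrals of sums over subconfigurations\<close>

lemma sum_Pow_image:
  assumes "inj_on x I"
  shows "(\<Sum>\<xi>\<in>Pow (x ` I). H \<xi> (x ` I - \<xi>)) = (\<Sum>S\<in>Pow I. H (x ` S) (x ` (I - S)))"
proof -
  have "(\<Sum>\<xi>\<in>Pow (x ` I). H \<xi> (x ` I - \<xi>)) = (\<Sum>S\<in>Pow I. H (x ` S) (x ` I - x ` S))"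
    using sum.reindex[OF inj_on_image_Pow[OF assms], of "\<lambda>\<xi>. H \<xi> (x ` I - \<xi>)"]
    by (simp add: image_Pow_surj)
  also have "\<dots> = (\<Sum>S\<in>Pow I. H (x ` S) (x ` (I - S)))"
    using assms by (intro sum.cong) (auto simp: inj_on_image_set_diff)
  finally show ?thesis .
qed

lemma sum_Pow_by_card:
  fixes f :: "nat \<Rightarrow> ennreal"
  assumes "finite A"
  shows "(\<Sum>S\<in>Pow A. f (card S)) = (\<Sum>p\<le>card A. of_nat (card A choose p) * f p)"
proof -
  have "(\<Sum>S\<in>Pow A. f (card S)) = (\<Sum>p\<le>card A. \<Sum>S\<in>{S\<in>Pow A. card S = p}. f (card S))"
    using assms by (intro sum.group[symmetric]) (auto intro: card_mono)
  also have "\<dots> = (\<Sum>p\<le>card A. of_nat (card A choose p) * f p)"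
    using assms by (intro sum.cong) (auto simp: n_subsets)
  finally show ?thesis .
qed

text \<open>Absolute-value model of a birth operator. The weight \<open>w\<close> sees only the
  sizes of the two blocks; it later carries \<open>z\<close>, the powers of \<open>C\<close> and the
  error of comparing two kernels.\<close>

definition birth_majorant ::
    "(nat \<Rightarrow> nat \<Rightarrow> ennreal) \<Rightarrow> ('a::euclidean_space \<Rightarrow> ennreal) \<Rightarrow> ('a set \<Rightarrow> ennreal) \<Rightarrow> 'a set \<Rightarrow> ennreal" where
  "birth_majorant w \<psi> g \<eta> = (\<Sum>\<xi>\<in>Pow \<eta>. w (card \<xi>) (card (\<eta> - \<xi>)) *
      (\<integral>\<^sup>+ y. g (insert y \<xi>) * (\<Prod>v\<in>\<eta> - \<xi>. \<psi> (y - v)) \<partial>lborel))"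

text \<open>On an injective tuple, subconfigurations correspond to index sets \<open>S\<close> that
  do not depend on \<open>x\<close>, so the sum can be exchanged with integration over
  \<open>x\<close>.\<close>

lemma birth_majorant_image:
  assumes "inj_on x I"
  shows "birth_majorant w \<psi> g (x ` I) = (\<Sum>S\<in>Pow I. w (card S) (card (I - S)) *
      (\<integral>\<^sup>+ y. g (insert y (x ` S)) * (\<Prod>i\<in>I - S. \<psi> (y - x i)) \<partial>lborel))"
  unfolding birth_majorant_def
    sum_Pow_image[OF assms, where H = "\<lambda>\<xi> \<zeta>. w (card \<xi>) (card \<zeta>) *
      (\<integral>\<^sup>+ y. g (insert y \<xi>) * (\<Prod>v\<in>\<zeta>. \<psi> (y - v)) \<partial>lborel)"]
proof (rule sum.cong[OF refl])
  fix S assume "S \<in> Pow I"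
  then have "inj_on x S" "inj_on x (I - S)" using assms by (auto intro: inj_on_subset)
  then show "w (card (x ` S)) (card (x ` (I - S))) *
      (\<integral>\<^sup>+ y. g (insert y (x ` S)) * (\<Prod>v\<in>x ` (I - S). \<psi> (y - v)) \<partial>lborel)
    = w (card S) (card (I - S)) * (\<integral>\<^sup>+ y. g (insert y (x ` S)) * (\<Prod>i\<in>I - S. \<psi> (y - x i)) \<partial>lborel)"
    by (simp add: card_image prod.reindex)
qed

lemma tuples_pair_shift_measurable:
  assumes "\<psi> \<in> borel_measurable borel" "i \<in> I"
  shows "(\<lambda>(x, y). \<psi> (y - x i :: 'a::euclidean_space)) \<in> borel_measurable (tuples I \<Otimes>\<^sub>M lborel)"
proof -
  have "(\<lambda>p. snd p - fst p i) \<in> borel_measurable (tuples I \<Otimes>\<^sub>M (lborel :: 'a measure))"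
    using assms(2)
    by (intro borel_measurable_diff measurable_compose[OF measurable_fst tuples_component_measurable])
       auto
  from measurable_compose[OF this assms(1)] show ?thesis by (simp add: split_beta)
qed

lemma birth_integrand_measurable:
  fixes g :: "'a::euclidean_space set \<Rightarrow> ennreal"
  assumes "conf_measurable g" "\<psi> \<in> borel_measurable borel" "finite I" "S \<subseteq> I" "J \<subseteq> I"
  shows "(\<lambda>(x, y). g (insert y (x ` S)) * (\<Prod>i\<in>J. \<psi> (y - x i))) \<in> borel_measurable (tuples I \<Otimes>\<^sub>M lborel)"
proof -
  have "(\<lambda>p. (case p of (x, y) \<Rightarrow> g (insert y (x ` S))) * (\<Prod>i\<in>J. case p of (x, y) \<Rightarrow> \<psi> (y - x i)))
      \<in> borel_measurable (tuples I \<Otimes>\<^sub>M lborel)"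
    using assms by (intro borel_measurable_times_ennreal borel_measurable_prod_ennreal
        conf_measurable_insert tuples_pair_shift_measurable) auto
  then show ?thesis by (simp add: split_beta)
qed

lemma conf_measurable_birth_majorant:
  fixes g :: "'a::euclidean_space set \<Rightarrow> ennreal"
  assumes "conf_measurable g" "\<psi> \<in> borel_measurable borel"
  shows "conf_measurable (birth_majorant w \<psi> g)"
proof (rule conf_measurableI_inj[where c = 0])
  fix n
  have "(\<lambda>x. \<integral>\<^sup>+ y. g (insert y (x ` S)) * (\<Prod>i\<in>{..<n} - S. \<psi> (y - x i)) \<partial>lborel)
      \<in> borel_measurable (tuples {..<n})" if "S \<subseteq> {..<n}" for S
    using birth_integrand_measurable[OF assms finite_lessThan that Diff_subset]
    by (intro lborel.borel_measurable_nn_integral) simp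
  then have [measurable]: "(\<lambda>x. \<Sum>S\<in>Pow {..<n}. w (card S) (card ({..<n} - S)) *
      (\<integral>\<^sup>+ y. g (insert y (x ` S)) * (\<Prod>i\<in>{..<n} - S. \<psi> (y - x i)) \<partial>lborel))
      \<in> borel_measurable (tuples {..<n})"
    by (intro borel_measurable_sum borel_measurable_times_ennreal) auto
  have [measurable]: "Measurable.pred (tuples {..<n}) (\<lambda>x :: nat \<Rightarrow> 'a. inj_on x {..<n})"
    by (intro inj_on_tuples_measurable) auto
  have "(\<lambda>x. if inj_on x {..<n} then \<Sum>S\<in>Pow {..<n}. w (card S) (card ({..<n} - S)) *
      (\<integral>\<^sup>+ y. g (insert y (x ` S)) * (\<Prod>i\<in>{..<n} - S. \<psi> (y - x i)) \<partial>lborel) else 0)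
      \<in> borel_measurable (tuples {..<n})"
    by measurable
  then show "(\<lambda>x. if inj_on x {..<n} then birth_majorant w \<psi> g (x ` {..<n}) else 0)
      \<in> borel_measurable (tuples {..<n})"
    by (simp add: birth_majorant_image cong: if_cong)
qed

text \<open>With \<open>y\<close> as the coordinate at a fresh index, both integrals merge into one.
  Injectivity of the longer tuple differs from that of \<open>x\<close> only if \<open>y\<close>
  hits one of finitely many points, a null set.\<close>

lemma nn_integral_insert_point:
  fixes g :: "'a::euclidean_space set \<Rightarrow> ennreal"
  assumes g: "conf_measurable g" and S: "finite S"
  shows "(\<integral>\<^sup>+ x. \<integral>\<^sup>+ y. g (insert y (x ` S)) * indicator {x. inj_on x S} x \<partial>lborel \<partial>tuples S)
    = inj_integral {..<Suc (card S)} g"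
proof -
  obtain k where k: "k \<notin> S" using S ex_new_if_finite infinite_UNIV_nat by blast
  have "inj_integral {..<Suc (card S)} g = inj_integral (insert k S) g"
    using inj_integral_cong_card[OF g, of "insert k S"] S k by simp
  also have "\<dots> = (\<integral>\<^sup>+ x. \<integral>\<^sup>+ y. g (x(k := y) ` insert k S) *
      indicator {x. inj_on x (insert k S)} (x(k := y)) \<partial>lborel \<partial>tuples S)"
    unfolding inj_integral_def using S k g
    by (intro tuples.product_nn_integral_insert inj_integrand_measurable) auto
  also have "\<dots> = (\<integral>\<^sup>+ x. \<integral>\<^sup>+ y. g (insert y (x ` S)) * indicator {x. inj_on x S} x \<partial>lborel \<partial>tuples S)"
  proof (rule nn_integral_cong, rule nn_integral_cong_AE)
    fix x :: "nat \<Rightarrow> 'a"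
    have "x ` S \<in> null_sets lborel"
      using S by (intro finite_imp_null_set_lborel finite_imageI)
    from AE_not_in[OF this]
    show "AE y in lborel. g (x(k := y) ` insert k S) * indicator {x. inj_on x (insert k S)} (x(k := y))
        = g (insert y (x ` S)) * indicator {x. inj_on x S} x"
    proof eventually_elim
      fix y assume y: "y \<notin> x ` S"
      have im: "x(k := y) ` S = x ` S" using k by (intro image_cong) auto
      have "inj_on (x(k := y)) S = inj_on x S" using k by (intro inj_on_cong) auto
      then have "inj_on (x(k := y)) (insert k S) = inj_on x S"
        using k y im unfolding inj_on_insert by (simp del: fun_upd_image)
      then show "g (x(k := y) ` insert k S) * indicator {x. inj_on x (insert k S)} (x(k := y))
        = g (insert y (x ` S)) * indicator {x. inj_on x S} x"
        unfolding image_insert im by (simp add: indicator_def)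
    qed
  qed
  finally show ?thesis by simp
qed

text \<open>Once the coordinates outside \<open>S\<close> are freed from the injectivity constraint,
  the only loss here, Fubini integrates each of them to \<open>B\<close> for fixed \<open>y\<close>.
  What remains is the block \<open>S\<close> with the newborn point.\<close>

lemma nn_integral_birth_block:
  fixes g :: "'a::euclidean_space set \<Rightarrow> ennreal"
  assumes g: "conf_measurable g" and \<psi>: "\<psi> \<in> borel_measurable borel"
    and B: "\<And>y. (\<integral>\<^sup>+ v. \<psi> (y - v) \<partial>lborel) = B"
    and I: "finite I" and S: "S \<subseteq> I"
  shows "(\<integral>\<^sup>+ x. (\<integral>\<^sup>+ y. g (insert y (x ` S)) * (\<Prod>i\<in>I - S. \<psi> (y - x i)) \<partial>lborel) *
      indicator {x. inj_on x I} x \<partial>tuples I) \<le> B ^ card (I - S) * inj_integral {..<Suc (card S)} g"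
proof -
  let ?J = "I - S"
  have fS: "finite S" and fJ: "finite ?J" using I S finite_subset by auto
  have IS: "S \<union> ?J = I" "S \<inter> ?J = {}" using S by auto
  have inj_m: "Measurable.pred (tuples I) (\<lambda>x :: nat \<Rightarrow> 'a. inj_on x S)"
    using I S by (rule inj_on_tuples_measurable)
  have m1: "(\<lambda>x. \<integral>\<^sup>+ y. g (insert y (x ` S)) * (\<Prod>i\<in>?J. \<psi> (y - x i)) \<partial>lborel)
      \<in> borel_measurable (tuples I)"
    using birth_integrand_measurable[OF g \<psi> I S Diff_subset]
    by (intro lborel.borel_measurable_nn_integral) simp
  let ?F = "\<lambda>x. (\<integral>\<^sup>+ y. g (insert y (x ` S)) * (\<Prod>i\<in>?J. \<psi> (y - x i)) \<partial>lborel) *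
      indicator {x. inj_on x S} x"
  have mF: "?F \<in> borel_measurable (tuples I)"
  proof -
    have "(\<lambda>x. if inj_on x S then \<integral>\<^sup>+ y. g (insert y (x ` S)) * (\<Prod>i\<in>?J. \<psi> (y - x i)) \<partial>lborel else 0)
      \<in> borel_measurable (tuples I)"
      using m1 inj_m by measurable
    moreover have "?F x = (if inj_on x S then \<integral>\<^sup>+ y. g (insert y (x ` S)) * (\<Prod>i\<in>?J. \<psi> (y - x i)) \<partial>lborel else 0)" for x
      by simp
    ultimately show ?thesis by simp
  qed
  have "(\<integral>\<^sup>+ x. (\<integral>\<^sup>+ y. g (insert y (x ` S)) * (\<Prod>i\<in>?J. \<psi> (y - x i)) \<partial>lborel) *
      indicator {x. inj_on x I} x \<partial>tuples I) \<le> (\<integral>\<^sup>+ x. ?F x \<partial>tuples I)"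
    using S by (intro nn_integral_mono mult_left_mono) (auto split: split_indicator intro: inj_on_subset)
  also have "\<dots> = (\<integral>\<^sup>+ x. \<integral>\<^sup>+ x'. ?F (merge S ?J (x, x')) \<partial>tuples ?J \<partial>tuples S)"
    using tuples.product_nn_integral_fold[OF IS(2) fS fJ, of ?F] mF unfolding IS by simp
  also have "\<dots> = (\<integral>\<^sup>+ x. \<integral>\<^sup>+ x'. \<integral>\<^sup>+ y. (g (insert y (x ` S)) * indicator {x. inj_on x S} x) *
      (\<Prod>i\<in>?J. \<psi> (y - x' i)) \<partial>lborel \<partial>tuples ?J \<partial>tuples S)"
  proof (intro nn_integral_cong)
    fix x x' :: "nat \<Rightarrow> 'a" assume "x \<in> space (tuples S)"
    have im: "merge S ?J (x, x') ` S = x ` S" by (intro image_cong) (auto simp: merge_def)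
    have inj: "inj_on (merge S ?J (x, x')) S = inj_on x S" by (intro inj_on_cong) (auto simp: merge_def)
    have pr: "(\<Prod>i\<in>?J. \<psi> (y - merge S ?J (x, x') i)) = (\<Prod>i\<in>?J. \<psi> (y - x' i))" for y
      by (intro prod.cong) (auto simp: merge_def)
    show "?F (merge S ?J (x, x')) = (\<integral>\<^sup>+ y. (g (insert y (x ` S)) * indicator {x. inj_on x S} x) *
      (\<Prod>i\<in>?J. \<psi> (y - x' i)) \<partial>lborel)"
      unfolding im pr using inj by (cases "inj_on x S") (simp_all add: indicator_def)
  qed
  also have "\<dots> = (\<integral>\<^sup>+ x. \<integral>\<^sup>+ y. \<integral>\<^sup>+ x'. (g (insert y (x ` S)) * indicator {x. inj_on x S} x) *
      (\<Prod>i\<in>?J. \<psi> (y - x' i)) \<partial>tuples ?J \<partial>lborel \<partial>tuples S)"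
  proof (rule nn_integral_cong)
    fix x :: "nat \<Rightarrow> 'a" assume x: "x \<in> space (tuples S)"
    interpret J: sigma_finite_measure "tuples ?J :: (nat \<Rightarrow> 'a) measure"
      using fJ by (rule tuples.sigma_finite)
    interpret JL: pair_sigma_finite "tuples ?J :: (nat \<Rightarrow> 'a) measure" "lborel :: 'a measure" ..
    have "(\<lambda>y. (x, y)) \<in> measurable lborel (tuples S \<Otimes>\<^sub>M (lborel :: 'a measure))"
      using x by (rule measurable_Pair1')
    then have "(\<lambda>y. g (insert y (x ` S))) \<in> borel_measurable lborel"
      using measurable_compose[OF _ conf_measurable_insert[OF g fS order_refl], of "\<lambda>y. (x, y)" lborel] by simp
    then have g1: "(\<lambda>p. g (insert (snd p) (x ` S))) \<in> borel_measurable (tuples ?J \<Otimes>\<^sub>M (lborel :: 'a measure))"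
      by (rule measurable_compose[OF measurable_snd])
    have "(\<lambda>p. \<Prod>i\<in>?J. case p of (x', y) \<Rightarrow> \<psi> (y - x' i)) \<in> borel_measurable (tuples ?J \<Otimes>\<^sub>M (lborel :: 'a measure))"
      using \<psi> by (intro borel_measurable_prod_ennreal tuples_pair_shift_measurable) auto
    with g1 have "(\<lambda>p. (g (insert (snd p) (x ` S)) * indicator {x. inj_on x S} x) *
        (\<Prod>i\<in>?J. case p of (x', y) \<Rightarrow> \<psi> (y - x' i))) \<in> borel_measurable (tuples ?J \<Otimes>\<^sub>M (lborel :: 'a measure))"
      by (intro borel_measurable_times_ennreal) auto
    then show "(\<integral>\<^sup>+ x'. \<integral>\<^sup>+ y. (g (insert y (x ` S)) * indicator {x. inj_on x S} x) *
      (\<Prod>i\<in>?J. \<psi> (y - x' i)) \<partial>lborel \<partial>tuples ?J) = (\<integral>\<^sup>+ y. \<integral>\<^sup>+ x'. (g (insert y (x ` S)) * indicator {x. inj_on x S} x) *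
      (\<Prod>i\<in>?J. \<psi> (y - x' i)) \<partial>tuples ?J \<partial>lborel)"
      by (intro JL.Fubini'[symmetric]) (simp add: split_beta)
  qed
  also have "\<dots> = (\<integral>\<^sup>+ x. \<integral>\<^sup>+ y. B ^ card ?J * (g (insert y (x ` S)) * indicator {x. inj_on x S} x)
      \<partial>lborel \<partial>tuples S)"
  proof (intro nn_integral_cong)
    fix x :: "nat \<Rightarrow> 'a" and y :: 'a
    have m: "(\<lambda>v. \<psi> (y - v)) \<in> borel_measurable lborel"
      using measurable_compose[OF _ \<psi>, of "\<lambda>v. y - v" lborel] by simp
    have "(\<integral>\<^sup>+ x'. (\<Prod>i\<in>?J. \<psi> (y - x' i)) \<partial>tuples ?J) = B ^ card ?J"
      using tuples.product_nn_integral_prod[OF fJ, of "\<lambda>_ v. \<psi> (y - v)"] m B by simp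
    moreover have "(\<lambda>x'. \<Prod>i\<in>?J. \<psi> (y - x' i)) \<in> borel_measurable (tuples ?J)"
      using m by (intro borel_measurable_prod_ennreal measurable_compose[OF tuples_component_measurable]) auto
    ultimately show "(\<integral>\<^sup>+ x'. (g (insert y (x ` S)) * indicator {x. inj_on x S} x) *
      (\<Prod>i\<in>?J. \<psi> (y - x' i)) \<partial>tuples ?J) = B ^ card ?J * (g (insert y (x ` S)) * indicator {x. inj_on x S} x)"
      by (simp add: nn_integral_cmult) (simp add: ac_simps)
  qed
  also have "\<dots> = B ^ card ?J * (\<integral>\<^sup>+ x. \<integral>\<^sup>+ y. g (insert y (x ` S)) * indicator {x. inj_on x S} x
      \<partial>lborel \<partial>tuples S)"
  proof -
    have "Measurable.pred (tuples S) (\<lambda>x :: nat \<Rightarrow> 'a. inj_on x S)"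
      using fS by (intro inj_on_tuples_measurable) auto
    then have "(indicator {x. inj_on x S} :: (nat \<Rightarrow> 'a) \<Rightarrow> ennreal) \<in> borel_measurable (tuples S)"
      by measurable
    then have "(\<lambda>p. indicator {x. inj_on x S} (fst p :: nat \<Rightarrow> 'a) :: ennreal) \<in> borel_measurable (tuples S \<Otimes>\<^sub>M (lborel :: 'a measure))"
      by (rule measurable_compose[OF measurable_fst])
    then have m: "(\<lambda>(x, y). g (insert y (x ` S)) * indicator {x. inj_on x S} x)
        \<in> borel_measurable (tuples S \<Otimes>\<^sub>M lborel)"
      using borel_measurable_times_ennreal[OF conf_measurable_insert[OF g fS order_refl]]
      by (simp add: split_beta)
    have "(\<lambda>y. g (insert y (x ` S)) * indicator {x. inj_on x S} x) \<in> borel_measurable lborel"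
      if "x \<in> space (tuples S)" for x
      using measurable_compose[OF measurable_Pair1'[OF that] m] by simp
    then show ?thesis
      using lborel.borel_measurable_nn_integral[OF m]
      by (simp add: nn_integral_cmult cong: nn_integral_cong)
  qed
  also have "\<dots> = B ^ card ?J * inj_integral {..<Suc (card S)} g"
    by (simp add: nn_integral_insert_point[OF g fS])
  finally show ?thesis .
qed

lemma inj_integral_birth_majorant_le:
  fixes g :: "'a::euclidean_space set \<Rightarrow> ennreal"
  assumes g: "conf_measurable g" and \<psi>: "\<psi> \<in> borel_measurable borel"
    and B: "\<And>y. (\<integral>\<^sup>+ v. \<psi> (y - v) \<partial>lborel) = B"
  shows "inj_integral {..<n} (birth_majorant w \<psi> g)
    \<le> (\<Sum>p\<le>n. of_nat (n choose p) * (w p (n - p) * (B ^ (n - p) * inj_integral {..<Suc p} g)))"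
proof -
  let ?h = "\<lambda>S x. (\<integral>\<^sup>+ y. g (insert y (x ` S)) * (\<Prod>i\<in>{..<n} - S. \<psi> (y - x i)) \<partial>lborel) *
      indicator {x. inj_on x {..<n}} x"
  have m: "?h S \<in> borel_measurable (tuples {..<n})" if "S \<subseteq> {..<n}" for S
  proof -
    have "Measurable.pred (tuples {..<n}) (\<lambda>x :: nat \<Rightarrow> 'a. inj_on x {..<n})"
      by (intro inj_on_tuples_measurable) auto
    then have "(indicator {x. inj_on x {..<n}} :: (nat \<Rightarrow> 'a) \<Rightarrow> ennreal) \<in> borel_measurable (tuples {..<n})"
      by measurable
    then show ?thesis
      using birth_integrand_measurable[OF g \<psi> finite_lessThan that Diff_subset]
      by (intro borel_measurable_times_ennreal lborel.borel_measurable_nn_integral) auto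
  qed
  have "inj_integral {..<n} (birth_majorant w \<psi> g)
      = (\<integral>\<^sup>+ x. (\<Sum>S\<in>Pow {..<n}. w (card S) (card ({..<n} - S)) * ?h S x) \<partial>tuples {..<n})"
    unfolding inj_integral_def
    by (intro nn_integral_cong)
       (auto split: split_indicator simp: birth_majorant_image)
  also have "\<dots> = (\<Sum>S\<in>Pow {..<n}. w (card S) (card ({..<n} - S)) * (\<integral>\<^sup>+ x. ?h S x \<partial>tuples {..<n}))"
    using m by (subst nn_integral_sum) (auto simp: nn_integral_cmult)
  also have "\<dots> \<le> (\<Sum>S\<in>Pow {..<n}. w (card S) (card ({..<n} - S)) *
      (B ^ card ({..<n} - S) * inj_integral {..<Suc (card S)} g))"
    using g \<psi> B by (intro sum_mono mult_left_mono nn_integral_birth_block) auto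
  also have "\<dots> = (\<Sum>S\<in>Pow {..<n}. (\<lambda>p. w p (n - p) * (B ^ (n - p) * inj_integral {..<Suc p} g)) (card S))"
    by (intro sum.cong) (auto simp: card_Diff_subset finite_subset)
  also have "\<dots> = (\<Sum>p\<le>n. of_nat (n choose p) * (w p (n - p) * (B ^ (n - p) * inj_integral {..<Suc p} g)))"
    by (subst sum_Pow_by_card) simp_all
  finally show ?thesis .
qed

text \<open>The triangle \<open>p + q < N\<close> lies in the square of side \<open>N\<close>, and
  in \<open>ennreal\<close> it is enough to bound partial sums.\<close>

lemma suminf_triangle_le:
  fixes f :: "nat \<Rightarrow> nat \<Rightarrow> ennreal"
  shows "(\<Sum>n. \<Sum>p\<le>n. f p (n - p)) \<le> (\<Sum>p. \<Sum>q. f p q)"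
proof (rule suminf_le_const)
  fix N
  have "(\<Sum>n<N. \<Sum>p\<le>n. f p (n - p)) = (\<Sum>(p, q)\<in>{(p, q). p + q < N}. f p q)"
    by (rule sum.triangle_reindex[symmetric])
  also have "\<dots> \<le> (\<Sum>(p, q)\<in>{..<N} \<times> {..<N}. f p q)"
    by (intro sum_mono2) auto
  also have "\<dots> = (\<Sum>p<N. \<Sum>q<N. f p q)"
    by (simp add: sum.cartesian_product)
  also have "\<dots> \<le> (\<Sum>p<N. \<Sum>q. f p q)"
    by (intro sum_mono sum_le_suminf) auto
  also have "\<dots> \<le> (\<Sum>p. \<Sum>q. f p q)"
    by (intro sum_le_suminf) auto
  finally show "(\<Sum>n<N. \<Sum>p\<le>n. f p (n - p)) \<le> (\<Sum>p. \<Sum>q. f p q)" .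
qed auto

text \<open>A one-sided form of the Minlos lemma: splitting a configuration into two blocks and
  integrating one of them out.\<close>

lemma LP_nn_integral_birth_majorant_le:
  fixes g :: "'a::euclidean_space set \<Rightarrow> ennreal"
  assumes g: "conf_measurable g" and \<psi>: "\<psi> \<in> borel_measurable borel"
    and B: "\<And>y. (\<integral>\<^sup>+ v. \<psi> (y - v) \<partial>lborel) = B"
  shows "LP_nn_integral (birth_majorant w \<psi> g)
    \<le> (\<Sum>p. \<Sum>q. w p q * (B ^ q * ennreal (1 / fact q)) * (of_nat (Suc p) * conf_mass (Suc p) g))"
proof -
  \<comment> \<open>The newborn point enlarges the kept block to \<open>Suc p\<close> points, so
    \<open>1 / fact p\<close> is rewritten with the normalisation of
    \<open>conf_mass (Suc p)\<close>. The leftover factor \<open>Suc p\<close> will be matched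
    against the death rate.\<close>
  have coeff: "ennreal (1 / fact n) * of_nat (n choose p)
      = ennreal (1 / fact (n - p)) * (of_nat (Suc p) * ennreal (1 / fact (Suc p)))" if "p \<le> n" for n p
  proof -
    have "real (n choose p) = fact n / (fact p * fact (n - p))"
      using that by (rule binomial_fact)
    then have "(1 / fact n) * real (n choose p) = (1 / fact (n - p)) * (1 / fact p)"
      by simp
    also have "1 / fact p = real (Suc p) * (1 / fact (Suc p))"
      by (simp del: of_nat_Suc)
    finally have "(1 / fact n) * real (n choose p) = (1 / fact (n - p)) * (real (Suc p) * (1 / fact (Suc p)))" .
    then show ?thesis
      unfolding ennreal_of_nat_eq_real_of_nat
      by (metis (no_types, lifting) ennreal_mult' of_nat_0_le_iff zero_le_divide_1_iff fact_ge_zero)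
  qed
  have "LP_nn_integral (birth_majorant w \<psi> g) \<le> (\<Sum>n. \<Sum>p\<le>n.
      w p (n - p) * (B ^ (n - p) * ennreal (1 / fact (n - p))) * (of_nat (Suc p) * conf_mass (Suc p) g))"
    unfolding LP_nn_integral_eq_suminf
  proof (intro suminf_le)
    fix n
    have "conf_mass n (birth_majorant w \<psi> g) \<le> ennreal (1 / fact n) *
       (\<Sum>p\<le>n. of_nat (n choose p) * (w p (n - p) * (B ^ (n - p) * inj_integral {..<Suc p} g)))"
      unfolding conf_mass_def by (intro mult_left_mono inj_integral_birth_majorant_le g \<psi> B) auto
    also have "\<dots> = (\<Sum>p\<le>n. (ennreal (1 / fact n) * of_nat (n choose p)) *
       (w p (n - p) * (B ^ (n - p) * inj_integral {..<Suc p} g)))"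
      by (simp only: sum_distrib_left mult.assoc)
    also have "\<dots> = (\<Sum>p\<le>n. w p (n - p) * (B ^ (n - p) * ennreal (1 / fact (n - p))) *
        (of_nat (Suc p) * conf_mass (Suc p) g))"
      by (intro sum.cong refl, subst coeff) (simp_all only: conf_mass_def atMost_iff ac_simps)
    finally show "conf_mass n (birth_majorant w \<psi> g) \<le> (\<Sum>p\<le>n. w p (n - p) *
       (B ^ (n - p) * ennreal (1 / fact (n - p))) * (of_nat (Suc p) * conf_mass (Suc p) g))" .
  qed auto
  also have "\<dots> \<le> (\<Sum>p. \<Sum>q. w p q * (B ^ q * ennreal (1 / fact q)) * (of_nat (Suc p) * conf_mass (Suc p) g))"
    by (rule suminf_triangle_le)
  finally show ?thesis .
qed

section \<open>Weighted spaces and birth operators\<close>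

abbreviation LC_nn :: "real \<Rightarrow> ('a::euclidean_space set \<Rightarrow> real) \<Rightarrow> ennreal" where
  "LC_nn C G \<equiv> LP_nn_integral (\<lambda>\<eta>. ennreal (\<bar>G \<eta>\<bar> * C ^ card \<eta>))"

abbreviation abs_mass :: "nat \<Rightarrow> ('a::euclidean_space set \<Rightarrow> real) \<Rightarrow> ennreal" where
  "abs_mass n G \<equiv> conf_mass n (\<lambda>\<eta>. ennreal \<bar>G \<eta>\<bar>)"

lemma conf_measurable_abs: "LP_measurable G \<Longrightarrow> conf_measurable (\<lambda>\<eta>. ennreal \<bar>G \<eta>\<bar>)"
  unfolding LP_measurable_iff conf_measurable_def by (auto intro!: measurable_compose[OF _ measurable_ennreal] borel_measurable_abs)

text \<open>The cardinality of the image is known to be \<open>n\<close> only on injective tuples,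
  hence the detour through \<open>conf_measurableI_inj\<close>.\<close>

lemma LP_measurable_card_weight:
  assumes "LP_measurable G"
  shows "LP_measurable (\<lambda>\<eta>. W (card \<eta>) * G \<eta>)"
  unfolding LP_measurable_iff
proof (rule conf_measurableI_inj[where c = 0])
  fix n
  have [measurable]: "Measurable.pred (tuples {..<n}) (\<lambda>x :: nat \<Rightarrow> 'a. inj_on x {..<n})"
    by (intro inj_on_tuples_measurable) auto
  have [measurable]: "(\<lambda>x. G (x ` {..<n})) \<in> borel_measurable (tuples {..<n})"
    using assms by (simp add: LP_measurable_def)
  have "(\<lambda>x. if inj_on x {..<n} then W n * G (x ` {..<n}) else 0) \<in> borel_measurable (tuples {..<n})"
    by measurable
  then show "(\<lambda>x. if inj_on x {..<n} then W (card (x ` {..<n})) * G (x ` {..<n}) else 0)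
      \<in> borel_measurable (tuples {..<n})"
    by (simp add: card_image cong: if_cong)
qed

lemma LP_measurable_linear:
  "LP_measurable F \<Longrightarrow> LP_measurable G \<Longrightarrow> LP_measurable (\<lambda>\<eta>. a * F \<eta> + b * G \<eta>)"
  unfolding LP_measurable_def by (auto intro!: borel_measurable_add borel_measurable_times)

lemma LP_measurable_add:
  "LP_measurable F \<Longrightarrow> LP_measurable G \<Longrightarrow> LP_measurable (\<lambda>\<eta>. F \<eta> + G \<eta>)"
  using LP_measurable_linear[of F G 1 1] by simp

lemma LP_measurable_cmult: "LP_measurable F \<Longrightarrow> LP_measurable (\<lambda>\<eta>. a * F \<eta>)"
  using LP_measurable_linear[of F F a 0] by simp

text \<open>Reduces norms to the layer masses \<open>abs_mass n G\<close>, so that operator bounds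
  become inequalities between coefficients for each \<open>n\<close>.\<close>

lemma LC_nn_card_weight:
  assumes "LP_measurable G" "0 \<le> C"
  shows "LC_nn C (\<lambda>\<eta>. W (card \<eta>) * G \<eta>) = (\<Sum>n. ennreal (\<bar>W n\<bar> * C ^ n) * abs_mass n G)"
proof -
  have "LC_nn C (\<lambda>\<eta>. W (card \<eta>) * G \<eta>)
      = LP_nn_integral (\<lambda>\<eta>. (\<lambda>n. ennreal (\<bar>W n\<bar> * C ^ n)) (card \<eta>) * ennreal \<bar>G \<eta>\<bar>)"
    using assms(2) by (simp add: abs_mult ennreal_mult'' [symmetric] ac_simps)
  then show ?thesis
    using LP_nn_integral_card_weight[OF conf_measurable_abs[OF assms(1)]] by simp
qed

lemma LC_nn_eq_suminf:
  assumes "LP_measurable G" "0 \<le> C"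
  shows "LC_nn C G = (\<Sum>n. ennreal (C ^ n) * abs_mass n G)"
  using LC_nn_card_weight[OF assms, of "\<lambda>_. 1"] by simp

lemma abs_mass_card_weight:
  assumes "LP_measurable G"
  shows "abs_mass n (\<lambda>\<eta>. W (card \<eta>) * G \<eta>) = ennreal \<bar>W n\<bar> * abs_mass n G"
proof -
  have "inj_integral {..<n} (\<lambda>\<eta>. ennreal \<bar>W (card \<eta>) * G \<eta>\<bar>)
      = inj_integral {..<n} (\<lambda>\<eta>. (\<lambda>n. ennreal \<bar>W n\<bar>) (card \<eta>) * ennreal \<bar>G \<eta>\<bar>)"
    by (simp add: abs_mult ennreal_mult)
  also have "\<dots> = ennreal \<bar>W n\<bar> * inj_integral {..<n} (\<lambda>\<eta>. ennreal \<bar>G \<eta>\<bar>)"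
    using inj_integral_card_weight[OF conf_measurable_abs[OF assms], of "{..<n}" "\<lambda>n. ennreal \<bar>W n\<bar>"] by simp
  finally show ?thesis by (simp add: conf_mass_def mult.left_commute)
qed

lemma LC_nn_add_le:
  assumes "LP_measurable F" "LP_measurable G" "0 \<le> C"
  shows "LC_nn C (\<lambda>\<eta>. F \<eta> + G \<eta>) \<le> LC_nn C F + LC_nn C G"
proof -
  have m: "conf_measurable (\<lambda>\<eta>. ennreal (\<bar>H \<eta>\<bar> * C ^ card \<eta>))" if "LP_measurable H" for H :: "'a set \<Rightarrow> real"
    using conf_measurable_abs[OF LP_measurable_card_weight[OF that, of "\<lambda>n. C ^ n"]] assms(3)
    by (simp add: abs_mult mult.commute)
  have "LC_nn C (\<lambda>\<eta>. F \<eta> + G \<eta>)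
      \<le> LP_nn_integral (\<lambda>\<eta>. ennreal (\<bar>F \<eta>\<bar> * C ^ card \<eta>) + ennreal (\<bar>G \<eta>\<bar> * C ^ card \<eta>))"
    using assms(3)
    by (intro LP_nn_integral_mono)
       (auto simp: ennreal_plus[symmetric] distrib_right[symmetric] simp del: ennreal_plus
          intro!: ennreal_leI mult_right_mono)
  also have "\<dots> = LC_nn C F + LC_nn C G"
    using assms by (intro LP_nn_integral_add m)
  finally show ?thesis .
qed

lemma LC_nn_cmult:
  assumes "LP_measurable F" "0 \<le> C"
  shows "LC_nn C (\<lambda>\<eta>. a * F \<eta>) = ennreal \<bar>a\<bar> * LC_nn C F"
  using LC_nn_card_weight[OF assms, of "\<lambda>_. a"] LC_nn_eq_suminf[OF assms] assms(2)
  by (simp add: ennreal_mult mult.assoc)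

lemma LC_D:
  assumes "F \<in> LC C"
  shows "LP_measurable F" "ennreal (LC_norm C F) = LC_nn C F"
  using assms by (simp_all add: LC_def LC_norm_def)

lemma LC_norm_nonneg: "0 \<le> LC_norm C F"
  by (simp add: LC_norm_def)

lemma
  assumes "LP_measurable F" "LC_nn C F \<le> ennreal K" "0 \<le> K"
  shows LC_I: "F \<in> LC C" and LC_norm_leI: "LC_norm C F \<le> K"
proof -
  show "F \<in> LC C" using assms le_less_trans[OF assms(2), of \<infinity>] by (simp add: LC_def)
  show "LC_norm C F \<le> K"
    unfolding LC_norm_def using assms(2,3) by (simp add: enn2real_leI)
qed

lemma LC_linear:
  assumes "F \<in> LC C" "G \<in> LC C" "0 \<le> C"
  shows "(\<lambda>\<eta>. a * F \<eta> + b * G \<eta>) \<in> LC C"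
    and "LC_norm C (\<lambda>\<eta>. a * F \<eta> + b * G \<eta>) \<le> \<bar>a\<bar> * LC_norm C F + \<bar>b\<bar> * LC_norm C G"
proof -
  note m = LC_D(1)[OF assms(1)] LC_D(1)[OF assms(2)]
  have "LC_nn C (\<lambda>\<eta>. a * F \<eta> + b * G \<eta>) \<le> LC_nn C (\<lambda>\<eta>. a * F \<eta>) + LC_nn C (\<lambda>\<eta>. b * G \<eta>)"
    using m assms(3) by (intro LC_nn_add_le LP_measurable_cmult)
  also have "\<dots> = ennreal (\<bar>a\<bar> * LC_norm C F + \<bar>b\<bar> * LC_norm C G)"
    unfolding LC_nn_cmult[OF m(1) assms(3)] LC_nn_cmult[OF m(2) assms(3)]
      LC_D(2)[OF assms(1), symmetric] LC_D(2)[OF assms(2), symmetric]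
    by (simp add: ennreal_mult LC_norm_nonneg)
  finally have *: "LC_nn C (\<lambda>\<eta>. a * F \<eta> + b * G \<eta>) \<le> ennreal (\<bar>a\<bar> * LC_norm C F + \<bar>b\<bar> * LC_norm C G)" .
  have nn: "0 \<le> \<bar>a\<bar> * LC_norm C F + \<bar>b\<bar> * LC_norm C G" by (simp add: LC_norm_nonneg)
  show "(\<lambda>\<eta>. a * F \<eta> + b * G \<eta>) \<in> LC C"
    by (rule LC_I[OF LP_measurable_linear[OF m] * nn])
  show "LC_norm C (\<lambda>\<eta>. a * F \<eta> + b * G \<eta>) \<le> \<bar>a\<bar> * LC_norm C F + \<bar>b\<bar> * LC_norm C G"
    by (rule LC_norm_leI[OF LP_measurable_linear[OF m] * nn])
qed

text \<open>Both birth parts are instances, so the estimates are proved once and the comparison of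
  the generators becomes a statement about two kernels.\<close>

definition birth ::
    "('a::euclidean_space \<Rightarrow> real) \<Rightarrow> ('a \<Rightarrow> real) \<Rightarrow> ('a set \<Rightarrow> real) \<Rightarrow> 'a set \<Rightarrow> real" where
  "birth \<alpha> \<gamma> G \<eta> = (\<Sum>\<xi>\<in>Pow \<eta>. \<integral>x. e_lam (\<lambda>y. \<alpha> (x - y)) \<xi> * e_lam (\<lambda>y. \<gamma> (x - y)) (\<eta> - \<xi>) *
      G (insert x \<xi>) \<partial>lborel)"

lemma L2eps_eq_birth:
  "L2eps z \<phi> \<epsilon> G \<eta> = z * birth (\<lambda>v. exp (- \<epsilon> * \<phi> v)) (\<lambda>v. (exp (- \<epsilon> * \<phi> v) - 1) / \<epsilon>) G \<eta>"
  by (simp add: L2eps_def birth_def)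

lemma L2V_eq_birth: "L2V z \<phi> G \<eta> = z * birth (\<lambda>_. 1) (\<lambda>v. - \<phi> v) G \<eta>"
  by (simp add: L2V_def birth_def e_lam_def mult.commute)

lemma birth_image:
  assumes "inj_on x I"
  shows "birth \<alpha> \<gamma> G (x ` I) = (\<Sum>S\<in>Pow I. \<integral>y. (\<Prod>i\<in>S. \<alpha> (y - x i)) * (\<Prod>i\<in>I - S. \<gamma> (y - x i)) *
      G (insert y (x ` S)) \<partial>lborel)"
  unfolding birth_def
    sum_Pow_image[OF assms, where H = "\<lambda>\<xi> \<zeta>. \<integral>y. e_lam (\<lambda>v. \<alpha> (y - v)) \<xi> * e_lam (\<lambda>v. \<gamma> (y - v)) \<zeta> *
      G (insert y \<xi>) \<partial>lborel"]
proof (rule sum.cong[OF refl])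
  fix S assume "S \<in> Pow I"
  then have "inj_on x S" "inj_on x (I - S)" using assms by (auto intro: inj_on_subset)
  then show "(\<integral>y. e_lam (\<lambda>v. \<alpha> (y - v)) (x ` S) * e_lam (\<lambda>v. \<gamma> (y - v)) (x ` (I - S)) *
      G (insert y (x ` S)) \<partial>lborel) = (\<integral>y. (\<Prod>i\<in>S. \<alpha> (y - x i)) * (\<Prod>i\<in>I - S. \<gamma> (y - x i)) *
      G (insert y (x ` S)) \<partial>lborel)"
    by (simp add: e_lam_def prod.reindex)
qed

lemma LP_measurable_birth:
  fixes G :: "'a::euclidean_space set \<Rightarrow> real"
  assumes G: "LP_measurable G" and \<alpha>: "\<alpha> \<in> borel_measurable borel" and \<gamma>: "\<gamma> \<in> borel_measurable borel"
  shows "LP_measurable (birth \<alpha> \<gamma> G)"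
  unfolding LP_measurable_iff
proof (rule conf_measurableI_inj[where c = 0])
  fix n
  have "(\<lambda>x. \<integral>y. (\<Prod>i\<in>S. \<alpha> (y - x i)) * (\<Prod>i\<in>{..<n} - S. \<gamma> (y - x i)) * G (insert y (x ` S)) \<partial>lborel)
      \<in> borel_measurable (tuples {..<n})" if S: "S \<subseteq> {..<n}" for S
  proof (rule lborel.borel_measurable_lebesgue_integral)
    have "(\<lambda>p. (\<Prod>i\<in>S. case p of (x, y) \<Rightarrow> \<alpha> (y - x i)) * (\<Prod>i\<in>{..<n} - S. case p of (x, y) \<Rightarrow> \<gamma> (y - x i)) *
        (case p of (x, y) \<Rightarrow> G (insert y (x ` S)))) \<in> borel_measurable (tuples {..<n} \<Otimes>\<^sub>M lborel)"
      using assms S unfolding LP_measurable_iff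
      by (intro borel_measurable_times borel_measurable_prod tuples_pair_shift_measurable conf_measurable_insert) auto
    then show "(\<lambda>(x, y). (\<Prod>i\<in>S. \<alpha> (y - x i)) * (\<Prod>i\<in>{..<n} - S. \<gamma> (y - x i)) * G (insert y (x ` S)))
        \<in> borel_measurable (tuples {..<n} \<Otimes>\<^sub>M lborel)"
      by (simp add: split_beta)
  qed
  then have [measurable]: "(\<lambda>x. \<Sum>S\<in>Pow {..<n}. \<integral>y. (\<Prod>i\<in>S. \<alpha> (y - x i)) * (\<Prod>i\<in>{..<n} - S. \<gamma> (y - x i)) *
      G (insert y (x ` S)) \<partial>lborel) \<in> borel_measurable (tuples {..<n})"
    by (intro borel_measurable_sum) auto
  have [measurable]: "Measurable.pred (tuples {..<n}) (\<lambda>x :: nat \<Rightarrow> 'a. inj_on x {..<n})"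
    by (intro inj_on_tuples_measurable) auto
  have "(\<lambda>x. if inj_on x {..<n} then \<Sum>S\<in>Pow {..<n}. \<integral>y. (\<Prod>i\<in>S. \<alpha> (y - x i)) * (\<Prod>i\<in>{..<n} - S. \<gamma> (y - x i)) *
      G (insert y (x ` S)) \<partial>lborel else 0) \<in> borel_measurable (tuples {..<n})"
    by measurable
  then show "(\<lambda>x. if inj_on x {..<n} then birth \<alpha> \<gamma> G (x ` {..<n}) else 0) \<in> borel_measurable (tuples {..<n})"
    by (simp add: birth_image cong: if_cong)
qed

lemma conf_measurable_insert_section:
  fixes F :: "'a::euclidean_space set \<Rightarrow> 'b::topological_space"
  assumes "conf_measurable F" "finite \<xi>"
  shows "(\<lambda>y. F (insert y \<xi>)) \<in> borel_measurable lborel"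
proof -
  obtain f :: "nat \<Rightarrow> 'a" where f: "bij_betw f {..<card \<xi>} \<xi>"
    using ex_bij_betw_nat_finite[OF assms(2)] by (auto simp: atLeast0LessThan)
  define x where "x = restrict f {..<card \<xi>}"
  have im: "x ` {..<card \<xi>} = \<xi>" using f by (simp add: x_def bij_betw_def)
  have "x \<in> space (tuples {..<card \<xi>})" by (auto simp: x_def space_PiM)
  then have "(\<lambda>y. (x, y)) \<in> measurable lborel (tuples {..<card \<xi>} \<Otimes>\<^sub>M (lborel :: 'a measure))"
    by (rule measurable_Pair1')
  from measurable_compose[OF this conf_measurable_insert[OF assms(1) finite_lessThan order_refl]]
  show ?thesis by (simp add: im)
qed

text \<open>No integrability is assumed: a function that is not integrable has integral 0. Hence the
  bound of \<open>birth\<close> by its majorant holds at every configuration.\<close>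

lemma ennreal_abs_integral_le:
  fixes f :: "'b \<Rightarrow> real"
  shows "ennreal \<bar>\<integral>x. f x \<partial>M\<bar> \<le> (\<integral>\<^sup>+ x. ennreal \<bar>f x\<bar> \<partial>M)"
  using integral_norm_bound_ennreal[of M f]
  by (cases "integrable M f") (simp_all add: not_integrable_integral_eq)

text \<open>The pointwise bounds hold for the Vlasov kernel at once and for the renormalised one by
  \<open>0 \<le> 1 - exp (- s) \<le> s\<close> for \<open>s \<ge> 0\<close>; they make every
  estimate uniform in \<open>\<epsilon>\<close>.\<close>

locale birth_kernel =
  fixes \<phi> \<alpha> \<gamma> :: "'a::euclidean_space \<Rightarrow> real" and \<beta> :: real
  assumes phi_nonneg: "0 \<le> \<phi> v"
    and phi_even: "\<phi> (- v) = \<phi> v"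
    and phi_meas: "\<phi> \<in> borel_measurable borel"
    and phi_integrable: "integrable lborel \<phi>"
    and beta_eq: "\<beta> = integral\<^sup>L lborel \<phi>"
    and alpha_meas: "\<alpha> \<in> borel_measurable borel"
    and gamma_meas: "\<gamma> \<in> borel_measurable borel"
    and alpha_le: "\<bar>\<alpha> v\<bar> \<le> 1"
    and gamma_le: "\<bar>\<gamma> v\<bar> \<le> \<phi> v"
begin

lemma beta_nonneg: "0 \<le> \<beta>"
  using phi_nonneg by (simp add: beta_eq)

lemma nn_integral_phi_shift: "(\<integral>\<^sup>+ v. ennreal (\<phi> (y - v)) \<partial>lborel) = ennreal \<beta>"
proof -
  have "\<phi> (y - v) = \<phi> (- y + v)" for v
    using phi_even[of "y - v"] by simp
  then have "(\<integral>\<^sup>+ v. ennreal (\<phi> (y - v)) \<partial>lborel) = (\<integral>\<^sup>+ v. ennreal (\<phi> v) \<partial>distr lborel borel ((+) (- y)))"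
    using phi_meas by (simp add: nn_integral_distr)
  also have "\<dots> = (\<integral>\<^sup>+ v. ennreal (\<phi> v) \<partial>lborel)"
    by (simp only: lborel_distr_plus)
  also have "\<dots> = ennreal \<beta>"
    unfolding beta_eq using phi_nonneg by (intro nn_integral_eq_integral phi_integrable) auto
  finally show ?thesis .
qed

abbreviation majorant :: "(nat \<Rightarrow> nat \<Rightarrow> real) \<Rightarrow> ('a set \<Rightarrow> real) \<Rightarrow> 'a set \<Rightarrow> ennreal" where
  "majorant w G \<equiv> birth_majorant (\<lambda>p q. ennreal (w p q)) (\<lambda>v. ennreal (\<phi> v)) (\<lambda>\<eta>. ennreal \<bar>G \<eta>\<bar>)"

text \<open>\<open>s p\<close> collects the sum over the size \<open>q\<close> of the integrated
  block; \<open>t\<close> is a coefficient sequence dominating the result, shifted by one because of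
  the newborn point.\<close>

lemma LP_nn_integral_majorant_le:
  assumes G: "LP_measurable G" and w: "\<And>p q. 0 \<le> w p q"
    and s: "\<And>p. (\<lambda>q. w p q * (\<beta> ^ q / fact q)) sums s p"
    and t: "\<And>p. s p * real (Suc p) \<le> t (Suc p)"
  shows "LP_nn_integral (majorant w G) \<le> (\<Sum>n. ennreal (t n) * abs_mass n G)"
proof -
  have "LP_nn_integral (majorant w G) \<le> (\<Sum>p. \<Sum>q. ennreal (w p q) * (ennreal \<beta> ^ q * ennreal (1 / fact q)) *
      (of_nat (Suc p) * abs_mass (Suc p) G))"
    using phi_meas by (intro LP_nn_integral_birth_majorant_le conf_measurable_abs G nn_integral_phi_shift) auto
  also have "\<dots> \<le> (\<Sum>p. ennreal (t (Suc p)) * abs_mass (Suc p) G)"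
  proof (intro suminf_le)
    fix p
    have nn: "0 \<le> w p q * (\<beta> ^ q / fact q)" for q
      using w beta_nonneg by simp
    have "ennreal (w p q) * (ennreal \<beta> ^ q * ennreal (1 / fact q)) = ennreal (w p q * (\<beta> ^ q / fact q))" for q
      using w beta_nonneg by (simp add: ennreal_power ennreal_mult[symmetric])
    then have "(\<Sum>q. ennreal (w p q) * (ennreal \<beta> ^ q * ennreal (1 / fact q)) * (of_nat (Suc p) * abs_mass (Suc p) G))
      = (\<Sum>q. ennreal (w p q * (\<beta> ^ q / fact q)) * (of_nat (Suc p) * abs_mass (Suc p) G))"
      by simp
    also have "\<dots> = ennreal (s p) * (of_nat (Suc p) * abs_mass (Suc p) G)"
      using suminf_ennreal_eq[OF nn s] by (simp add: ennreal_suminf_multc)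
    also have "\<dots> = ennreal (s p * real (Suc p)) * abs_mass (Suc p) G"
    proof -
      have "0 \<le> s p" using sums_le[OF nn sums_zero s] .
      then show ?thesis
        unfolding ennreal_of_nat_eq_real_of_nat by (subst ennreal_mult) (simp_all add: mult.assoc)
    qed
    also have "\<dots> \<le> ennreal (t (Suc p)) * abs_mass (Suc p) G"
      using t by (intro mult_right_mono ennreal_leI) auto
    finally show "(\<Sum>q. ennreal (w p q) * (ennreal \<beta> ^ q * ennreal (1 / fact q)) *
      (of_nat (Suc p) * abs_mass (Suc p) G)) \<le> ennreal (t (Suc p)) * abs_mass (Suc p) G" .
  qed auto
  \<comment> \<open>Starting the series at \<open>0\<close> instead of \<open>1\<close> only adds a
    nonnegative term.\<close>
  also have "\<dots> \<le> (\<Sum>n. ennreal (t n) * abs_mass n G)"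
  proof (rule suminf_le_const)
    fix N
    have "(\<Sum>p<N. ennreal (t (Suc p)) * abs_mass (Suc p) G) \<le> (\<Sum>n<Suc N. ennreal (t n) * abs_mass n G)"
      unfolding sum.lessThan_Suc_shift by simp
    also have "\<dots> \<le> (\<Sum>n. ennreal (t n) * abs_mass n G)"
      by (intro sum_le_suminf) auto
    finally show "(\<Sum>p<N. ennreal (t (Suc p)) * abs_mass (Suc p) G) \<le> (\<Sum>n. ennreal (t n) * abs_mass n G)" .
  qed auto
  finally show ?thesis .
qed

text \<open>The factor \<open>C ^ card \<eta>\<close> depends only on the two block sizes and moves
  into the weight. The bound on \<open>F\<close> is asked almost everywhere, since differences of
  birth terms can be expanded only where the integrals converge.\<close>

lemma LC_nn_le_of_majorant:
  assumes G: "LP_measurable G"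
    and F: "LP_AE (\<lambda>\<eta>. ennreal \<bar>F \<eta>\<bar> \<le> majorant w G \<eta>)"
    and w: "\<And>p q. 0 \<le> w p q" and C: "0 \<le> C"
    and s: "\<And>p. (\<lambda>q. C ^ (p + q) * w p q * (\<beta> ^ q / fact q)) sums s p"
    and t: "\<And>p. s p * real (Suc p) \<le> t (Suc p)"
  shows "LC_nn C F \<le> (\<Sum>n. ennreal (t n) * abs_mass n G)"
proof -
  have "LC_nn C F \<le> LP_nn_integral (majorant (\<lambda>p q. C ^ (p + q) * w p q) G)"
  proof (rule LP_nn_integral_mono_AE, rule LP_AE_mp[OF F])
    fix \<eta> :: "'a set" assume \<eta>: "finite \<eta>" and le: "ennreal \<bar>F \<eta>\<bar> \<le> majorant w G \<eta>"
    have "ennreal (\<bar>F \<eta>\<bar> * C ^ card \<eta>) = ennreal (C ^ card \<eta>) * ennreal \<bar>F \<eta>\<bar>"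
      using C by (simp add: ennreal_mult mult.commute)
    also have "\<dots> \<le> ennreal (C ^ card \<eta>) * majorant w G \<eta>"
      using le by (rule mult_left_mono) simp
    also have "\<dots> = majorant (\<lambda>p q. C ^ (p + q) * w p q) G \<eta>"
      unfolding birth_majorant_def sum_distrib_left
    proof (rule sum.cong[OF refl])
      fix \<xi> assume "\<xi> \<in> Pow \<eta>"
      then have "card \<eta> = card \<xi> + card (\<eta> - \<xi>)"
        using \<eta> by (metis PowD card_Diff_subset card_mono finite_subset le_add_diff_inverse)
      then show "ennreal (C ^ card \<eta>) * (ennreal (w (card \<xi>) (card (\<eta> - \<xi>))) *
          (\<integral>\<^sup>+ y. ennreal \<bar>G (insert y \<xi>)\<bar> * (\<Prod>v\<in>\<eta> - \<xi>. ennreal (\<phi> (y - v))) \<partial>lborel))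
        = ennreal (C ^ (card \<xi> + card (\<eta> - \<xi>)) * w (card \<xi>) (card (\<eta> - \<xi>))) *
          (\<integral>\<^sup>+ y. ennreal \<bar>G (insert y \<xi>)\<bar> * (\<Prod>v\<in>\<eta> - \<xi>. ennreal (\<phi> (y - v))) \<partial>lborel)"
        using C w by (simp add: ennreal_mult mult.assoc)
    qed
    finally show "ennreal (\<bar>F \<eta>\<bar> * C ^ card \<eta>) \<le> majorant (\<lambda>p q. C ^ (p + q) * w p q) G \<eta>" .
  qed
  also have "\<dots> \<le> (\<Sum>n. ennreal (t n) * abs_mass n G)"
    using w C s t by (intro LP_nn_integral_majorant_le[OF G]) auto
  finally show ?thesis .
qed

lemma abs_kernel_le:
  "\<bar>e_lam (\<lambda>y. \<alpha> (x - y)) \<xi> * e_lam (\<lambda>y. \<gamma> (x - y)) \<zeta>\<bar> \<le> (\<Prod>y\<in>\<zeta>. \<phi> (x - y))"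
proof -
  have "\<bar>e_lam (\<lambda>y. \<alpha> (x - y)) \<xi>\<bar> \<le> 1"
    unfolding e_lam_def abs_prod using alpha_le by (intro prod_le_1) auto
  moreover have "\<bar>e_lam (\<lambda>y. \<gamma> (x - y)) \<zeta>\<bar> \<le> (\<Prod>y\<in>\<zeta>. \<phi> (x - y))"
    unfolding e_lam_def abs_prod using gamma_le by (intro prod_mono) auto
  ultimately show ?thesis
    unfolding abs_mult using mult_mono[of _ 1] by fastforce
qed

lemma kernel_measurable:
  assumes "LP_measurable G" "finite \<xi>"
  shows "(\<lambda>x. e_lam (\<lambda>y. \<alpha> (x - y)) \<xi> * e_lam (\<lambda>y. \<gamma> (x - y)) \<zeta> * G (insert x \<xi>)) \<in> borel_measurable lborel"
proof -
  have "(\<lambda>x. x - y) \<in> measurable lborel borel" for y :: 'a by simp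
  then show ?thesis
    unfolding e_lam_def using assms alpha_meas gamma_meas
    by (intro borel_measurable_times borel_measurable_prod conf_measurable_insert_section)
       (auto simp: LP_measurable_iff intro: measurable_compose)
qed

lemma nn_integral_kernel_le:
  "(\<integral>\<^sup>+ x. ennreal \<bar>e_lam (\<lambda>y. \<alpha> (x - y)) \<xi> * e_lam (\<lambda>y. \<gamma> (x - y)) \<zeta> * G (insert x \<xi>)\<bar> \<partial>lborel)
    \<le> (\<integral>\<^sup>+ x. ennreal \<bar>G (insert x \<xi>)\<bar> * (\<Prod>y\<in>\<zeta>. ennreal (\<phi> (x - y))) \<partial>lborel)"
proof (rule nn_integral_mono)
  fix x
  have "\<bar>e_lam (\<lambda>y. \<alpha> (x - y)) \<xi> * e_lam (\<lambda>y. \<gamma> (x - y)) \<zeta> * G (insert x \<xi>)\<bar>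
      \<le> (\<Prod>y\<in>\<zeta>. \<phi> (x - y)) * \<bar>G (insert x \<xi>)\<bar>"
    unfolding abs_mult[of _ "G _"] by (intro mult_right_mono abs_kernel_le) auto
  then have "ennreal \<bar>e_lam (\<lambda>y. \<alpha> (x - y)) \<xi> * e_lam (\<lambda>y. \<gamma> (x - y)) \<zeta> * G (insert x \<xi>)\<bar>
      \<le> ennreal ((\<Prod>y\<in>\<zeta>. \<phi> (x - y)) * \<bar>G (insert x \<xi>)\<bar>)"
    by (rule ennreal_leI)
  also have "\<dots> = ennreal \<bar>G (insert x \<xi>)\<bar> * (\<Prod>y\<in>\<zeta>. ennreal (\<phi> (x - y)))"
    using phi_nonneg by (simp add: ennreal_mult prod_nonneg prod_ennreal mult.commute)
  finally show "ennreal \<bar>e_lam (\<lambda>y. \<alpha> (x - y)) \<xi> * e_lam (\<lambda>y. \<gamma> (x - y)) \<zeta> * G (insert x \<xi>)\<bar>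
      \<le> ennreal \<bar>G (insert x \<xi>)\<bar> * (\<Prod>y\<in>\<zeta>. ennreal (\<phi> (x - y)))" .
qed

lemma abs_birth_le_majorant: "ennreal \<bar>birth \<alpha> \<gamma> G \<eta>\<bar> \<le> majorant (\<lambda>_ _. 1) G \<eta>"
proof -
  let ?k = "\<lambda>\<xi> x. e_lam (\<lambda>y. \<alpha> (x - y)) \<xi> * e_lam (\<lambda>y. \<gamma> (x - y)) (\<eta> - \<xi>) * G (insert x \<xi>)"
  have "ennreal \<bar>birth \<alpha> \<gamma> G \<eta>\<bar> \<le> ennreal (\<Sum>\<xi>\<in>Pow \<eta>. \<bar>\<integral>x. ?k \<xi> x \<partial>lborel\<bar>)"
    unfolding birth_def by (intro ennreal_leI sum_abs)
  also have "\<dots> = (\<Sum>\<xi>\<in>Pow \<eta>. ennreal \<bar>\<integral>x. ?k \<xi> x \<partial>lborel\<bar>)"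
    by (simp add: sum_ennreal)
  also have "\<dots> \<le> majorant (\<lambda>_ _. 1) G \<eta>"
    unfolding birth_majorant_def ennreal_1 mult_1
    by (intro sum_mono order_trans[OF ennreal_abs_integral_le] nn_integral_kernel_le)
  finally show ?thesis .
qed

lemma kernel_integrable:
  assumes "LP_measurable G" "finite \<eta>" "\<xi> \<subseteq> \<eta>" "majorant (\<lambda>_ _. 1) G \<eta> < \<infinity>"
  shows "integrable lborel (\<lambda>x. e_lam (\<lambda>y. \<alpha> (x - y)) \<xi> * e_lam (\<lambda>y. \<gamma> (x - y)) (\<eta> - \<xi>) * G (insert x \<xi>))"
proof (rule integrableI_bounded)
  show "(\<lambda>x. e_lam (\<lambda>y. \<alpha> (x - y)) \<xi> * e_lam (\<lambda>y. \<gamma> (x - y)) (\<eta> - \<xi>) * G (insert x \<xi>)) \<in> borel_measurable lborel"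
    using assms finite_subset by (intro kernel_measurable) auto
  have "(\<integral>\<^sup>+ x. ennreal \<bar>e_lam (\<lambda>y. \<alpha> (x - y)) \<xi> * e_lam (\<lambda>y. \<gamma> (x - y)) (\<eta> - \<xi>) * G (insert x \<xi>)\<bar> \<partial>lborel)
    \<le> (\<integral>\<^sup>+ x. ennreal \<bar>G (insert x \<xi>)\<bar> * (\<Prod>y\<in>\<eta> - \<xi>. ennreal (\<phi> (x - y))) \<partial>lborel)"
    by (rule nn_integral_kernel_le)
  also have "\<dots> \<le> majorant (\<lambda>_ _. 1) G \<eta>"
    unfolding birth_majorant_def using assms
    using member_le_sum[of \<xi> "Pow \<eta>" "\<lambda>\<xi>. \<integral>\<^sup>+ x. ennreal \<bar>G (insert x \<xi>)\<bar> * (\<Prod>y\<in>\<eta> - \<xi>. ennreal (\<phi> (x - y))) \<partial>lborel"]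
    by auto
  also have "\<dots> < \<infinity>" by fact
  finally show "(\<integral>\<^sup>+ x. ennreal (norm (e_lam (\<lambda>y. \<alpha> (x - y)) \<xi> * e_lam (\<lambda>y. \<gamma> (x - y)) (\<eta> - \<xi>) * G (insert x \<xi>))) \<partial>lborel) < \<infinity>"
    by simp
qed

text \<open>Finite majorants make every integral in \<open>birth\<close> converge; with the value 0
  for divergent integrals additivity could fail.\<close>

lemma birth_diff:
  assumes "LP_measurable F" "LP_measurable G" "finite \<eta>"
    "majorant (\<lambda>_ _. 1) F \<eta> < \<infinity>" "majorant (\<lambda>_ _. 1) G \<eta> < \<infinity>"
  shows "birth \<alpha> \<gamma> (\<lambda>\<eta>. F \<eta> - G \<eta>) \<eta> = birth \<alpha> \<gamma> F \<eta> - birth \<alpha> \<gamma> G \<eta>"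
  unfolding birth_def sum_subtractf[symmetric]
proof (rule sum.cong[OF refl])
  fix \<xi> assume "\<xi> \<in> Pow \<eta>"
  then show "(\<integral>x. e_lam (\<lambda>y. \<alpha> (x - y)) \<xi> * e_lam (\<lambda>y. \<gamma> (x - y)) (\<eta> - \<xi>) * (F (insert x \<xi>) - G (insert x \<xi>)) \<partial>lborel)
    = (\<integral>x. e_lam (\<lambda>y. \<alpha> (x - y)) \<xi> * e_lam (\<lambda>y. \<gamma> (x - y)) (\<eta> - \<xi>) * F (insert x \<xi>) \<partial>lborel)
     - (\<integral>x. e_lam (\<lambda>y. \<alpha> (x - y)) \<xi> * e_lam (\<lambda>y. \<gamma> (x - y)) (\<eta> - \<xi>) * G (insert x \<xi>) \<partial>lborel)"
    using assms
    by (subst Bochner_Integration.integral_diff[symmetric]) (auto intro: kernel_integrable simp: right_diff_distrib)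
qed

text \<open>The series of \<open>(C * \<beta>) ^ q / fact q\<close> gives
  \<open>exp (C * \<beta>)\<close>, and the condition on \<open>z\<close> exchanges
  \<open>z * exp (C * \<beta>)\<close> for one more factor \<open>C\<close>. The resulting
  coefficient is that of the death part.\<close>

lemma LC_nn_birth_le:
  assumes G: "LP_measurable G" and C: "0 < C" and z: "0 \<le> z" "z * exp (C * \<beta>) \<le> C"
  shows "LC_nn C (\<lambda>\<eta>. z * birth \<alpha> \<gamma> G \<eta>) \<le> (\<Sum>n. ennreal (real n * C ^ n) * abs_mass n G)"
proof (rule LC_nn_le_of_majorant[OF G, where w = "\<lambda>_ _. z" and s = "\<lambda>p. z * C ^ p * exp (C * \<beta>)"])
  show "LP_AE (\<lambda>\<eta>. ennreal \<bar>z * birth \<alpha> \<gamma> G \<eta>\<bar> \<le> majorant (\<lambda>_ _. z) G \<eta>)"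
  proof (rule LP_AE_I)
    fix \<eta> :: "'a set"
    have "ennreal \<bar>z * birth \<alpha> \<gamma> G \<eta>\<bar> = ennreal z * ennreal \<bar>birth \<alpha> \<gamma> G \<eta>\<bar>"
      using z by (simp add: abs_mult ennreal_mult)
    also have "\<dots> \<le> ennreal z * majorant (\<lambda>_ _. 1) G \<eta>"
      by (intro mult_left_mono abs_birth_le_majorant) auto
    also have "\<dots> = majorant (\<lambda>_ _. z) G \<eta>"
      by (simp add: birth_majorant_def sum_distrib_left)
    finally show "ennreal \<bar>z * birth \<alpha> \<gamma> G \<eta>\<bar> \<le> majorant (\<lambda>_ _. z) G \<eta>" .
  qed
  show "(\<lambda>q. C ^ (p + q) * z * (\<beta> ^ q / fact q)) sums (z * C ^ p * exp (C * \<beta>))" for p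
    using sums_mult[OF exp_converges[of "C * \<beta>"], of "z * C ^ p"]
    by (simp add: power_add power_mult_distrib field_simps)
  show "z * C ^ p * exp (C * \<beta>) * real (Suc p) \<le> real (Suc p) * C ^ Suc p" for p
  proof -
    have "(z * exp (C * \<beta>)) * (C ^ p * real (Suc p)) \<le> C * (C ^ p * real (Suc p))"
      using C z by (intro mult_right_mono) auto
    then show ?thesis by (simp add: ac_simps)
  qed
qed (use C z in auto)

end

section \<open>Estimates for the generators\<close>

definition gen :: "real \<Rightarrow> ('a::euclidean_space \<Rightarrow> real) \<Rightarrow> ('a \<Rightarrow> real) \<Rightarrow> ('a set \<Rightarrow> real) \<Rightarrow> 'a set \<Rightarrow> real" where
  "gen z \<alpha> \<gamma> G \<eta> = L1 G \<eta> + z * birth \<alpha> \<gamma> G \<eta>"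

lemma L_ren_eq_gen:
  "L_ren z \<phi> \<epsilon> = gen z (\<lambda>v. exp (- \<epsilon> * \<phi> v)) (\<lambda>v. (exp (- \<epsilon> * \<phi> v) - 1) / \<epsilon>)"
  by (intro ext) (simp add: L_ren_def gen_def L2eps_eq_birth)

lemma L_V_eq_gen: "L_V z \<phi> = gen z (\<lambda>_. 1) (\<lambda>v. - \<phi> v)"
  by (intro ext) (simp add: L_V_def gen_def L2V_eq_birth)

text \<open>It will be applied to the argument of \<open>gen\<close>, not to its value: this
  preserves the balance of births and deaths caused by each layer of the argument.\<close>

definition cutoff :: "nat \<Rightarrow> ('a set \<Rightarrow> real) \<Rightarrow> 'a set \<Rightarrow> real" where
  "cutoff m G \<eta> = of_bool (card \<eta> \<le> m) * G \<eta>"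

lemma LP_measurable_cutoff: "LP_measurable G \<Longrightarrow> LP_measurable (cutoff m G)"
  unfolding cutoff_def using LP_measurable_card_weight[of G "\<lambda>n. of_bool (n \<le> m)"] by simp

lemma abs_mass_cutoff: "LP_measurable G \<Longrightarrow> abs_mass n (cutoff m G) = ennreal (of_bool (n \<le> m)) * abs_mass n G"
  unfolding cutoff_def using abs_mass_card_weight[of G n "\<lambda>n. of_bool (n \<le> m)"] by simp

lemma abs_mass_diff_cutoff:
  assumes "LP_measurable G"
  shows "abs_mass n (\<lambda>\<eta>. G \<eta> - cutoff m G \<eta>) = ennreal (of_bool (m < n)) * abs_mass n G"
proof -
  have "G \<eta> - cutoff m G \<eta> = of_bool (m < card \<eta>) * G \<eta>" for \<eta>
    by (simp add: cutoff_def)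
  then show ?thesis
    using abs_mass_card_weight[OF assms, of n "\<lambda>n. of_bool (m < n)"] by simp
qed

lemma LP_measurable_diff:
  "LP_measurable F \<Longrightarrow> LP_measurable G \<Longrightarrow> LP_measurable (\<lambda>\<eta>. F \<eta> - G \<eta>)"
  using LP_measurable_linear[of F G 1 "-1"] by simp

lemma suminf_abs_mass_le:
  assumes "F \<in> LC C" "0 \<le> C" "0 \<le> K" "\<And>n. t n \<le> K * C ^ n"
  shows "(\<Sum>n. ennreal (t n) * abs_mass n F) \<le> ennreal (K * LC_norm C F)"
proof -
  have "(\<Sum>n. ennreal (t n) * abs_mass n F) \<le> (\<Sum>n. ennreal K * (ennreal (C ^ n) * abs_mass n F))"
    using assms(2-4)
    by (intro suminf_le) (auto simp: ennreal_mult[symmetric] mult.assoc[symmetric] intro!: mult_right_mono ennreal_leI)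
  also have "\<dots> = ennreal K * LC_nn C F"
    by (simp add: LC_nn_eq_suminf[OF LC_D(1)[OF assms(1)] assms(2)])
  also have "\<dots> = ennreal (K * LC_norm C F)"
    unfolding LC_D(2)[OF assms(1), symmetric] using assms(3) by (simp add: ennreal_mult LC_norm_nonneg)
  finally show ?thesis .
qed

section \<open>Elementary inequalities: powers of two against polynomials, and the
  exponential\<close>

lemma two_mult_le_power2: "2 * real n \<le> 2 ^ n"
proof (induction n)
  case (Suc n)
  show ?case
  proof (cases "n = 0")
    case False
    then have "(2::real) ^ 1 \<le> 2 ^ n" by (intro power_increasing) auto
    with Suc show ?thesis by simp
  qed simp
qed simp

lemma square_le_power2: "real n * real n \<le> 2 * 2 ^ n"
proof -
  \<comment> \<open>The induction starts at 3 because doubling the square of 2 does not reach the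
    square of 3.\<close>
  have "real (k + 3) * real (k + 3) \<le> 2 * 2 ^ (k + 3)" for k
  proof (induction k)
    case (Suc k)
    have "real (Suc k + 3) * real (Suc k + 3) \<le> 2 * (real (k + 3) * real (k + 3))"
      by (simp add: algebra_simps)
    also have "\<dots> \<le> 2 * (2 * 2 ^ (k + 3))" using Suc by (rule mult_left_mono) simp
    finally show ?case by (simp add: power_add)
  qed simp
  note large = this
  show ?thesis
  proof (cases "n < 3")
    case True
    then have "n \<in> {0, 1, 2}" by auto
    then show ?thesis by auto
  next
    case False
    then show ?thesis using large[of "n - 3"] by simp
  qed
qed

text \<open>\<open>Suc p\<close> will come from the newborn point and \<open>p + 1 / 2\<close> from
  comparing kernels. The induction proves the doubled inequality from \<open>p = 3\<close>
  on.\<close>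

lemma quadratic_le_power2: "real (Suc p) * (real p + 1 / 2) \<le> 2 ^ Suc p"
proof -
  have "(real k + 4) * (2 * real k + 7) \<le> 2 * 2 ^ (k + 4)" for k
  proof (induction k)
    case (Suc k)
    have "(real (Suc k) + 4) * (2 * real (Suc k) + 7) \<le> 2 * ((real k + 4) * (2 * real k + 7))"
      by (simp add: algebra_simps)
    also have "\<dots> \<le> 2 * (2 * 2 ^ (k + 4))" using Suc by (rule mult_left_mono) simp
    finally show ?case by (simp add: power_add)
  qed simp
  from this[of "p - 3"] show ?thesis
    by (cases "p < 3") (auto simp: less_Suc_eq numeral_3_eq_3 of_nat_diff field_simps)
qed

lemma sums_nat_exp:
  fixes x :: real
  shows "(\<lambda>q. real q * (x ^ q / fact q)) sums (x * exp x)"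
proof -
  have "(\<lambda>q. real (Suc q) * (x ^ Suc q / fact (Suc q))) sums (x * exp x)"
    using sums_mult[OF exp_converges[of x], of x]
    by (simp add: field_simps del: of_nat_Suc)
  from sums_Suc[OF this] show ?thesis by simp
qed

text \<open>The product \<open>(1 - s + s^2 / 2) * (1 + s + s^2 / 2)\<close> equals
  \<open>1 + s^4 / 4\<close>, hence is at least 1, and its second factor is at most
  \<open>exp s\<close>.\<close>

lemma exp_neg_le_quadratic:
  fixes s :: real
  assumes "0 \<le> s"
  shows "exp (- s) \<le> 1 - s + s\<^sup>2 / 2"
proof -
  have "1 \<le> 1 + (s\<^sup>2)\<^sup>2 / 4" by simp
  also have "\<dots> = (1 - s + s\<^sup>2 / 2) * (1 + s + s\<^sup>2 / 2)"
    by (simp add: power2_eq_square algebra_simps)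
  also have "\<dots> \<le> (1 - s + s\<^sup>2 / 2) * exp s"
  proof (rule mult_left_mono)
    show "1 + s + s\<^sup>2 / 2 \<le> exp s" using assms by (rule exp_lower_Taylor_quadratic)
    have "0 \<le> ((1 - s)\<^sup>2 + 1) / 2" by simp
    also have "\<dots> = 1 - s + s\<^sup>2 / 2" by (simp add: power2_eq_square field_simps)
    finally show "0 \<le> 1 - s + s\<^sup>2 / 2" .
  qed
  finally show ?thesis by (simp add: exp_minus field_simps)
qed

section \<open>Norm bounds for the generator, its truncation and the Euler step\<close>

context birth_kernel
begin

lemma LP_measurable_gen:
  assumes "LP_measurable G"
  shows "LP_measurable (gen z \<alpha> \<gamma> G)"
proof -
  have "LP_measurable (\<lambda>\<eta>. - real (card \<eta>) * G \<eta> + z * birth \<alpha> \<gamma> G \<eta>)"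
    using LP_measurable_card_weight[OF assms, of "\<lambda>n. - real n"]
    by (intro LP_measurable_add LP_measurable_cmult LP_measurable_birth assms alpha_meas gamma_meas)
  then show ?thesis by (simp add: gen_def[abs_def] L1_def)
qed

text \<open>The condition on \<open>z\<close> makes the birth part no larger than the death part, which is the source
  of all contractivity.\<close>

lemma LC_nn_weight_birth_le:
  assumes G: "LP_measurable G" and F: "LP_measurable F" and C: "0 < C" and z: "0 \<le> z" "z * exp (C * \<beta>) \<le> C"
    and h: "0 \<le> h"
  shows "LC_nn C (\<lambda>\<eta>. W (card \<eta>) * F \<eta> + h * (z * birth \<alpha> \<gamma> G \<eta>))
    \<le> (\<Sum>n. ennreal (\<bar>W n\<bar> * C ^ n) * abs_mass n F) + (\<Sum>n. ennreal (h * (real n * C ^ n)) * abs_mass n G)"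
proof -
  have C0: "0 \<le> C" using C by simp
  have m: "LP_measurable (\<lambda>\<eta>. z * birth \<alpha> \<gamma> G \<eta>)"
    by (intro LP_measurable_cmult LP_measurable_birth G alpha_meas gamma_meas)
  have "LC_nn C (\<lambda>\<eta>. W (card \<eta>) * F \<eta> + h * (z * birth \<alpha> \<gamma> G \<eta>))
      \<le> LC_nn C (\<lambda>\<eta>. W (card \<eta>) * F \<eta>) + LC_nn C (\<lambda>\<eta>. h * (z * birth \<alpha> \<gamma> G \<eta>))"
    by (intro LC_nn_add_le LP_measurable_card_weight LP_measurable_cmult[OF m] F C0)
  also have "LC_nn C (\<lambda>\<eta>. h * (z * birth \<alpha> \<gamma> G \<eta>)) = ennreal h * LC_nn C (\<lambda>\<eta>. z * birth \<alpha> \<gamma> G \<eta>)"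
    using LC_nn_cmult[OF m C0, of h] h by simp
  also have "\<dots> \<le> ennreal h * (\<Sum>n. ennreal (real n * C ^ n) * abs_mass n G)"
    by (intro mult_left_mono LC_nn_birth_le G C z) auto
  also have "\<dots> = (\<Sum>n. ennreal (h * (real n * C ^ n)) * abs_mass n G)"
    using h C by (simp add: ennreal_mult mult.assoc)
  finally show ?thesis
    by (simp add: LC_nn_card_weight[OF F C0])
qed

lemma LC_nn_gen_le:
  assumes G: "LP_measurable G" and C: "0 < C" and z: "0 \<le> z" "z * exp (C * \<beta>) \<le> C"
  shows "LC_nn C (gen z \<alpha> \<gamma> G) \<le> (\<Sum>n. ennreal (2 * real n * C ^ n) * abs_mass n G)"
proof -
  have "LC_nn C (gen z \<alpha> \<gamma> G) \<le> (\<Sum>n. ennreal (\<bar>- real n\<bar> * C ^ n) * abs_mass n G)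
      + (\<Sum>n. ennreal (1 * (real n * C ^ n)) * abs_mass n G)"
    using LC_nn_weight_birth_le[OF G G C z, of 1 "\<lambda>n. - real n"]
    by (simp add: gen_def[abs_def] L1_def)
  also have "\<dots> = (\<Sum>n. ennreal (2 * real n * C ^ n) * abs_mass n G)"
    using C by (subst suminf_add)
      (auto simp: distrib_right[symmetric] ennreal_plus[symmetric] simp del: ennreal_plus)
  finally show ?thesis .
qed

text \<open>Deaths and births contribute \<open>n * C ^ n\<close> each, and the doubled weight
  absorbs \<open>2 * n\<close>, so the operator norm from \<open>LC (2 * C)\<close> to
  \<open>LC C\<close> is at most 1.\<close>

lemma
  assumes u: "u \<in> LC (2 * C)" and C: "0 < C" and z: "0 \<le> z" "z * exp (C * \<beta>) \<le> C"
  shows gen_in_LC: "gen z \<alpha> \<gamma> u \<in> LC C"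
    and LC_norm_gen_le: "LC_norm C (gen z \<alpha> \<gamma> u) \<le> LC_norm (2 * C) u"
proof -
  have "2 * real n * C ^ n \<le> 1 * (2 * C) ^ n" for n
    using mult_right_mono[OF two_mult_le_power2, of "C ^ n" n] C by (simp add: power_mult_distrib)
  then have "LC_nn C (gen z \<alpha> \<gamma> u) \<le> ennreal (1 * LC_norm (2 * C) u)"
    using C by (intro order_trans[OF LC_nn_gen_le[OF LC_D(1)[OF u] C z]] suminf_abs_mass_le[OF u]) auto
  then have *: "LC_nn C (gen z \<alpha> \<gamma> u) \<le> ennreal (LC_norm (2 * C) u)" by simp
  note m = LP_measurable_gen[OF LC_D(1)[OF u]]
  show "gen z \<alpha> \<gamma> u \<in> LC C" by (rule LC_I[OF m * LC_norm_nonneg])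
  show "LC_norm C (gen z \<alpha> \<gamma> u) \<le> LC_norm (2 * C) u" by (rule LC_norm_leI[OF m * LC_norm_nonneg])
qed

text \<open>Only layers \<open>n \<le> m\<close> contribute, so \<open>2 * n\<close> is at most
  \<open>2 * m\<close> and the truncated operator is bounded on a single space.\<close>

lemma
  assumes u: "u \<in> LC C" and C: "0 < C" and z: "0 \<le> z" "z * exp (C * \<beta>) \<le> C"
  shows gen_cutoff_in_LC: "gen z \<alpha> \<gamma> (cutoff m u) \<in> LC C"
    and LC_norm_gen_cutoff_le: "LC_norm C (gen z \<alpha> \<gamma> (cutoff m u)) \<le> 2 * real m * LC_norm C u"
proof -
  note mu = LC_D(1)[OF u] and mcut = LP_measurable_cutoff[OF LC_D(1)[OF u]]
  have "LC_nn C (gen z \<alpha> \<gamma> (cutoff m u)) \<le> (\<Sum>n. ennreal (2 * real n * C ^ n) * abs_mass n (cutoff m u))"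
    by (rule LC_nn_gen_le[OF mcut C z])
  also have "\<dots> = (\<Sum>n. ennreal (2 * real n * C ^ n * of_bool (n \<le> m)) * abs_mass n u)"
    using C by (intro arg_cong[where f = suminf] ext)
      (simp add: abs_mass_cutoff[OF mu] ennreal_mult mult.assoc)
  also have "\<dots> \<le> ennreal (2 * real m * LC_norm C u)"
    using C by (intro suminf_abs_mass_le[OF u]) (auto intro!: mult_right_mono)
  finally have *: "LC_nn C (gen z \<alpha> \<gamma> (cutoff m u)) \<le> ennreal (2 * real m * LC_norm C u)" .
  have nn: "0 \<le> 2 * real m * LC_norm C u" by (simp add: LC_norm_nonneg)
  show "gen z \<alpha> \<gamma> (cutoff m u) \<in> LC C" by (rule LC_I[OF LP_measurable_gen[OF mcut] * nn])
  show "LC_norm C (gen z \<alpha> \<gamma> (cutoff m u)) \<le> 2 * real m * LC_norm C u"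
    by (rule LC_norm_leI[OF LP_measurable_gen[OF mcut] * nn])
qed

text \<open>By \<open>h * real m \<le> 1\<close> the fraction \<open>1 - h * n\<close> left by
  deaths is nonnegative for \<open>n \<le> m\<close>, so its absolute value is harmless. Births add
  back at most \<open>h * n\<close>, which restores the coefficient \<open>C ^ n\<close>; layers
  above \<open>m\<close> are untouched.\<close>

lemma
  assumes u: "u \<in> LC C" and C: "0 < C" and z: "0 \<le> z" "z * exp (C * \<beta>) \<le> C"
    and h: "0 \<le> h" "h * real m \<le> 1"
  shows euler_step_in_LC: "(\<lambda>\<eta>. u \<eta> + h * gen z \<alpha> \<gamma> (cutoff m u) \<eta>) \<in> LC C"
    and LC_norm_euler_step_le: "LC_norm C (\<lambda>\<eta>. u \<eta> + h * gen z \<alpha> \<gamma> (cutoff m u) \<eta>) \<le> LC_norm C u"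
proof -
  note mu = LC_D(1)[OF u] and mcut = LP_measurable_cutoff[OF LC_D(1)[OF u]]
  define W where "W n = 1 - h * real n * of_bool (n \<le> m)" for n
  have W: "0 \<le> W n" for n
    using h mult_left_mono[of "real n" "real m" h] by (auto simp: W_def)
  have eq: "u \<eta> + h * gen z \<alpha> \<gamma> (cutoff m u) \<eta> = W (card \<eta>) * u \<eta> + h * (z * birth \<alpha> \<gamma> (cutoff m u) \<eta>)" for \<eta>
    by (simp add: gen_def L1_def cutoff_def W_def algebra_simps)
  have "LC_nn C (\<lambda>\<eta>. u \<eta> + h * gen z \<alpha> \<gamma> (cutoff m u) \<eta>)
      \<le> (\<Sum>n. ennreal (\<bar>W n\<bar> * C ^ n) * abs_mass n u) + (\<Sum>n. ennreal (h * (real n * C ^ n)) * abs_mass n (cutoff m u))"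
    unfolding eq by (rule LC_nn_weight_birth_le[OF mcut mu C z h(1)])
  also have "(\<Sum>n. ennreal (h * (real n * C ^ n)) * abs_mass n (cutoff m u))
      = (\<Sum>n. ennreal (h * (real n * C ^ n) * of_bool (n \<le> m)) * abs_mass n u)"
    using C h by (intro arg_cong[where f = suminf] ext)
      (simp add: abs_mass_cutoff[OF mu] ennreal_mult mult.assoc)
  also have "(\<Sum>n. ennreal (\<bar>W n\<bar> * C ^ n) * abs_mass n u) + \<dots>
      = (\<Sum>n. ennreal (\<bar>W n\<bar> * C ^ n + h * (real n * C ^ n) * of_bool (n \<le> m)) * abs_mass n u)"
    using C h by (subst suminf_add) (auto simp: distrib_right[symmetric])
  also have "\<dots> = (\<Sum>n. ennreal (C ^ n) * abs_mass n u)"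
    using W by (intro arg_cong[where f = suminf] ext) (simp add: W_def algebra_simps)
  also have "\<dots> = ennreal (LC_norm C u)"
    using LC_nn_eq_suminf[OF mu] LC_D(2)[OF u] C by simp
  finally have *: "LC_nn C (\<lambda>\<eta>. u \<eta> + h * gen z \<alpha> \<gamma> (cutoff m u) \<eta>) \<le> ennreal (LC_norm C u)" .
  have m: "LP_measurable (\<lambda>\<eta>. u \<eta> + h * gen z \<alpha> \<gamma> (cutoff m u) \<eta>)"
    by (intro LP_measurable_add LP_measurable_cmult LP_measurable_gen mcut mu)
  show "(\<lambda>\<eta>. u \<eta> + h * gen z \<alpha> \<gamma> (cutoff m u) \<eta>) \<in> LC C" by (rule LC_I[OF m * LC_norm_nonneg])
  show "LC_norm C (\<lambda>\<eta>. u \<eta> + h * gen z \<alpha> \<gamma> (cutoff m u) \<eta>) \<le> LC_norm C u"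
    by (rule LC_norm_leI[OF m * LC_norm_nonneg])
qed

text \<open>Integrated without powers of \<open>C\<close>, the majorant has coefficients
  \<open>exp \<beta> * n\<close>, which \<open>(2 * C) ^ n\<close> dominates because
  \<open>C \<ge> 1\<close>. Off the exceptional set \<open>birth\<close> may be treated as
  additive.\<close>

lemma LP_AE_majorant_finite:
  assumes u: "u \<in> LC (2 * C)" and C: "1 \<le> C"
  shows "LP_AE (\<lambda>\<eta>. majorant (\<lambda>_ _. 1) u \<eta> < \<infinity>)"
proof (rule LP_AE_finite)
  show "conf_measurable (majorant (\<lambda>_ _. 1) u)"
    using phi_meas by (intro conf_measurable_birth_majorant conf_measurable_abs LC_D(1)[OF u]) auto
  have "LP_nn_integral (majorant (\<lambda>_ _. 1) u) \<le> (\<Sum>n. ennreal (exp \<beta> * real n) * abs_mass n u)"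
    using exp_converges[of \<beta>]
    by (intro LP_nn_integral_majorant_le[OF LC_D(1)[OF u], where s = "\<lambda>_. exp \<beta>"]) (auto simp: field_simps)
  also have "\<dots> \<le> ennreal (exp \<beta> * LC_norm (2 * C) u)"
  proof (rule suminf_abs_mass_le[OF u])
    fix n
    have "real n \<le> 2 ^ n" using two_mult_le_power2[of n] by simp
    also have "\<dots> \<le> (2 * C) ^ n" using C by (intro power_mono) auto
    finally show "exp \<beta> * real n \<le> exp \<beta> * (2 * C) ^ n" by simp
  qed (use C in auto)
  also have "\<dots> < \<infinity>" by simp
  finally show "LP_nn_integral (majorant (\<lambda>_ _. 1) u) < \<infinity>" .
qed

lemma majorant_cutoff_le: "majorant (\<lambda>_ _. 1) (cutoff m u) \<eta> \<le> majorant (\<lambda>_ _. 1) u \<eta>"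
  unfolding birth_majorant_def cutoff_def
  by (intro sum_mono mult_left_mono nn_integral_mono mult_right_mono) auto

text \<open>The removed part lives on layers \<open>n > m\<close>, where
  \<open>n * (m + 1) \<le> n * n \<le> 2 * 2 ^ n\<close>: a second factor \<open>n\<close> is
  affordable in \<open>LC (2 * C)\<close> and is traded for \<open>1 / (m + 1)\<close>.\<close>

lemma LC_norm_gen_diff_cutoff_le:
  assumes u: "u \<in> LC (2 * C)" and C: "1 \<le> C" and z: "0 \<le> z" "z * exp (C * \<beta>) \<le> C"
  shows "LC_norm C (\<lambda>\<eta>. gen z \<alpha> \<gamma> u \<eta> - gen z \<alpha> \<gamma> (cutoff m u) \<eta>) \<le> 4 / real (Suc m) * LC_norm (2 * C) u"
proof (rule LC_norm_leI)
  note mu = LC_D(1)[OF u] and mcut = LP_measurable_cutoff[OF LC_D(1)[OF u]]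
  have C0: "0 < C" using C by simp
  show "LP_measurable (\<lambda>\<eta>. gen z \<alpha> \<gamma> u \<eta> - gen z \<alpha> \<gamma> (cutoff m u) \<eta>)"
    by (intro LP_measurable_diff LP_measurable_gen mu mcut)
  have "LC_nn C (\<lambda>\<eta>. gen z \<alpha> \<gamma> u \<eta> - gen z \<alpha> \<gamma> (cutoff m u) \<eta>)
      \<le> LC_nn C (gen z \<alpha> \<gamma> (\<lambda>\<eta>. u \<eta> - cutoff m u \<eta>))"
  proof (rule LP_nn_integral_mono_AE, rule LP_AE_mp[OF LP_AE_majorant_finite[OF u C]])
    fix \<eta> :: "'a set" assume \<eta>: "finite \<eta>" and fin: "majorant (\<lambda>_ _. 1) u \<eta> < \<infinity>"
    have "birth \<alpha> \<gamma> (\<lambda>\<eta>. u \<eta> - cutoff m u \<eta>) \<eta> = birth \<alpha> \<gamma> u \<eta> - birth \<alpha> \<gamma> (cutoff m u) \<eta>"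
      using fin le_less_trans[OF majorant_cutoff_le fin] by (intro birth_diff mu mcut \<eta>)
    then have "gen z \<alpha> \<gamma> (\<lambda>\<eta>. u \<eta> - cutoff m u \<eta>) \<eta> = gen z \<alpha> \<gamma> u \<eta> - gen z \<alpha> \<gamma> (cutoff m u) \<eta>"
      by (simp add: gen_def L1_def right_diff_distrib)
    then show "ennreal (\<bar>gen z \<alpha> \<gamma> u \<eta> - gen z \<alpha> \<gamma> (cutoff m u) \<eta>\<bar> * C ^ card \<eta>)
        \<le> ennreal (\<bar>gen z \<alpha> \<gamma> (\<lambda>\<eta>. u \<eta> - cutoff m u \<eta>) \<eta>\<bar> * C ^ card \<eta>)"
      by simp
  qed
  also have "\<dots> \<le> (\<Sum>n. ennreal (2 * real n * C ^ n) * abs_mass n (\<lambda>\<eta>. u \<eta> - cutoff m u \<eta>))"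
    by (rule LC_nn_gen_le[OF LP_measurable_diff[OF mu mcut] C0 z])
  also have "\<dots> = (\<Sum>n. ennreal (2 * real n * C ^ n * of_bool (m < n)) * abs_mass n u)"
    using C0 by (intro arg_cong[where f = suminf] ext)
      (simp add: abs_mass_diff_cutoff[OF mu] ennreal_mult mult.assoc)
  also have "\<dots> \<le> ennreal (4 / real (Suc m) * LC_norm (2 * C) u)"
  proof (rule suminf_abs_mass_le[OF u])
    fix n
    show "2 * real n * C ^ n * of_bool (m < n) \<le> 4 / real (Suc m) * (2 * C) ^ n"
    proof (cases "m < n")
      case True
      have "real n * real (Suc m) \<le> real n * real n"
        using True by (intro mult_left_mono) auto
      also have "\<dots> \<le> 2 * 2 ^ n" by (rule square_le_power2)
      finally have "2 * real n \<le> 4 / real (Suc m) * 2 ^ n" by (simp add: field_simps)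
      from mult_right_mono[OF this, of "C ^ n"] show ?thesis
        using True C0 by (simp add: power_mult_distrib)
    qed (use C0 in simp)
  qed (use C0 in auto)
  finally show "LC_nn C (\<lambda>\<eta>. gen z \<alpha> \<gamma> u \<eta> - gen z \<alpha> \<gamma> (cutoff m u) \<eta>) \<le> ennreal (4 / real (Suc m) * LC_norm (2 * C) u)" .
qed (simp add: LC_norm_nonneg)

end

text \<open>Summing over \<open>q\<close> turns \<open>p + q / 2\<close> into
  \<open>p + C * \<beta> / 2\<close>. The bound on \<open>z\<close> for \<open>C\<close> controls
  the first term and the bound for \<open>2 * C\<close> the second, leaving
  \<open>(p + 1) * (p + 1 / 2) \<le> 2 ^ (p + 1)\<close>.\<close>

lemma LC_norm_gen_diff_kernel_le:
  fixes \<phi> :: "'a::euclidean_space \<Rightarrow> real"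
  assumes K: "birth_kernel \<phi> \<alpha> \<gamma> \<beta>" and K': "birth_kernel \<phi> \<alpha>' \<gamma>' \<beta>"
    and kernel: "\<And>x \<xi> \<zeta>. finite \<xi> \<Longrightarrow> finite \<zeta> \<Longrightarrow>
      \<bar>e_lam (\<lambda>y. \<alpha> (x - y)) \<xi> * e_lam (\<lambda>y. \<gamma> (x - y)) \<zeta> - e_lam (\<lambda>y. \<alpha>' (x - y)) \<xi> * e_lam (\<lambda>y. \<gamma>' (x - y)) \<zeta>\<bar>
      \<le> \<delta> * (real (card \<xi>) + real (card \<zeta>) / 2) * (\<Prod>y\<in>\<zeta>. \<phi> (x - y))"
    and \<delta>: "0 \<le> \<delta>"
    and u: "u \<in> LC (2 * C)" and C: "1 \<le> C"
    and z: "0 \<le> z" "z * exp (C * \<beta>) \<le> C" "z * exp (2 * C * \<beta>) \<le> 2 * C"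
  shows "LC_norm C (\<lambda>\<eta>. gen z \<alpha> \<gamma> u \<eta> - gen z \<alpha>' \<gamma>' u \<eta>) \<le> \<delta> * LC_norm (2 * C) u"
proof (rule LC_norm_leI)
  interpret birth_kernel \<phi> \<alpha> \<gamma> \<beta> by (fact K)
  interpret K': birth_kernel \<phi> \<alpha>' \<gamma>' \<beta> by (fact K')
  note mu = LC_D(1)[OF u]
  have C0: "0 < C" using C by simp
  show "LP_measurable (\<lambda>\<eta>. gen z \<alpha> \<gamma> u \<eta> - gen z \<alpha>' \<gamma>' u \<eta>)"
    by (intro LP_measurable_diff LP_measurable_gen K'.LP_measurable_gen mu)
  let ?w = "\<lambda>p q. z * (\<delta> * (real p + real q / 2))"
  let ?y = "C * \<beta>"
  have w: "0 \<le> ?w p q" for p q using z \<delta> by simp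
  have AE: "LP_AE (\<lambda>\<eta>. ennreal \<bar>gen z \<alpha> \<gamma> u \<eta> - gen z \<alpha>' \<gamma>' u \<eta>\<bar> \<le> majorant ?w u \<eta>)"
  proof (rule LP_AE_mp[OF LP_AE_majorant_finite[OF u C]])
    fix \<eta> :: "'a set" assume \<eta>: "finite \<eta>" and fin: "majorant (\<lambda>_ _. 1) u \<eta> < \<infinity>"
    let ?k = "\<lambda>\<xi> x. e_lam (\<lambda>y. \<alpha> (x - y)) \<xi> * e_lam (\<lambda>y. \<gamma> (x - y)) (\<eta> - \<xi>)"
    let ?k' = "\<lambda>\<xi> x. e_lam (\<lambda>y. \<alpha>' (x - y)) \<xi> * e_lam (\<lambda>y. \<gamma>' (x - y)) (\<eta> - \<xi>)"
    have "birth \<alpha> \<gamma> u \<eta> - birth \<alpha>' \<gamma>' u \<eta>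
        = (\<Sum>\<xi>\<in>Pow \<eta>. \<integral>x. ?k \<xi> x * u (insert x \<xi>) - ?k' \<xi> x * u (insert x \<xi>) \<partial>lborel)"
      unfolding birth_def sum_subtractf[symmetric]
      by (intro sum.cong refl Bochner_Integration.integral_diff[symmetric]
            kernel_integrable[OF mu \<eta> _ fin] K'.kernel_integrable[OF mu \<eta> _ fin]) auto
    then have "\<bar>gen z \<alpha> \<gamma> u \<eta> - gen z \<alpha>' \<gamma>' u \<eta>\<bar>
        = z * \<bar>\<Sum>\<xi>\<in>Pow \<eta>. \<integral>x. ?k \<xi> x * u (insert x \<xi>) - ?k' \<xi> x * u (insert x \<xi>) \<partial>lborel\<bar>"
      using z by (simp add: gen_def right_diff_distrib[symmetric] abs_mult)
    also have "\<dots> \<le> z * (\<Sum>\<xi>\<in>Pow \<eta>. \<bar>\<integral>x. ?k \<xi> x * u (insert x \<xi>) - ?k' \<xi> x * u (insert x \<xi>) \<partial>lborel\<bar>)"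
      using z by (intro mult_left_mono sum_abs)
    finally have "ennreal \<bar>gen z \<alpha> \<gamma> u \<eta> - gen z \<alpha>' \<gamma>' u \<eta>\<bar>
        \<le> ennreal (\<Sum>\<xi>\<in>Pow \<eta>. z * \<bar>\<integral>x. ?k \<xi> x * u (insert x \<xi>) - ?k' \<xi> x * u (insert x \<xi>) \<partial>lborel\<bar>)"
      unfolding sum_distrib_left by (rule ennreal_leI)
    also have "\<dots> = (\<Sum>\<xi>\<in>Pow \<eta>. ennreal z * ennreal \<bar>\<integral>x. ?k \<xi> x * u (insert x \<xi>) - ?k' \<xi> x * u (insert x \<xi>) \<partial>lborel\<bar>)"
      using z by (simp add: ennreal_mult[symmetric] sum_ennreal)
    also have "\<dots> \<le> majorant ?w u \<eta>"
      unfolding birth_majorant_def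
    proof (rule sum_mono)
      fix \<xi> assume "\<xi> \<in> Pow \<eta>"
      then have fin2: "finite \<xi>" "finite (\<eta> - \<xi>)" using \<eta> finite_subset by auto
      let ?c = "\<delta> * (real (card \<xi>) + real (card (\<eta> - \<xi>)) / 2)"
      let ?g = "\<lambda>x. ennreal \<bar>u (insert x \<xi>)\<bar> * (\<Prod>y\<in>\<eta> - \<xi>. ennreal (\<phi> (x - y)))"
      have c: "0 \<le> ?c" using \<delta> by simp
      have m: "?g \<in> borel_measurable lborel"
      proof -
        have "(\<lambda>x. x - y) \<in> measurable lborel borel" for y :: 'a by simp
        then show ?thesis
          using phi_meas
          by (intro borel_measurable_times_ennreal borel_measurable_prod_ennreal
              conf_measurable_insert_section[OF conf_measurable_abs[OF mu] fin2(1)])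
             (auto intro: measurable_compose)
      qed
      have "ennreal \<bar>\<integral>x. ?k \<xi> x * u (insert x \<xi>) - ?k' \<xi> x * u (insert x \<xi>) \<partial>lborel\<bar>
          \<le> (\<integral>\<^sup>+ x. ennreal \<bar>?k \<xi> x * u (insert x \<xi>) - ?k' \<xi> x * u (insert x \<xi>)\<bar> \<partial>lborel)"
        by (rule ennreal_abs_integral_le)
      also have "\<dots> \<le> (\<integral>\<^sup>+ x. ennreal ?c * ?g x \<partial>lborel)"
      proof (rule nn_integral_mono)
        fix x
        have "\<bar>?k \<xi> x * u (insert x \<xi>) - ?k' \<xi> x * u (insert x \<xi>)\<bar> = \<bar>?k \<xi> x - ?k' \<xi> x\<bar> * \<bar>u (insert x \<xi>)\<bar>"
          by (simp add: left_diff_distrib[symmetric] abs_mult)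
        also have "\<dots> \<le> (?c * (\<Prod>y\<in>\<eta> - \<xi>. \<phi> (x - y))) * \<bar>u (insert x \<xi>)\<bar>"
          by (intro mult_right_mono kernel fin2) auto
        finally have "ennreal \<bar>?k \<xi> x * u (insert x \<xi>) - ?k' \<xi> x * u (insert x \<xi>)\<bar>
            \<le> ennreal ((?c * (\<Prod>y\<in>\<eta> - \<xi>. \<phi> (x - y))) * \<bar>u (insert x \<xi>)\<bar>)"
          by (rule ennreal_leI)
        also have "\<dots> = ennreal ?c * ?g x"
        proof -
          have "0 \<le> (\<Prod>y\<in>\<eta> - \<xi>. \<phi> (x - y))" using phi_nonneg by (intro prod_nonneg) auto
          then have "ennreal ((?c * (\<Prod>y\<in>\<eta> - \<xi>. \<phi> (x - y))) * \<bar>u (insert x \<xi>)\<bar>)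
              = ennreal ?c * ennreal (\<Prod>y\<in>\<eta> - \<xi>. \<phi> (x - y)) * ennreal \<bar>u (insert x \<xi>)\<bar>"
            using c by (simp only: ennreal_mult mult_nonneg_nonneg abs_ge_zero)
          then show ?thesis
            using phi_nonneg by (simp add: prod_ennreal ac_simps)
        qed
        finally show "ennreal \<bar>?k \<xi> x * u (insert x \<xi>) - ?k' \<xi> x * u (insert x \<xi>)\<bar> \<le> ennreal ?c * ?g x" .
      qed
      also have "\<dots> = ennreal ?c * (\<integral>\<^sup>+ x. ?g x \<partial>lborel)"
        using m by (rule nn_integral_cmult)
      finally have "ennreal z * ennreal \<bar>\<integral>x. ?k \<xi> x * u (insert x \<xi>) - ?k' \<xi> x * u (insert x \<xi>) \<partial>lborel\<bar>
          \<le> ennreal z * (ennreal ?c * (\<integral>\<^sup>+ x. ?g x \<partial>lborel))"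
        by (rule mult_left_mono) simp
      also have "\<dots> = ennreal (z * ?c) * (\<integral>\<^sup>+ x. ?g x \<partial>lborel)"
        using z c by (simp only: ennreal_mult mult.assoc)
      finally show "ennreal z * ennreal \<bar>\<integral>x. ?k \<xi> x * u (insert x \<xi>) - ?k' \<xi> x * u (insert x \<xi>) \<partial>lborel\<bar>
          \<le> ennreal (z * ?c) * (\<integral>\<^sup>+ x. ?g x \<partial>lborel)" .
    qed
    finally show "ennreal \<bar>gen z \<alpha> \<gamma> u \<eta> - gen z \<alpha>' \<gamma>' u \<eta>\<bar> \<le> majorant ?w u \<eta>" .
  qed
  have s: "(\<lambda>q. C ^ (p + q) * ?w p q * (\<beta> ^ q / fact q)) sums (z * \<delta> * C ^ p * (exp ?y * (real p + ?y / 2)))" for p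
  proof -
    have "(\<lambda>q. real p * (?y ^ q / fact q) + (1 / 2) * (real q * (?y ^ q / fact q)))
        sums (real p * exp ?y + (1 / 2) * (?y * exp ?y))"
      using exp_converges[of ?y] by (intro sums_add sums_mult sums_nat_exp) (simp add: field_simps)
    from sums_mult[OF this, of "z * \<delta> * C ^ p"] show ?thesis
      by (simp add: power_add power_mult_distrib algebra_simps add_divide_distrib)
  qed
  have t: "z * \<delta> * C ^ p * (exp ?y * (real p + ?y / 2)) * real (Suc p) \<le> \<delta> * (2 * C) ^ Suc p" for p
  proof -
    \<comment> \<open>From \<open>exp 1 \<ge> 2\<close> and \<open>exp (?y - 1) \<ge> ?y\<close>.
      The factor \<open>?y\<close> is thus paid with a second \<open>exp ?y\<close>, which
      \<open>z * exp (2 * C * \<beta>) \<le> 2 * C\<close> absorbs; this is why no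
      \<open>\<beta>\<close> survives in the bound.\<close>
    have "2 * ?y \<le> exp 1 * exp (?y - 1)"
      using exp_ge_add_one_self[of 1] exp_ge_add_one_self[of "?y - 1"] C0 beta_nonneg
      by (intro mult_mono) auto
    then have "2 * ?y \<le> exp ?y" by (simp add: exp_add[symmetric])
    then have "(z * exp ?y) * (2 * ?y) \<le> (z * exp ?y) * exp ?y"
      using z by (intro mult_left_mono) auto
    also have "\<dots> = z * exp (2 * C * \<beta>)" by (simp add: exp_add[symmetric] mult.assoc)
    also have "\<dots> \<le> 2 * C" by (rule z)
    finally have "(z * exp ?y) * (?y / 2) \<le> C * (1 / 2)" by simp
    moreover have "(z * exp ?y) * real p \<le> C * real p"
      using z by (intro mult_right_mono) auto
    ultimately have "(z * exp ?y) * (real p + ?y / 2) \<le> C * (real p + 1 / 2)"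
      by (simp add: distrib_left)
    then have "\<delta> * C ^ p * real (Suc p) * ((z * exp ?y) * (real p + ?y / 2)) \<le> \<delta> * C ^ p * real (Suc p) * (C * (real p + 1 / 2))"
      using \<delta> C0 by (intro mult_left_mono) auto
    also have "\<dots> = \<delta> * C ^ Suc p * (real (Suc p) * (real p + 1 / 2))" by (simp add: ac_simps)
    also have "\<dots> \<le> \<delta> * C ^ Suc p * 2 ^ Suc p"
      using \<delta> C0 by (intro mult_left_mono quadratic_le_power2) auto
    finally show ?thesis by (simp add: power_mult_distrib ac_simps)
  qed
  have "LC_nn C (\<lambda>\<eta>. gen z \<alpha> \<gamma> u \<eta> - gen z \<alpha>' \<gamma>' u \<eta>) \<le> (\<Sum>n. ennreal (\<delta> * (2 * C) ^ n) * abs_mass n u)"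
    using C0 by (intro LC_nn_le_of_majorant[OF mu AE w _ s t]) auto
  also have "\<dots> \<le> ennreal (\<delta> * LC_norm (2 * C) u)"
    using C0 \<delta> by (intro suminf_abs_mass_le[OF u]) auto
  finally show "LC_nn C (\<lambda>\<eta>. gen z \<alpha> \<gamma> u \<eta> - gen z \<alpha>' \<gamma>' u \<eta>) \<le> ennreal (\<delta> * LC_norm (2 * C) u)" .
qed (simp add: \<delta> LC_norm_nonneg)

text \<open>Replacing the factors one at a time costs a relative error \<open>r\<close> each, and
  factors already replaced only shrink the product, so the relative errors add up.\<close>

lemma prod_diff_le:
  fixes c d :: "'b \<Rightarrow> real"
  assumes "finite A" "\<And>i. i \<in> A \<Longrightarrow> 0 \<le> c i" "\<And>i. i \<in> A \<Longrightarrow> c i \<le> d i"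
    "\<And>i. i \<in> A \<Longrightarrow> d i - c i \<le> r * d i"
  shows "prod d A - prod c A \<le> real (card A) * r * prod d A"
  using assms
proof (induction A rule: finite_induct)
  case (insert a A)
  have le: "prod c A \<le> prod d A" using insert by (intro prod_mono) auto
  have pc: "0 \<le> prod c A" using insert by (intro prod_nonneg) auto
  have da: "0 \<le> d a" using insert.prems(1)[of a] insert.prems(2)[of a] by simp
  have "d a * (prod d A - prod c A) \<le> d a * (real (card A) * r * prod d A)"
    using insert da by (intro mult_left_mono) auto
  moreover have "(d a - c a) * prod c A \<le> (r * d a) * prod d A"
  proof -
    have "(d a - c a) * prod c A \<le> (r * d a) * prod c A"
      using insert.prems(3)[of a] pc by (intro mult_right_mono) auto
    also have "\<dots> \<le> (r * d a) * prod d A"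
      using insert.prems(2,3)[of a] le by (intro mult_left_mono) auto
    finally show ?thesis .
  qed
  ultimately show ?case
    using insert.hyps by (simp add: algebra_simps)
qed simp

section \<open>Comparison of the semigroups\<close>

lemma LC_diff: "F \<in> LC C \<Longrightarrow> G \<in> LC C \<Longrightarrow> 0 \<le> C \<Longrightarrow> (\<lambda>\<eta>. F \<eta> - G \<eta>) \<in> LC C"
  using LC_linear(1)[of F C G 1 "-1"] by simp

lemma LC_norm_zero: "LC_norm C (\<lambda>_. 0) = 0"
  by (simp add: LC_norm_def LP_nn_integral_def)

lemma LC_zero: "(\<lambda>_. 0) \<in> LC C"
  by (rule LC_I[where K = 0]) (simp_all add: LP_measurable_def LP_nn_integral_def)

lemma LC_norm_add_le:
  "F \<in> LC C \<Longrightarrow> G \<in> LC C \<Longrightarrow> 0 \<le> C \<Longrightarrow> LC_norm C (\<lambda>\<eta>. F \<eta> + G \<eta>) \<le> LC_norm C F + LC_norm C G"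
  using LC_linear(2)[of F C G 1 1] by simp

lemma LC_norm_triangle:
  assumes "F \<in> LC C" "G \<in> LC C" "H \<in> LC C" "0 \<le> C"
  shows "LC_norm C (\<lambda>\<eta>. F \<eta> - H \<eta>) \<le> LC_norm C (\<lambda>\<eta>. F \<eta> - G \<eta>) + LC_norm C (\<lambda>\<eta>. G \<eta> - H \<eta>)"
  using LC_norm_add_le[OF LC_diff[OF assms(1,2,4)] LC_diff[OF assms(2,3,4)] assms(4)] by simp

lemma LC_norm_minus_commute: "LC_norm C (\<lambda>\<eta>. F \<eta> - G \<eta>) = LC_norm C (\<lambda>\<eta>. G \<eta> - F \<eta>)"
  by (simp add: LC_norm_def abs_minus_commute)

lemma LC_antimono:
  assumes "F \<in> LC D" "0 \<le> C" "C \<le> D"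
  shows "F \<in> LC C"
proof -
  have "LC_nn C F \<le> LC_nn D F"
    using assms by (intro LP_nn_integral_mono ennreal_leI mult_left_mono power_mono) auto
  also have "\<dots> = ennreal (LC_norm D F)" by (simp add: LC_D(2)[OF assms(1)])
  finally show ?thesis by (rule LC_I[OF LC_D(1)[OF assms(1)] _ LC_norm_nonneg])
qed

lemma
  assumes "contraction_C0_semigroup C T"
  shows semigroup_in_LC: "0 \<le> t \<Longrightarrow> f \<in> LC C \<Longrightarrow> T t f \<in> LC C"
    and semigroup_linear: "0 \<le> t \<Longrightarrow> f \<in> LC C \<Longrightarrow> g \<in> LC C \<Longrightarrow>
      LC_norm C (\<lambda>\<eta>. T t (\<lambda>\<zeta>. a * f \<zeta> + b * g \<zeta>) \<eta> - (a * T t f \<eta> + b * T t g \<eta>)) = 0"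
    and semigroup_zero: "f \<in> LC C \<Longrightarrow> LC_norm C (\<lambda>\<eta>. T 0 f \<eta> - f \<eta>) = 0"
    and semigroup_add: "0 \<le> s \<Longrightarrow> 0 \<le> t \<Longrightarrow> f \<in> LC C \<Longrightarrow> LC_norm C (\<lambda>\<eta>. T (s + t) f \<eta> - T s (T t f) \<eta>) = 0"
    and semigroup_contraction: "0 \<le> t \<Longrightarrow> f \<in> LC C \<Longrightarrow> LC_norm C (T t f) \<le> LC_norm C f"
  using assms unfolding contraction_C0_semigroup_def by blast+

text \<open>Linearity holds only up to seminorm zero, so contractivity on \<open>f - g\<close> has
  to be transferred by the triangle inequality.\<close>

lemma semigroup_contraction_diff:
  assumes T: "contraction_C0_semigroup C T" and C: "0 \<le> C" and t: "0 \<le> t" and f: "f \<in> LC C" and g: "g \<in> LC C"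
  shows "LC_norm C (\<lambda>\<eta>. T t f \<eta> - T t g \<eta>) \<le> LC_norm C (\<lambda>\<eta>. f \<eta> - g \<eta>)"
proof -
  let ?d = "\<lambda>\<eta>. f \<eta> - g \<eta>"
  have d: "?d \<in> LC C" using f g C by (rule LC_diff)
  note inLC = semigroup_in_LC[OF T t]
  have Td: "(\<lambda>\<eta>. T t f \<eta> - T t g \<eta>) \<in> LC C" using inLC f g C by (intro LC_diff) auto
  have z: "LC_norm C (\<lambda>\<eta>. T t ?d \<eta> - (T t f \<eta> - T t g \<eta>)) = 0"
    using semigroup_linear[OF T t f g, of 1 "-1"] by simp
  have "LC_norm C (\<lambda>\<eta>. (T t f \<eta> - T t g \<eta>) - 0)
      \<le> LC_norm C (\<lambda>\<eta>. (T t f \<eta> - T t g \<eta>) - T t ?d \<eta>) + LC_norm C (\<lambda>\<eta>. T t ?d \<eta> - 0)"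
    using LC_norm_triangle[OF Td inLC[OF d] LC_zero C] .
  also have "\<dots> = LC_norm C (T t ?d)"
    using z LC_norm_minus_commute[of C "\<lambda>\<eta>. T t f \<eta> - T t g \<eta>" "T t ?d"] by simp
  also have "\<dots> \<le> LC_norm C ?d" by (rule semigroup_contraction[OF T t d])
  finally show ?thesis by simp
qed

text \<open>Telescoping over a fine subdivision replaces the integral formula
  \<open>T h f - f = \<integral> T s g ds\<close>.\<close>

lemma semigroup_step_estimate:
  assumes T: "contraction_C0_semigroup C T" and C: "0 \<le> C" and fg: "generator_graph C T f g"
    and k: "k \<in> LC C" and h: "0 \<le> h" and \<rho>: "\<And>s. 0 \<le> s \<Longrightarrow> s \<le> h \<Longrightarrow> LC_norm C (\<lambda>\<eta>. T s k \<eta> - k \<eta>) \<le> \<rho>"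
  shows "LC_norm C (\<lambda>\<eta>. T h f \<eta> - (f \<eta> + h * k \<eta>)) \<le> h * (LC_norm C (\<lambda>\<eta>. g \<eta> - k \<eta>) + \<rho>)"
proof (cases "h = 0")
  case True
  then show ?thesis using semigroup_zero[OF T] fg by (simp add: generator_graph_def)
next
  case False
  then have h: "0 < h" using h by simp
  have f: "f \<in> LC C" and g: "g \<in> LC C"
    and lim: "((\<lambda>h. LC_norm C (\<lambda>\<eta>. (T h f \<eta> - f \<eta>) / h - g \<eta>)) \<longlongrightarrow> 0) (at_right 0)"
    using fg by (auto simp: generator_graph_def)
  note inLC = semigroup_in_LC[OF T]
  let ?\<delta> = "LC_norm C (\<lambda>\<eta>. g \<eta> - k \<eta>)"
  have lin: "(\<lambda>\<eta>. F \<eta> + a * H \<eta>) \<in> LC C" if "F \<in> LC C" "H \<in> LC C" for F H a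
    using LC_linear(1)[OF that C, of 1 a] by simp
  \<comment> \<open>The generator limit gives an error \<open>d * e'\<close> for a short step
    \<open>d\<close>; over \<open>n\<close> steps with \<open>n * d = h\<close> these add up to
    \<open>h * e' = e\<close>, and \<open>e\<close> is arbitrary.\<close>
  have "LC_norm C (\<lambda>\<eta>. T h f \<eta> - (f \<eta> + h * k \<eta>)) \<le> h * (?\<delta> + \<rho>) + e" if e: "0 < e" for e
  proof -
    define e' where "e' = e / h"
    have e': "0 < e'" using e h by (simp add: e'_def)
    obtain D where D: "0 < D" "\<And>d. 0 < d \<Longrightarrow> d < D \<Longrightarrow> LC_norm C (\<lambda>\<eta>. (T d f \<eta> - f \<eta>) / d - g \<eta>) < e'"
      using order_tendstoD(2)[OF lim e'] unfolding eventually_at_right_field by auto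
    obtain n where n: "h / D < real n" using reals_Archimedean2 by blast
    have n0: "0 < real n" using n D h by (smt (verit) divide_pos_pos)
    define d where "d = h / real n"
    have d: "0 < d" "d < D" using n n0 h D by (auto simp: d_def field_simps)
    have nd: "real n * d = h" using n0 by (simp add: d_def)
    have small: "LC_norm C (\<lambda>\<eta>. T d f \<eta> - (f \<eta> + d * k \<eta>)) \<le> d * (e' + ?\<delta>)"
    proof -
      have q: "(\<lambda>\<eta>. (T d f \<eta> - f \<eta>) / d - g \<eta>) \<in> LC C"
      proof -
        have "(\<lambda>\<eta>. (1 / d) * T d f \<eta> + (- 1 / d) * f \<eta>) \<in> LC C"
          using d f C by (intro LC_linear inLC) auto
        from LC_diff[OF this g C] show ?thesis by (simp add: diff_divide_distrib)
      qed
      have "T d f \<eta> - (f \<eta> + d * k \<eta>) = d * ((T d f \<eta> - f \<eta>) / d - g \<eta>) + d * (g \<eta> - k \<eta>)" for \<eta>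
        using d by (simp add: field_simps)
      then have "LC_norm C (\<lambda>\<eta>. T d f \<eta> - (f \<eta> + d * k \<eta>))
          \<le> d * LC_norm C (\<lambda>\<eta>. (T d f \<eta> - f \<eta>) / d - g \<eta>) + d * ?\<delta>"
        using LC_linear(2)[OF q LC_diff[OF g k C] C, of d d] d by simp
      also have "\<dots> \<le> d * e' + d * ?\<delta>"
        using D(2)[OF d] d by (intro add_right_mono mult_left_mono) auto
      finally show ?thesis by (simp add: distrib_left)
    qed
    \<comment> \<open>In the inductive step contractivity lets \<open>T d f\<close> be replaced by
      \<open>f + d * k\<close> under \<open>T ?s\<close>; linearity splits off
      \<open>d * T ?s k\<close>, and \<open>\<rho>\<close> pays for replacing this by
      \<open>d * k\<close>.\<close>
    have "LC_norm C (\<lambda>\<eta>. T (real j * d) f \<eta> - (f \<eta> + (real j * d) * k \<eta>)) \<le> real j * (d * (e' + ?\<delta> + \<rho>))"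
      if "j \<le> n" for j
      using that
    proof (induction j)
      case 0
      then show ?case using semigroup_zero[OF T f] by simp
    next
      case (Suc j)
      let ?s = "real j * d"
      have s: "0 \<le> ?s" using d by simp
      have "?s \<le> real n * d" using Suc.prems d by (intro mult_right_mono) auto
      then have sh: "?s \<le> h" using nd by simp
      have Suc_s: "real (Suc j) * d = ?s + d" by (simp add: distrib_right)
      have Tdf: "T d f \<in> LC C" using d f by (intro inLC) auto
      have fdk: "(\<lambda>\<eta>. f \<eta> + d * k \<eta>) \<in> LC C" by (rule lin[OF f k])
      have X1: "T (?s + d) f \<in> LC C" using s d f by (intro inLC) auto
      have X2: "T ?s (T d f) \<in> LC C" by (rule inLC[OF s Tdf])
      have X3: "T ?s (\<lambda>\<eta>. f \<eta> + d * k \<eta>) \<in> LC C" by (rule inLC[OF s fdk])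
      have X4: "(\<lambda>\<eta>. T ?s f \<eta> + d * T ?s k \<eta>) \<in> LC C" by (rule lin[OF inLC[OF s f] inLC[OF s k]])
      have X5: "(\<lambda>\<eta>. f \<eta> + (?s + d) * k \<eta>) \<in> LC C" by (rule lin[OF f k])
      have X5': "(\<lambda>\<eta>. f \<eta> + ?s * k \<eta>) \<in> LC C" by (rule lin[OF f k])
      have "LC_norm C (\<lambda>\<eta>. T (?s + d) f \<eta> - T ?s (T d f) \<eta>) = 0"
        using s d f by (intro semigroup_add[OF T]) auto
      moreover have "LC_norm C (\<lambda>\<eta>. T ?s (T d f) \<eta> - T ?s (\<lambda>\<eta>. f \<eta> + d * k \<eta>) \<eta>) \<le> d * (e' + ?\<delta>)"
        using semigroup_contraction_diff[OF T C s Tdf fdk] small by linarith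
      moreover have "LC_norm C (\<lambda>\<eta>. T ?s (\<lambda>\<eta>. f \<eta> + d * k \<eta>) \<eta> - (T ?s f \<eta> + d * T ?s k \<eta>)) = 0"
        using semigroup_linear[OF T s f k, of 1 d] by simp
      moreover have "LC_norm C (\<lambda>\<eta>. (T ?s f \<eta> + d * T ?s k \<eta>) - (f \<eta> + (?s + d) * k \<eta>))
          \<le> real j * (d * (e' + ?\<delta> + \<rho>)) + d * \<rho>"
      proof -
        have "(T ?s f \<eta> + d * T ?s k \<eta>) - (f \<eta> + (?s + d) * k \<eta>)
            = 1 * (T ?s f \<eta> - (f \<eta> + ?s * k \<eta>)) + d * (T ?s k \<eta> - k \<eta>)" for \<eta>
          by (simp add: algebra_simps)
        then have "LC_norm C (\<lambda>\<eta>. (T ?s f \<eta> + d * T ?s k \<eta>) - (f \<eta> + (?s + d) * k \<eta>))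
            \<le> LC_norm C (\<lambda>\<eta>. T ?s f \<eta> - (f \<eta> + ?s * k \<eta>)) + d * LC_norm C (\<lambda>\<eta>. T ?s k \<eta> - k \<eta>)"
          using LC_linear(2)[OF LC_diff[OF inLC[OF s f] X5' C] LC_diff[OF inLC[OF s k] k C] C, of 1 d] d
          by (simp only: abs_one mult_1 abs_of_pos)
        also have "\<dots> \<le> real j * (d * (e' + ?\<delta> + \<rho>)) + d * \<rho>"
          using Suc d \<rho>[OF s sh] by (intro add_mono mult_left_mono) auto
        finally show ?thesis .
      qed
      ultimately have "LC_norm C (\<lambda>\<eta>. T (?s + d) f \<eta> - (f \<eta> + (?s + d) * k \<eta>))
          \<le> d * (e' + ?\<delta>) + (real j * (d * (e' + ?\<delta> + \<rho>)) + d * \<rho>)"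
        using LC_norm_triangle[OF X1 X2 X5 C] LC_norm_triangle[OF X2 X3 X5 C] LC_norm_triangle[OF X3 X4 X5 C]
        by linarith
      then show ?case unfolding Suc_s by (simp add: algebra_simps)
    qed
    from this[of n] have "LC_norm C (\<lambda>\<eta>. T h f \<eta> - (f \<eta> + h * k \<eta>)) \<le> real n * (d * (e' + ?\<delta> + \<rho>))"
      unfolding nd by simp
    also have "\<dots> = h * (e' + ?\<delta> + \<rho>)" using nd by (simp add: mult.assoc[symmetric])
    also have "\<dots> = h * (?\<delta> + \<rho>) + e" using h by (simp add: e'_def field_simps)
    finally show ?thesis .
  qed
  then show ?thesis by (rule field_le_epsilon)
qed

text \<open>The step estimate with \<open>k = 0\<close>, for which \<open>\<rho> = 0\<close> is
  admissible.\<close>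

lemma semigroup_lipschitz:
  assumes T: "contraction_C0_semigroup C T" and C: "0 \<le> C" and fg: "generator_graph C T f g" and s: "0 \<le> s"
  shows "LC_norm C (\<lambda>\<eta>. T s f \<eta> - f \<eta>) \<le> s * LC_norm C g"
proof -
  have "LC_norm C (\<lambda>\<eta>. T r (\<lambda>_. 0) \<eta> - 0) \<le> 0" if "0 \<le> r" for r
    using semigroup_contraction[OF T that LC_zero] by (simp add: LC_norm_zero)
  from semigroup_step_estimate[OF T C fg LC_zero s this] show ?thesis by simp
qed

text \<open>If \<open>k\<close> lies in the domain of the generator as well, the Lipschitz bound
  supplies \<open>\<rho> = h * LC_norm C l\<close>; besides the mismatch of \<open>g\<close> and
  \<open>k\<close> the local error is then of second order in \<open>h\<close>.\<close>

lemma semigroup_euler_step: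
  assumes T: "contraction_C0_semigroup C T" and C: "0 \<le> C"
    and fg: "generator_graph C T f g" and kl: "generator_graph C T k l" and h: "0 \<le> h"
  shows "LC_norm C (\<lambda>\<eta>. T h f \<eta> - (f \<eta> + h * k \<eta>)) \<le> h * (LC_norm C (\<lambda>\<eta>. g \<eta> - k \<eta>) + h * LC_norm C l)"
proof (rule semigroup_step_estimate[OF T C fg _ h])
  show "k \<in> LC C" using kl by (simp add: generator_graph_def)
  show "LC_norm C (\<lambda>\<eta>. T s k \<eta> - k \<eta>) \<le> h * LC_norm C l" if "0 \<le> s" "s \<le> h" for s
    using semigroup_lipschitz[OF T C kl that(1)] mult_right_mono[OF that(2) LC_norm_nonneg, of C l] by linarith
qed

text \<open>A constant sequence shows that \<open>u\<close> lies in the domain of the closure; this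
  links \<open>T\<close> to the explicit operator.\<close>

lemma generates_generator_graph:
  assumes "generates C L D T" "u \<in> D" "u \<in> LC C" "L u \<in> LC C"
  shows "generator_graph C T u (L u)"
proof -
  have "closure_graph C L D u (L u)"
    unfolding closure_graph_def using assms by (auto intro!: exI[of _ "\<lambda>_. u"] simp: LC_norm_zero)
  then show ?thesis using assms(1) by (simp add: generates_def)
qed

text \<open>The explicit Euler scheme for the truncated operator \<open>gen \<circ> cutoff m\<close> stays bounded in
  \<open>LC (2 * C)\<close>, which makes its consistency error with respect to a second semigroup uniform along
  the scheme.\<close>

lemma euler_scheme_error:
  fixes \<phi> :: "'a::euclidean_space \<Rightarrow> real"
  assumes K: "birth_kernel \<phi> \<alpha> \<gamma> \<beta>" and K': "birth_kernel \<phi> \<alpha>' \<gamma>' \<beta>"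
    and C: "1 \<le> C" and z: "0 \<le> z" "z * exp (C * \<beta>) \<le> C" "z * exp (2 * C * \<beta>) \<le> 2 * C"
    and T: "generates C (gen z \<alpha>' \<gamma>') (LC (2 * C)) T"
    and diff: "\<And>u. u \<in> LC (2 * C) \<Longrightarrow>
      LC_norm C (\<lambda>\<eta>. gen z \<alpha>' \<gamma>' u \<eta> - gen z \<alpha> \<gamma> u \<eta>) \<le> \<delta> * LC_norm (2 * C) u"
    and \<delta>: "0 \<le> \<delta>"
    and G: "G \<in> LC (2 * C)" and h: "0 \<le> h" "h * real m \<le> 1"
  defines "U \<equiv> \<lambda>j. ((\<lambda>u \<eta>. u \<eta> + h * gen z \<alpha> \<gamma> (cutoff m u) \<eta>) ^^ j) G"
  shows "U j \<in> LC (2 * C)" and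
    "LC_norm C (\<lambda>\<eta>. T (real j * h) G \<eta> - U j \<eta>)
      \<le> real j * (h * (\<delta> + 4 / real (Suc m) + h * (2 * real m)) * LC_norm (2 * C) G)"
proof -
  interpret birth_kernel \<phi> \<alpha> \<gamma> \<beta> by (fact K)
  interpret K': birth_kernel \<phi> \<alpha>' \<gamma>' \<beta> by (fact K')
  have C0: "0 \<le> C" "0 < C" "0 < 2 * C" "C \<le> 2 * C" using C by auto
  have sg: "contraction_C0_semigroup C T" using T by (simp add: generates_def)
  note inLC = semigroup_in_LC[OF sg]
  have sub: "u \<in> LC C" if "u \<in> LC (2 * C)" for u :: "'a set \<Rightarrow> real"
    using that C0 by (intro LC_antimono[OF that]) auto
  let ?Q = "LC_norm (2 * C) G"
  let ?\<kappa> = "\<delta> + 4 / real (Suc m) + h * (2 * real m)"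
  have \<kappa>: "0 \<le> ?\<kappa>" using \<delta> h by simp
  have U_Suc: "U (Suc j) = (\<lambda>\<eta>. U j \<eta> + h * gen z \<alpha> \<gamma> (cutoff m (U j)) \<eta>)" for j
    by (simp add: U_def)
  \<comment> \<open>Stability: by the bound on \<open>z\<close> for \<open>2 * C\<close> each Euler
    step is a contraction of \<open>LC (2 * C)\<close>.\<close>
  have U: "U j \<in> LC (2 * C) \<and> LC_norm (2 * C) (U j) \<le> ?Q" for j
  proof (induction j)
    case 0
    then show ?case using G by (simp add: U_def)
  next
    case (Suc j)
    then show ?case
      unfolding U_Suc
      using euler_step_in_LC[OF _ C0(3) z(1,3) h, of "U j"] LC_norm_euler_step_le[OF _ C0(3) z(1,3) h, of "U j"]
      by auto
  qed
  then show "U j \<in> LC (2 * C)" by simp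
  \<comment> \<open>The local error has three sources: the other kernel (\<open>\<delta>\<close>),
    the cutoff (\<open>4 / (m + 1)\<close>) and the time step. The last involves the generator of
    \<open>T\<close> applied to \<open>?k\<close>, bounded through the \<open>LC (2 * C)\<close>
    norm of \<open>?k\<close>, hence the factor \<open>2 * m\<close>.\<close>
  have step: "LC_norm C (\<lambda>\<eta>. T h u \<eta> - (u \<eta> + h * gen z \<alpha> \<gamma> (cutoff m u) \<eta>)) \<le> h * ?\<kappa> * LC_norm (2 * C) u"
    if u: "u \<in> LC (2 * C)" for u
  proof -
    let ?k = "gen z \<alpha> \<gamma> (cutoff m u)"
    have k: "?k \<in> LC (2 * C)" "LC_norm (2 * C) ?k \<le> 2 * real m * LC_norm (2 * C) u"
      using gen_cutoff_in_LC[OF u C0(3) z(1,3)] LC_norm_gen_cutoff_le[OF u C0(3) z(1,3)] by auto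
    have gu: "gen z \<alpha>' \<gamma>' u \<in> LC C" "gen z \<alpha> \<gamma> u \<in> LC C"
      using K'.gen_in_LC[OF u C0(2) z(1,2)] gen_in_LC[OF u C0(2) z(1,2)] by auto
    have gk: "gen z \<alpha>' \<gamma>' ?k \<in> LC C" "LC_norm C (gen z \<alpha>' \<gamma>' ?k) \<le> LC_norm (2 * C) ?k"
      using K'.gen_in_LC[OF k(1) C0(2) z(1,2)] K'.LC_norm_gen_le[OF k(1) C0(2) z(1,2)] by auto
    have "LC_norm C (\<lambda>\<eta>. gen z \<alpha>' \<gamma>' u \<eta> - ?k \<eta>)
        \<le> \<delta> * LC_norm (2 * C) u + 4 / real (Suc m) * LC_norm (2 * C) u"
      using LC_norm_triangle[OF gu sub[OF k(1)] C0(1)] diff[OF u] LC_norm_gen_diff_cutoff_le[OF u C z(1,2), of m]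
      by linarith
    moreover have "h * LC_norm C (gen z \<alpha>' \<gamma>' ?k) \<le> h * (2 * real m * LC_norm (2 * C) u)"
      using gk(2) k(2) h(1) by (intro mult_left_mono) auto
    ultimately have "LC_norm C (\<lambda>\<eta>. gen z \<alpha>' \<gamma>' u \<eta> - ?k \<eta>) + h * LC_norm C (gen z \<alpha>' \<gamma>' ?k)
        \<le> ?\<kappa> * LC_norm (2 * C) u"
      by (simp add: distrib_right)
    from mult_left_mono[OF this h(1)]
    show ?thesis
      using semigroup_euler_step[OF sg C0(1) generates_generator_graph[OF T u sub[OF u] gu(1)]
          generates_generator_graph[OF T k(1) sub[OF k(1)] gk(1)] h(1)]
      by (simp add: mult.assoc)
  qed
  \<comment> \<open>Contractivity of \<open>T h\<close> passes the accumulated error on without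
    growth, so the local errors simply add.\<close>
  show "LC_norm C (\<lambda>\<eta>. T (real j * h) G \<eta> - U j \<eta>) \<le> real j * (h * ?\<kappa> * ?Q)"
  proof (induction j)
    case 0
    then show ?case using semigroup_zero[OF sg sub[OF G]] by (simp add: U_def)
  next
    case (Suc j)
    let ?s = "real j * h"
    have s: "0 \<le> ?s" using h by simp
    have Suc_s: "real (Suc j) * h = h + ?s" by (simp add: distrib_right)
    have X0: "T ?s G \<in> LC C" by (rule inLC[OF s sub[OF G]])
    have X1: "T (h + ?s) G \<in> LC C" using s h sub[OF G] by (intro inLC) auto
    have X2: "T h (T ?s G) \<in> LC C" by (rule inLC[OF h(1) X0])
    have Uj: "U j \<in> LC C" using U sub by blast
    have X3: "T h (U j) \<in> LC C" by (rule inLC[OF h(1) Uj])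
    have X4: "U (Suc j) \<in> LC C" using U sub by blast
    have "LC_norm C (\<lambda>\<eta>. T (h + ?s) G \<eta> - T h (T ?s G) \<eta>) = 0"
      by (rule semigroup_add[OF sg h(1) s sub[OF G]])
    moreover have "LC_norm C (\<lambda>\<eta>. T h (T ?s G) \<eta> - T h (U j) \<eta>) \<le> real j * (h * ?\<kappa> * ?Q)"
      using semigroup_contraction_diff[OF sg C0(1) h(1) X0 Uj] Suc by linarith
    moreover have "LC_norm C (\<lambda>\<eta>. T h (U j) \<eta> - U (Suc j) \<eta>) \<le> h * ?\<kappa> * ?Q"
    proof -
      have "LC_norm C (\<lambda>\<eta>. T h (U j) \<eta> - U (Suc j) \<eta>) \<le> h * ?\<kappa> * LC_norm (2 * C) (U j)"
        unfolding U_Suc using step U by blast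
      also have "\<dots> \<le> h * ?\<kappa> * ?Q"
        using U h(1) \<kappa> by (intro mult_left_mono) auto
      finally show ?thesis .
    qed
    ultimately have "LC_norm C (\<lambda>\<eta>. T (h + ?s) G \<eta> - U (Suc j) \<eta>) \<le> real j * (h * ?\<kappa> * ?Q) + h * ?\<kappa> * ?Q"
      using LC_norm_triangle[OF X1 X2 X4 C0(1)] LC_norm_triangle[OF X2 X3 X4 C0(1)] by linarith
    then show ?case unfolding Suc_s by (simp add: distrib_right)
  qed
qed

text \<open>Both semigroups are compared with one scheme, built from \<open>\<alpha>\<close> and
  \<open>\<gamma>\<close>: the kernel error is \<open>\<delta>\<close> for \<open>T'\<close> and
  \<open>0\<close> for \<open>T\<close>. The remaining errors vanish as \<open>m\<close>
  grows.\<close>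

lemma semigroup_difference_le:
  fixes \<phi> :: "'a::euclidean_space \<Rightarrow> real"
  assumes K: "birth_kernel \<phi> \<alpha> \<gamma> \<beta>" and K': "birth_kernel \<phi> \<alpha>' \<gamma>' \<beta>"
    and C: "1 \<le> C" and z: "0 \<le> z" "z * exp (C * \<beta>) \<le> C" "z * exp (2 * C * \<beta>) \<le> 2 * C"
    and T: "generates C (gen z \<alpha> \<gamma>) (LC (2 * C)) T"
    and T': "generates C (gen z \<alpha>' \<gamma>') (LC (2 * C)) T'"
    and diff: "\<And>u. u \<in> LC (2 * C) \<Longrightarrow>
      LC_norm C (\<lambda>\<eta>. gen z \<alpha>' \<gamma>' u \<eta> - gen z \<alpha> \<gamma> u \<eta>) \<le> \<delta> * LC_norm (2 * C) u"
    and \<delta>: "0 \<le> \<delta>" and G: "G \<in> LC (2 * C)" and t: "0 \<le> t"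
  shows "LC_norm C (\<lambda>\<eta>. T' t G \<eta> - T t G \<eta>) \<le> t * \<delta> * LC_norm (2 * C) G"
proof -
  let ?Q = "LC_norm (2 * C) G"
  have C0: "0 \<le> C" using C by simp
  have GC: "G \<in> LC C" using C0 by (intro LC_antimono[OF G]) auto
  have inLC: "T t G \<in> LC C" "T' t G \<in> LC C"
    using T T' t GC semigroup_in_LC by (auto simp: generates_def)
  have bound: "LC_norm C (\<lambda>\<eta>. T' t G \<eta> - T t G \<eta>) \<le> t * \<delta> * ?Q + t * (8 + 4 * t) * ?Q / real (Suc m)"
    if m: "t \<le> real (Suc m)" for m
  proof -
    define M where "M = real (Suc m)"
    \<comment> \<open>With \<open>M * M\<close> steps the time step error \<open>2 * h * m\<close>
      is \<open>O(1 / M)\<close>, like the cutoff error \<open>4 / M\<close>; and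
      \<open>t \<le> M\<close> ensures \<open>h * m \<le> 1\<close>.\<close>
    define h where "h = t / (M * M)"
    define j where "j = Suc m * Suc m"
    have M: "0 < M" "t \<le> M" "real m \<le> M" using m by (auto simp: M_def)
    have h: "0 \<le> h" using t M by (simp add: h_def)
    have "h * real m \<le> (M / (M * M)) * M"
      unfolding h_def using t M by (intro mult_mono divide_right_mono) auto
    then have hm: "h * real m \<le> 1" using M by simp
    have "real j = M * M" unfolding j_def M_def by (rule of_nat_mult)
    then have jh: "real j * h = t" using M by (simp add: h_def)
    have hM: "h * (2 * real m) \<le> 2 * t / M"
    proof -
      have "h * (2 * real m) \<le> h * (2 * M)" using h M by (intro mult_left_mono) auto
      also have "\<dots> = 2 * t / M" using M by (simp add: h_def)
      finally show ?thesis .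
    qed
    let ?U = "((\<lambda>u \<eta>. u \<eta> + h * gen z \<alpha> \<gamma> (cutoff m u) \<eta>) ^^ j) G"
    have U: "?U \<in> LC C"
      using C0 by (intro LC_antimono[OF euler_scheme_error(1)[OF K K' C z T' diff \<delta> G h hm]]) auto
    have "LC_norm C (\<lambda>\<eta>. T' t G \<eta> - ?U \<eta>) \<le> real j * (h * (\<delta> + 4 / M + h * (2 * real m)) * ?Q)"
      using euler_scheme_error(2)[OF K K' C z T' diff \<delta> G h hm, of j] by (simp only: jh M_def)
    moreover have "LC_norm C (\<lambda>\<eta>. T t G \<eta> - ?U \<eta>) \<le> real j * (h * (0 + 4 / M + h * (2 * real m)) * ?Q)"
      using euler_scheme_error(2)[OF K K C z T, of 0 G h m j] G h hm by (simp only: jh M_def) (simp add: LC_norm_zero)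
    ultimately have "LC_norm C (\<lambda>\<eta>. T' t G \<eta> - T t G \<eta>) \<le> real j * (h * (\<delta> + 4 / M + h * (2 * real m)) * ?Q)
        + real j * (h * (0 + 4 / M + h * (2 * real m)) * ?Q)"
      using LC_norm_triangle[OF inLC(2) U inLC(1) C0] LC_norm_minus_commute[of C ?U "T t G"] by linarith
    also have "\<dots> = (real j * h) * (\<delta> + 2 * (4 / M + h * (2 * real m))) * ?Q"
      by (simp add: algebra_simps)
    also have "\<dots> \<le> t * (\<delta> + 2 * (4 / M + 2 * t / M)) * ?Q"
      unfolding jh using hM t by (intro mult_right_mono mult_left_mono add_left_mono LC_norm_nonneg) auto
    also have "\<dots> = t * \<delta> * ?Q + t * (8 + 4 * t) * ?Q / M"
      using M by (simp add: field_simps)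
    finally show ?thesis by (simp only: M_def)
  qed
  have "(\<lambda>m. t * \<delta> * ?Q + t * (8 + 4 * t) * ?Q * inverse (real (Suc m))) \<longlonglongrightarrow> t * \<delta> * ?Q + t * (8 + 4 * t) * ?Q * 0"
    by (intro tendsto_intros LIMSEQ_inverse_real_of_nat)
  moreover have "\<exists>N. \<forall>m\<ge>N. LC_norm C (\<lambda>\<eta>. T' t G \<eta> - T t G \<eta>) \<le> t * \<delta> * ?Q + t * (8 + 4 * t) * ?Q * inverse (real (Suc m))"
  proof -
    obtain N :: nat where "t \<le> real N" using real_arch_simple by blast
    then show ?thesis
      using bound by (intro exI[of _ N]) (auto simp: divide_inverse simp del: of_nat_Suc)
  qed
  ultimately show ?thesis by (auto dest: LIMSEQ_le_const)
qed

text \<open>Each factor over \<open>\<xi>\<close> is within \<open>\<epsilon> * b\<close> of 1, a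
  first-order error. Over \<open>\<zeta>\<close>, up to a common sign,
  \<open>(1 - exp (- \<epsilon> * \<phi>)) / \<epsilon>\<close> falls short of \<open>\<phi>\<close>
  by a relative error of at most \<open>\<epsilon> * b / 2\<close>, the quadratic Taylor term; hence
  the weights 1 and 1/2 of the two cardinalities.\<close>

lemma exp_kernel_diff_le:
  fixes \<phi> :: "'a::euclidean_space \<Rightarrow> real"
  assumes nn: "\<And>v. 0 \<le> \<phi> v" and bd: "\<And>v. \<phi> v \<le> b" and \<epsilon>: "0 < \<epsilon>" and fin: "finite \<xi>" "finite \<zeta>"
  shows "\<bar>e_lam (\<lambda>y. exp (- \<epsilon> * \<phi> (x - y))) \<xi> * e_lam (\<lambda>y. (exp (- \<epsilon> * \<phi> (x - y)) - 1) / \<epsilon>) \<zeta>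
      - e_lam (\<lambda>y. 1) \<xi> * e_lam (\<lambda>y. - \<phi> (x - y)) \<zeta>\<bar>
    \<le> \<epsilon> * b * (real (card \<xi>) + real (card \<zeta>) / 2) * (\<Prod>y\<in>\<zeta>. \<phi> (x - y))"
proof -
  let ?a = "\<lambda>y. exp (- \<epsilon> * \<phi> (x - y))"
  let ?c = "\<lambda>y. (1 - exp (- \<epsilon> * \<phi> (x - y))) / \<epsilon>"
  let ?d = "\<lambda>y. \<phi> (x - y)"
  have s: "0 \<le> \<epsilon> * ?d y" for y using nn \<epsilon> by simp
  have "1 - ?a y \<le> \<epsilon> * b * 1" for y
  proof -
    have "\<epsilon> * ?d y \<le> \<epsilon> * b" using bd \<epsilon> by (intro mult_left_mono) auto
    then show ?thesis using exp_ge_add_one_self[of "- \<epsilon> * ?d y"] by simp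
  qed
  then have A: "1 - prod ?a \<xi> \<le> real (card \<xi>) * (\<epsilon> * b)"
    using prod_diff_le[OF fin(1), of ?a "\<lambda>_. 1" "\<epsilon> * b"] s by simp
  have A1: "0 \<le> prod ?a \<xi>" "prod ?a \<xi> \<le> 1" using s by (auto intro!: prod_nonneg prod_le_1)
  have c0: "0 \<le> ?c y" for y using s[of y] \<epsilon> by simp
  have c1: "?c y \<le> ?d y" for y
    using exp_ge_add_one_self[of "- \<epsilon> * ?d y"] \<epsilon> by (simp add: field_simps)
  have c2: "?d y - ?c y \<le> \<epsilon> * b / 2 * ?d y" for y
  proof -
    have "\<epsilon> * (?d y - ?c y) = exp (- (\<epsilon> * ?d y)) - (1 - \<epsilon> * ?d y)"
      using \<epsilon> by (simp add: field_simps)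
    also have "\<dots> \<le> (\<epsilon> * ?d y)\<^sup>2 / 2"
      using exp_neg_le_quadratic[OF s[of y]] by linarith
    also have "\<dots> = \<epsilon> * (\<epsilon> / 2 * ?d y * ?d y)" by (simp add: power2_eq_square)
    finally have "?d y - ?c y \<le> \<epsilon> / 2 * ?d y * ?d y" using \<epsilon> by simp
    also have "\<dots> \<le> \<epsilon> / 2 * b * ?d y"
      using bd nn \<epsilon> by (intro mult_right_mono mult_left_mono) auto
    finally show ?thesis by simp
  qed
  have B: "prod ?d \<zeta> - prod ?c \<zeta> \<le> real (card \<zeta>) * (\<epsilon> * b / 2) * prod ?d \<zeta>"
    using c0 c1 c2 by (intro prod_diff_le[OF fin(2)]) auto
  have cd: "prod ?c \<zeta> \<le> prod ?d \<zeta>" using c0 c1 by (intro prod_mono) auto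
  have c: "0 \<le> prod ?c \<zeta>" using c0 by (intro prod_nonneg) auto
  have d: "0 \<le> prod ?d \<zeta>" using nn by (intro prod_nonneg) auto
  have sgn_c: "(\<Prod>y\<in>\<zeta>. (?a y - 1) / \<epsilon>) = (- 1) ^ card \<zeta> * prod ?c \<zeta>"
  proof -
    have "(?a y - 1) / \<epsilon> = - ?c y" for y using \<epsilon> by (simp add: field_simps)
    then show ?thesis by (simp only: prod_uminus)
  qed
  have sgn_d: "(\<Prod>y\<in>\<zeta>. - ?d y) = (- 1) ^ card \<zeta> * prod ?d \<zeta>" by (rule prod_uminus)
  have "\<bar>prod ?a \<xi> * ((- 1) ^ card \<zeta> * prod ?c \<zeta>) - 1 * ((- 1) ^ card \<zeta> * prod ?d \<zeta>)\<bar>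
      = \<bar>(- 1) ^ card \<zeta> * (prod ?a \<xi> * prod ?c \<zeta> - prod ?d \<zeta>)\<bar>"
    by (simp add: algebra_simps)
  also have "\<dots> = \<bar>prod ?a \<xi> * prod ?c \<zeta> - prod ?d \<zeta>\<bar>" by (simp add: abs_mult)
  \<comment> \<open>The product of the \<open>?a\<close> is at most 1 and that of the
    \<open>?c\<close> at most that of the \<open>?d\<close>, so the sign is known.\<close>
  also have "\<dots> = prod ?d \<zeta> - prod ?a \<xi> * prod ?c \<zeta>"
    using mult_mono[OF A1(2) cd] A1 c d by (simp add: abs_if)
  also have "\<dots> = (1 - prod ?a \<xi>) * prod ?d \<zeta> + prod ?a \<xi> * (prod ?d \<zeta> - prod ?c \<zeta>)"
    by (simp add: algebra_simps)
  also have "\<dots> \<le> (real (card \<xi>) * (\<epsilon> * b)) * prod ?d \<zeta> + 1 * (real (card \<zeta>) * (\<epsilon> * b / 2) * prod ?d \<zeta>)"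
    using A A1 B cd d by (intro add_mono mult_right_mono mult_mono) auto
  also have "\<dots> = \<epsilon> * b * (real (card \<xi>) + real (card \<zeta>) / 2) * prod ?d \<zeta>"
    by (simp add: algebra_simps)
  finally show ?thesis
    unfolding e_lam_def sgn_c sgn_d by simp
qed

text \<open>For \<open>n \<le> m\<close> the factor \<open>2 ^ n\<close> is at most
  \<open>2 ^ m\<close>, and the part cut off is the tail of a convergent series:
  \<open>LC (2 * C)\<close> is dense in \<open>LC C\<close>.\<close>

lemma
  assumes G: "G \<in> LC C" and C: "0 \<le> C"
  shows cutoff_in_LC: "cutoff m G \<in> LC (2 * C)"
    and LC_norm_diff_cutoff_tendsto: "(\<lambda>m. LC_norm C (\<lambda>\<eta>. G \<eta> - cutoff m G \<eta>)) \<longlonglongrightarrow> 0"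
proof -
  note mG = LC_D(1)[OF G]
  have "LC_nn (2 * C) (cutoff m G) = (\<Sum>n. ennreal ((2 * C) ^ n * of_bool (n \<le> m)) * abs_mass n G)"
    using LC_nn_eq_suminf[OF LP_measurable_cutoff[OF mG], of "2 * C"] C
    by (simp add: abs_mass_cutoff[OF mG] ennreal_mult mult.assoc)
  also have "\<dots> \<le> ennreal (2 ^ m * LC_norm C G)"
    using C by (intro suminf_abs_mass_le[OF G])
      (auto simp: power_mult_distrib intro!: mult_right_mono power_increasing)
  finally show "cutoff m G \<in> LC (2 * C)"
    by (rule LC_I[OF LP_measurable_cutoff[OF mG]]) (simp add: LC_norm_nonneg)
next
  note mG = LC_D(1)[OF G]
  let ?f = "\<lambda>n. ennreal (C ^ n) * abs_mass n G"
  let ?S = "\<lambda>m. \<Sum>n<Suc m. ?f n"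
  have total: "(\<Sum>n. ?f n) = ennreal (LC_norm C G)"
    using LC_nn_eq_suminf[OF mG C] LC_D(2)[OF G] by simp
  \<comment> \<open>Head and tail are added in \<open>ennreal\<close>; subtraction happens only
    among reals, once finiteness is known.\<close>
  have split: "LC_norm C (\<lambda>\<eta>. G \<eta> - cutoff m G \<eta>) = LC_norm C G - enn2real (?S m)" for m
  proof -
    have tail: "LC_nn C (\<lambda>\<eta>. G \<eta> - cutoff m G \<eta>) = (\<Sum>n. ennreal (of_bool (m < n)) * ?f n)"
      using LC_nn_eq_suminf[OF LP_measurable_diff[OF mG LP_measurable_cutoff[OF mG]] C]
      by (simp add: abs_mass_diff_cutoff[OF mG] mult.left_commute)
    have head: "?S m = (\<Sum>n. ennreal (of_bool (n \<le> m)) * ?f n)"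
    proof -
      have "(\<Sum>n. ennreal (of_bool (n \<le> m)) * ?f n) = (\<Sum>n<Suc m. ennreal (of_bool (n \<le> m)) * ?f n)"
        by (rule suminf_finite) auto
      then show ?thesis by simp
    qed
    have "LC_nn C (\<lambda>\<eta>. G \<eta> - cutoff m G \<eta>) + ?S m
        = (\<Sum>n. ennreal (of_bool (m < n)) * ?f n + ennreal (of_bool (n \<le> m)) * ?f n)"
      unfolding tail head by (rule suminf_add) auto
    also have "\<dots> = (\<Sum>n. ?f n)"
      by (intro arg_cong[where f = suminf] ext) auto
    finally have eq: "LC_nn C (\<lambda>\<eta>. G \<eta> - cutoff m G \<eta>) + ?S m = ennreal (LC_norm C G)"
      using total by simp
    have "LC_nn C (\<lambda>\<eta>. G \<eta> - cutoff m G \<eta>) + ?S m < top"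
      unfolding eq by simp
    then have "enn2real (LC_nn C (\<lambda>\<eta>. G \<eta> - cutoff m G \<eta>) + ?S m)
        = LC_norm C (\<lambda>\<eta>. G \<eta> - cutoff m G \<eta>) + enn2real (?S m)"
      unfolding LC_norm_def ennreal_add_less_top by (intro enn2real_plus) auto
    then show ?thesis unfolding eq by (simp add: LC_norm_nonneg)
  qed
  have "(\<lambda>m. \<Sum>n<m. ?f n) \<longlonglongrightarrow> ennreal (LC_norm C G)"
    unfolding total[symmetric] by (rule summable_LIMSEQ) auto
  then have "?S \<longlonglongrightarrow> ennreal (LC_norm C G)"
    by (rule LIMSEQ_Suc)
  then have "(\<lambda>m. enn2real (?S m)) \<longlonglongrightarrow> LC_norm C G"
    by (rule tendsto_enn2real) (rule LC_norm_nonneg)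
  then have "(\<lambda>m. LC_norm C G - enn2real (?S m)) \<longlonglongrightarrow> LC_norm C G - LC_norm C G"
    by (intro tendsto_diff tendsto_const)
  then show "(\<lambda>m. LC_norm C (\<lambda>\<eta>. G \<eta> - cutoff m G \<eta>)) \<longlonglongrightarrow> 0"
    unfolding split by simp
qed

theorem mainTheorem7:
  fixes \<phi> :: "'a::euclidean_space \<Rightarrow> real"
    and C z \<beta> \<phi>bar :: real
    and T_ren :: "real \<Rightarrow> real \<Rightarrow> ('a set \<Rightarrow> real) \<Rightarrow> ('a set \<Rightarrow> real)"
    and T_V :: "real \<Rightarrow> ('a set \<Rightarrow> real) \<Rightarrow> ('a set \<Rightarrow> real)"
  assumes phi_nonneg: "\<And>x. \<phi> x \<ge> 0"
    and phi_even: "\<And>x. \<phi> (- x) = \<phi> x"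
    and phi_meas: "\<phi> \<in> borel_measurable lborel"
    and phi_int: "integrable lborel \<phi>"
    and beta_def: "\<beta> = integral\<^sup>L lborel \<phi>"
    and phi_bdd: "bdd_above (range \<phi>)"
    and phibar_def: "\<phi>bar = (SUP x. \<phi> x)"
    and C_gt: "C > 1"
    and z_pos: "z > 0"
    and z_le: "z \<le> min (C * exp (- C * \<beta>)) (2 * C * exp (- 2 * C * \<beta>))"
    and T_ren_gen: "\<And>\<epsilon>. \<epsilon> > 0 \<Longrightarrow> generates C (L_ren z \<phi> \<epsilon>) (LC (2 * C)) (T_ren \<epsilon>)"
    and T_V_gen: "generates C (L_V z \<phi>) (LC (2 * C)) T_V"
  shows "(\<forall>\<epsilon>>0. \<forall>t\<ge>0. \<forall>G\<in>LC (2 * C).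
            LC_norm C (\<lambda>\<eta>. T_ren \<epsilon> t G \<eta> - T_V t G \<eta>)
              \<le> \<epsilon> * t * \<phi>bar * (1 + \<beta>) * LC_norm (2 * C) G)
       \<and> (\<forall>G\<in>LC C. \<forall>Tmax\<ge>0. \<forall>e>0. \<exists>\<delta>>0. \<forall>\<epsilon>. 0 < \<epsilon> \<and> \<epsilon> < \<delta> \<longrightarrow>
            (\<forall>t\<in>{0..Tmax}. LC_norm C (\<lambda>\<eta>. T_ren \<epsilon> t G \<eta> - T_V t G \<eta>) < e))"
proof -
  have phi_meas': "\<phi> \<in> borel_measurable borel" using phi_meas by simp
  have C: "1 \<le> C" "0 \<le> C" using C_gt by auto
  have phi_le: "\<phi> v \<le> \<phi>bar" for v
    unfolding phibar_def using phi_bdd by (intro cSUP_upper) auto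
  have bar_nonneg: "0 \<le> \<phi>bar" using phi_nonneg[of 0] phi_le[of 0] by linarith
  have z: "0 \<le> z" "z * exp (C * \<beta>) \<le> C" "z * exp (2 * C * \<beta>) \<le> 2 * C"
    using z_pos z_le by (auto simp: exp_minus field_simps)
  have KV: "birth_kernel \<phi> (\<lambda>_. 1) (\<lambda>v. - \<phi> v) \<beta>"
    using phi_nonneg phi_even phi_meas' phi_int beta_def by unfold_locales auto
  have beta_nonneg: "0 \<le> \<beta>" using KV by (rule birth_kernel.beta_nonneg)
  have Keps: "birth_kernel \<phi> (\<lambda>v. exp (- \<epsilon> * \<phi> v)) (\<lambda>v. (exp (- \<epsilon> * \<phi> v) - 1) / \<epsilon>) \<beta>" if \<epsilon>: "0 < \<epsilon>" for \<epsilon>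
  proof
    fix v
    have "exp (- \<epsilon> * \<phi> v) \<le> 1" using \<epsilon> phi_nonneg[of v] by simp
    moreover have "1 - exp (- \<epsilon> * \<phi> v) \<le> \<epsilon> * \<phi> v" using exp_ge_add_one_self[of "- \<epsilon> * \<phi> v"] by simp
    ultimately show "\<bar>(exp (- \<epsilon> * \<phi> v) - 1) / \<epsilon>\<bar> \<le> \<phi> v"
      using \<epsilon> by (simp add: abs_if field_simps)
  qed (use phi_nonneg phi_even phi_meas' phi_int beta_def \<epsilon> in auto)
  have part1: "LC_norm C (\<lambda>\<eta>. T_ren \<epsilon> t G \<eta> - T_V t G \<eta>) \<le> \<epsilon> * t * \<phi>bar * (1 + \<beta>) * LC_norm (2 * C) G"
    if \<epsilon>: "0 < \<epsilon>" and t: "0 \<le> t" and G: "G \<in> LC (2 * C)" for \<epsilon> t G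
  proof -
    have nn: "0 \<le> \<epsilon> * \<phi>bar" using \<epsilon> bar_nonneg by simp
    have "LC_norm C (\<lambda>\<eta>. T_ren \<epsilon> t G \<eta> - T_V t G \<eta>) \<le> t * (\<epsilon> * \<phi>bar) * LC_norm (2 * C) G"
      using T_ren_gen[OF \<epsilon>] T_V_gen unfolding L_ren_eq_gen L_V_eq_gen
    proof (intro semigroup_difference_le[OF KV Keps[OF \<epsilon>] C(1) z _ _ _ nn G t])
      fix u :: "'a set \<Rightarrow> real" assume u: "u \<in> LC (2 * C)"
      show "LC_norm C (\<lambda>\<eta>. gen z (\<lambda>v. exp (- \<epsilon> * \<phi> v)) (\<lambda>v. (exp (- \<epsilon> * \<phi> v) - 1) / \<epsilon>) u \<eta>
          - gen z (\<lambda>_. 1) (\<lambda>v. - \<phi> v) u \<eta>) \<le> \<epsilon> * \<phi>bar * LC_norm (2 * C) u"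
        by (rule LC_norm_gen_diff_kernel_le[OF Keps[OF \<epsilon>] KV exp_kernel_diff_le[OF phi_nonneg phi_le \<epsilon>] nn u C(1) z])
    qed
    \<comment> \<open>The bounds on \<open>z\<close> have already absorbed \<open>\<beta>\<close>;
      the factor \<open>1 + \<beta>\<close> of the claim enters as a number that is at least
      1.\<close>
    also have "\<dots> \<le> t * (\<epsilon> * \<phi>bar) * LC_norm (2 * C) G * (1 + \<beta>)"
      using mult_left_mono[of 1 "1 + \<beta>" "t * (\<epsilon> * \<phi>bar) * LC_norm (2 * C) G"] t nn beta_nonneg
      by (simp add: LC_norm_nonneg)
    finally show ?thesis by (simp add: ac_simps)
  qed
  have part2: "\<exists>\<delta>>0. \<forall>\<epsilon>. 0 < \<epsilon> \<and> \<epsilon> < \<delta> \<longrightarrow>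
      (\<forall>t\<in>{0..Tmax}. LC_norm C (\<lambda>\<eta>. T_ren \<epsilon> t G \<eta> - T_V t G \<eta>) < e)"
    if G: "G \<in> LC C" and Tmax: "0 \<le> Tmax" and e: "0 < e" for G Tmax e
  proof -
    \<comment> \<open>Three errors below \<open>e / 4\<close> will occur: two from replacing
      \<open>G\<close> by its cutoff under contractions, one from the rate at the cutoff.\<close>
    have "0 < e / 4" using e by simp
    from order_tendstoD(2)[OF LC_norm_diff_cutoff_tendsto[OF G C(2)] this]
    obtain m where m: "LC_norm C (\<lambda>\<eta>. G \<eta> - cutoff m G \<eta>) < e / 4"
      by (auto simp: eventually_sequentially)
    define H where "H = cutoff m G"
    have H: "H \<in> LC (2 * C)" unfolding H_def by (rule cutoff_in_LC[OF G C(2)])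
    have HC: "H \<in> LC C" using C by (intro LC_antimono[OF H]) auto
    \<comment> \<open>The rate at \<open>H\<close> with \<open>t\<close> bounded by
      \<open>Tmax\<close>, which gives uniformity in \<open>t\<close>. The threshold for
      \<open>\<epsilon>\<close> uses \<open>K + 1\<close> because \<open>K\<close> may be 0.\<close>
    define K where "K = Tmax * \<phi>bar * (1 + \<beta>) * LC_norm (2 * C) H"
    have K: "0 \<le> K" unfolding K_def using Tmax bar_nonneg beta_nonneg by (simp add: LC_norm_nonneg)
    show ?thesis
    proof (intro exI[of _ "e / (4 * (K + 1))"] conjI allI impI ballI)
      show "0 < e / (4 * (K + 1))" using e K by simp
      fix \<epsilon> t assume \<epsilon>: "0 < \<epsilon> \<and> \<epsilon> < e / (4 * (K + 1))" and t: "t \<in> {0..Tmax}"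
      have sgs: "contraction_C0_semigroup C (T_ren \<epsilon>)" "contraction_C0_semigroup C T_V"
        using T_ren_gen \<epsilon> T_V_gen by (auto simp: generates_def)
      have t0: "0 \<le> t" using t by simp
      have "\<epsilon> * t * \<phi>bar * (1 + \<beta>) * LC_norm (2 * C) H = \<epsilon> * (t * (\<phi>bar * (1 + \<beta>) * LC_norm (2 * C) H))"
        by (simp add: ac_simps)
      also have "\<dots> \<le> \<epsilon> * (Tmax * (\<phi>bar * (1 + \<beta>) * LC_norm (2 * C) H))"
        using \<epsilon> t bar_nonneg beta_nonneg by (intro mult_left_mono mult_right_mono) (auto simp: LC_norm_nonneg)
      also have "\<dots> = \<epsilon> * K" by (simp add: K_def ac_simps)
      also have "\<dots> \<le> \<epsilon> * (K + 1)" using \<epsilon> by simp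
      also have "\<dots> < e / 4" using \<epsilon> K by (simp add: field_simps)
      finally have "LC_norm C (\<lambda>\<eta>. T_ren \<epsilon> t H \<eta> - T_V t H \<eta>) < e / 4"
        using part1[OF _ t0 H, of \<epsilon>] \<epsilon> by linarith
      moreover have "LC_norm C (\<lambda>\<eta>. T_ren \<epsilon> t G \<eta> - T_ren \<epsilon> t H \<eta>) < e / 4"
        using semigroup_contraction_diff[OF sgs(1) C(2) t0 G HC] m by (simp add: H_def)
      moreover have "LC_norm C (\<lambda>\<eta>. T_V t H \<eta> - T_V t G \<eta>) < e / 4"
        using semigroup_contraction_diff[OF sgs(2) C(2) t0 G HC] m LC_norm_minus_commute[of C "T_V t H" "T_V t G"]
        by (simp add: H_def)
      ultimately show "LC_norm C (\<lambda>\<eta>. T_ren \<epsilon> t G \<eta> - T_V t G \<eta>) < e"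
        using LC_norm_triangle[OF semigroup_in_LC[OF sgs(1) t0 G] semigroup_in_LC[OF sgs(1) t0 HC]
            semigroup_in_LC[OF sgs(2) t0 G] C(2)]
          LC_norm_triangle[OF semigroup_in_LC[OF sgs(1) t0 HC] semigroup_in_LC[OF sgs(2) t0 HC]
            semigroup_in_LC[OF sgs(2) t0 G] C(2)] e
        by linarith
    qed
  qed
  show ?thesis using part1 part2 by blast
qed

end
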